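(* Let $k\ge1$ be an integer and let $Bes^k$ be the Bessel process of dimension $k$ started at $0$. Let $\psi:[0,1]\to\mathbb{R}$ be positive and twice continuously differentiable on $[0,1]$, and let $\vartheta=\int_0^1\sqrt{\psi(t)}\,dt$. Then, as $\varepsilon\to0+$, $$ \mathsf{P}\{\|Bes^k\|_\psi\leq\varepsilon\}\sim \frac{2^{(k+3)/2}\,\psi^{k/8}(0)}{\sqrt\pi\, k\,\vartheta\,\psi^{k/8}(1)}\, \varepsilon\, \exp\left(-\frac{k^2\vartheta^2}{8}\varepsilon^{-2}\right). $$
   Context: For a process $X(t)$, $0\le t\le 1$, and a non-negative weight $\psi$ on $[0,1]$, $\|X\|_\psi=\left(\int_0^1X^2(t)\psi(t)\,dt\right)^{1/2}$. $Bes^k$ is the radial part $\left(\sum_{i=1}^kW_i^2(t)\right)^{1/2}$ of a $k$-dimensional Brownian motion with independent standard components $W_1,\dots,W_k$ started at $0$. The notation $f(\varepsilon)\sim g(\varepsilon)$ means $f(\varepsilon)/g(\varepsilon)\to1$. $\psi^{a}(t)$ means $(\psi(t))^{a}$. *)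

theory Defs
  imports "HOL-Probability.Probability" "HOL-Library.Landau_Symbols"
begin

text \<open>
  Continuity is required of every path, not only of almost every path, so that the small ball
  event is measurable although \<open>M\<close> need not be complete.
\<close>

locale std_brownian_motion = prob_space M for M :: "'a measure" +
  fixes W :: "real \<Rightarrow> 'a \<Rightarrow> real"
  assumes rv: "\<And>t. t \<in> {0..1} \<Longrightarrow> random_variable borel (W t)"
    and start: "AE \<omega> in M. W 0 \<omega> = 0"
    and indep_increments:
      "\<And>(t :: nat \<Rightarrow> real) n. strict_mono_on {..n} t \<Longrightarrow> t ` {..n} \<subseteq> {0..1} \<Longrightarrow>
         indep_vars (\<lambda>_. borel) (\<lambda>i \<omega>. W (t (Suc i)) \<omega> - W (t i) \<omega>) {..<n}"
    and normal_increments: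
      "\<And>s t. 0 \<le> s \<Longrightarrow> s < t \<Longrightarrow> t \<le> 1 \<Longrightarrow>
         distributed M lborel (\<lambda>\<omega>. W t \<omega> - W s \<omega>) (normal_density 0 (sqrt (t - s)))"
    and continuous_paths: "\<And>\<omega>. \<omega> \<in> space M \<Longrightarrow> continuous_on {0..1} (\<lambda>t. W t \<omega>)"

text \<open>
  The components are independent as processes: the paths are jointly independent random elements
  of the product space \<open>\<real>\<close> to the power \<open>[0,1]\<close>.
\<close>

locale multidim_brownian_motion = prob_space M for M :: "'a measure" +
  fixes k :: nat and W :: "nat \<Rightarrow> real \<Rightarrow> 'a \<Rightarrow> real"
  assumes components: "\<And>i. i \<in> {1..k} \<Longrightarrow> std_brownian_motion M (W i)"
    and indep_components:
      "indep_vars (\<lambda>_. \<Pi>\<^sub>M t\<in>{0..1}. borel) (\<lambda>i \<omega>. \<lambda>t\<in>{0..1::real}. W i t \<omega>) {1..k}"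

definition radial_part :: "nat \<Rightarrow> (nat \<Rightarrow> real \<Rightarrow> 'a \<Rightarrow> real) \<Rightarrow> real \<Rightarrow> 'a \<Rightarrow> real" where
  "radial_part k W t \<omega> = sqrt (\<Sum>i=1..k. (W i t \<omega>)\<^sup>2)"

definition weighted_L2_norm :: "(real \<Rightarrow> real) \<Rightarrow> (real \<Rightarrow> real) \<Rightarrow> real" where
  "weighted_L2_norm \<psi> x = sqrt (LBINT t:{0..1}. (x t)\<^sup>2 * \<psi> t)"

text \<open>Derivatives at the end points of the interval are one-sided.\<close>

definition C2_on_unit_interval :: "(real \<Rightarrow> real) \<Rightarrow> bool" where
  "C2_on_unit_interval f \<longleftrightarrow>
     (\<exists>f' f''. (\<forall>t\<in>{0..1}. (f has_real_derivative f' t) (at t within {0..1})) \<and>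
               (\<forall>t\<in>{0..1}. (f' has_real_derivative f'' t) (at t within {0..1})) \<and>
               continuous_on {0..1} f'')"

end

theory Submission
  imports Defs "HOL-Real_Asymp.Real_Asymp"
begin

text \<open>
  Write \<open>S\<close> for the squared norm, \<open>A = \<psi>\<^bsup>-1/4\<^esup>\<close> and \<open>R\<close> for the Bessel process. For a positive \<open>\<phi>\<close>
  with \<open>\<phi>'' = q \<phi>\<close>, \<open>q \<ge> 0\<close> and \<open>\<phi>'(1) \<le> 0\<close>, integrating out Gaussian increments backwards shows
  that \<open>exp (\<phi>'(1) R(1)\<^sup>2 / (2 \<phi>(1)) - (1/2) \<integral> q R\<^sup>2)\<close> has expectation \<open>(\<phi>(1) / \<phi>(0))\<^bsup>k/2\<^esup>\<close>.
  The Liouville functions \<open>\<phi> = A (cosh (l r) - (\<kappa> / l) sinh (l r))\<close> with \<open>r(t) = \<integral>\<^sub>t\<^sup>1 \<surd>\<psi>\<close> satisfy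
  \<open>\<phi>'' = (A'' / A + l\<^sup>2 \<psi>) \<phi>\<close> exactly, so this is the Laplace transform, in \<open>l\<^sup>2 / 2\<close>, of \<open>S\<close> under a
  measure whose density involves only \<open>\<integral> (A'' / A) R\<^sup>2\<close>, which is \<open>O(S)\<close>, and \<open>R(1)\<^sup>2\<close>.

  For \<open>\<kappa> = - K\<close> with \<open>K\<close> large the terminal factor is at most 1, and up to the constant
  \<open>(A(1) / A(0))\<^bsup>k/2\<^esup>\<close> the transform depends on \<open>\<psi>\<close> only through \<open>\<theta>\<close>; hence the distribution can be replaced
  by that of the constant weight \<open>\<theta>\<^sup>2\<close>. On both sides, dropping the terminal factor costs
  \<open>O(x exp (- k\<^sup>2 \<theta>\<^sup>2 / (8 x)))\<close> on the event \<open>S \<le> x\<close>, by an exponential Chebyshev inequality; this is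
  smaller than the main term by a factor \<open>\<surd>x\<close>. For the constant weight the binomial series of
  \<open>(cosh (l \<theta>))\<^bsup>-k/2\<^esup>\<close> expresses the distribution function of \<open>S\<close> through Gaussian tails.
\<close>

section \<open>Riemann sums and Gaussian walks\<close>

text \<open>A general weight gives no closed form for the transform of \<open>S\<close> itself, and
  a Tauberian argument would recover only the logarithm of a probability that decays exponentially
  in 1/x. Hence equality of transforms is arranged exactly, under a tilted measure, and carried over
  to distribution functions by uniqueness; only then are inequalities used. The choice \<kappa> = -
  A'(1) A(1) removes the terminal factor, but it differs from weight to weight, so the transforms
  would not be proportional; one \<open>K\<close> at least |A'(1) A(1)| serves both weights, and the
  terminal factor has to be removed afterwards. \<open>A'' / A\<close> may have any sign; it is
  dominated by \<open>L\<^sup>2\<close> times the weight, which costs only factors exp (O(x)) on S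
  \<le> x. With a = k \<theta> / 2 the optimal Chebyshev exponent is - a^2 / (2 x), the same as in
  the main term, and the relative gap O(1 / l) between the transforms, at l = a / x, supplies the
  factor x. Uniqueness holds almost everywhere; monotonicity makes the final bounds
  pointwise.\<close>

lemma mvt_within_unit:
  fixes f f' :: "real \<Rightarrow> real"
  assumes "\<And>t. t \<in> {0..1} \<Longrightarrow> (f has_real_derivative f' t) (at t within {0..1})"
    and "0 \<le> a" "a < b" "b \<le> 1"
  obtains x where "a < x" "x < b" "f b - f a = (b - a) * f' x"
proof -
  have "\<exists>x\<in>{a<..<b}. f b - f a = f' x * (b - a)"
  proof (rule mvt_simple)
    fix x assume "a \<le> x" "x \<le> b"
    then have "(f has_real_derivative f' x) (at x within {a..b})"
      using assms by (intro DERIV_subset[OF assms(1)]) auto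
    then show "(f has_derivative (*) (f' x)) (at x within {a..b})"
      by (simp add: has_field_derivative_def)
  qed fact
  then show ?thesis using that by (auto simp: mult.commute)
qed

text \<open>In the main application \<open>G n i\<close> contains a discretised coefficient, only
  uniformly close to its limit on the grid. Index 0 is left out because the second differences
  behind \<open>G\<close> need a neighbour on both sides; the missing term is O(1/n). The limit is
  identified through a telescoping sum of an antiderivative.\<close>

lemma riemann_sum_tendsto_perturbed:
  fixes g :: "real \<Rightarrow> real" and G :: "nat \<Rightarrow> nat \<Rightarrow> real"
  assumes g: "continuous_on {0..1} g"
    and G: "\<And>e. e > 0 \<Longrightarrow> \<forall>\<^sub>F n in sequentially. \<forall>i\<in>{1..<n}. \<bar>G n i - g (real i / real n)\<bar> \<le> e"
  shows "(\<lambda>n. (\<Sum>i=1..<n. G n i) / real n) \<longlonglongrightarrow> (LBINT t:{0..1}. g t)"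
proof -
  obtain F where F: "\<And>t. t \<in> {0..1} \<Longrightarrow> (F has_vector_derivative g t) (at t within {0..1})"
    using antiderivative_continuous[OF g] by metis
  have F': "\<And>t. t \<in> {0..1} \<Longrightarrow> (F has_real_derivative g t) (at t within {0..1})"
    using F by (simp add: has_real_derivative_iff_has_vector_derivative)
  have int: "(LBINT t:{0..1}. g t) = F 1 - F 0"
    unfolding set_lebesgue_integral_def
    by (rule integral_FTC_atLeastAtMost) (use F g in auto)
  obtain B where B: "\<And>t. t \<in> {0..1} \<Longrightarrow> \<bar>g t\<bar> \<le> B"
    using compact_imp_bounded[OF compact_continuous_image[OF g]] unfolding bounded_iff by force
  have uc: "uniformly_continuous_on {0..1} g"
    by (rule compact_uniformly_continuous) (use g in auto)
  have "\<exists>N. \<forall>n\<ge>N. \<bar>(\<Sum>i=1..<n. G n i) / real n - (F 1 - F 0)\<bar> < e" if e: "e > 0" for e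
  proof -
    obtain d where d: "d > 0" "\<And>s t. s \<in> {0..1} \<Longrightarrow> t \<in> {0..1} \<Longrightarrow> \<bar>s - t\<bar> < d \<Longrightarrow> \<bar>g s - g t\<bar> < e/4"
    proof -
      have "\<exists>d>0. \<forall>s\<in>{0..1}. \<forall>t\<in>{0..1}. dist s t < d \<longrightarrow> dist (g s) (g t) < e/4"
        using uc e unfolding uniformly_continuous_on_def
        by (auto dest!: spec[of _ "e/4"] simp: dist_commute)
      then show ?thesis using that unfolding dist_real_def by blast
    qed
    have "\<forall>\<^sub>F n in sequentially. 1 / real n < d" using d(1) by real_asymp
    moreover have "\<forall>\<^sub>F n in sequentially. B / real n < e/4" using that by real_asymp
    moreover have "\<forall>\<^sub>F n in sequentially. (n::nat) > 0" by (rule eventually_gt_at_top)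
    moreover have "\<forall>\<^sub>F n in sequentially. \<forall>i\<in>{1..<n}. \<bar>G n i - g (real i / real n)\<bar> \<le> e/4"
      by (intro G) (use e in simp)
    ultimately have "\<forall>\<^sub>F n in sequentially. \<bar>(\<Sum>i=1..<n. G n i) / real n - (F 1 - F 0)\<bar> < e"
    proof eventually_elim
      case (elim n)
      let ?t = "\<lambda>i. real i / real n"
      \<comment> \<open>The error \<open>e\<close> is split into quarters: one for uniform
        continuity, one for the omitted index 0, one for the perturbation.\<close>
      have mv: "\<bar>g (?t i) / n - (F (?t (Suc i)) - F (?t i))\<bar> \<le> (e/4)/n" if i: "i < n" for i
      proof -
        have le: "?t i < ?t (Suc i)" "0 \<le> ?t i" "?t (Suc i) \<le> 1" "?t (Suc i) - ?t i = 1 / n"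
          using elim i by (auto simp: divide_simps)
        obtain x where x: "?t i < x" "x < ?t (Suc i)" "F (?t (Suc i)) - F (?t i) = (1/n) * g x"
          using mvt_within_unit[OF F' le(2,1,3)] le(4) by metis
        have "0 \<le> x" "x \<le> 1" "?t i \<le> 1" "\<bar>?t i - x\<bar> < d"
          using x(1,2) le elim(1) by linarith+
        then have "\<bar>g (?t i) - g x\<bar> < e/4"
          using le by (intro d(2)) auto
        then have "\<bar>g (?t i) - g x\<bar> / n \<le> (e/4)/n" by (intro divide_right_mono) auto
        then show ?thesis unfolding x(3) by (simp add: abs_divide flip: diff_divide_distrib)
      qed
      have "F 1 - F 0 = (\<Sum>i<n. F (?t (Suc i)) - F (?t i))"
        using sum_lessThan_telescope[of "\<lambda>i. F (?t i)" n] elim by simp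
      moreover have "\<bar>(\<Sum>i<n. g (?t i) / n) - (\<Sum>i<n. F (?t (Suc i)) - F (?t i))\<bar> \<le> (\<Sum>i<n. (e/4)/n)"
        unfolding sum_subtractf[symmetric] by (intro order_trans[OF sum_abs] sum_mono mv) auto
      moreover have "(\<Sum>i<n. (e/4)/n) = e/4" using elim by simp
      moreover have "(\<Sum>i<n. g (?t i) / n) = g 0 / n + (\<Sum>i=1..<n. g (?t i) / n)"
        using elim by (simp add: lessThan_atLeast0 sum.atLeast_Suc_lessThan)
      moreover have "\<bar>g 0 / n\<bar> < e/4"
      proof -
        have "\<bar>g 0 / n\<bar> \<le> B / n" using B[of 0] by (auto simp: abs_divide divide_right_mono)
        then show ?thesis using elim by linarith
      qed
      moreover have "\<bar>(\<Sum>i=1..<n. G n i / n) - (\<Sum>i=1..<n. g (?t i) / n)\<bar> \<le> e/4"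
      proof -
        have "\<bar>(\<Sum>i=1..<n. G n i / n) - (\<Sum>i=1..<n. g (?t i) / n)\<bar> \<le> (\<Sum>i=1..<n. (e/4)/n)"
          unfolding sum_subtractf[symmetric]
          by (intro order_trans[OF sum_abs] sum_mono)
            (use elim in \<open>auto simp: divide_simps simp flip: diff_divide_distrib\<close>)
        also have "\<dots> \<le> (\<Sum>i<n. (e/4)/n)" using that by (intro sum_mono2) auto
        finally show ?thesis using elim by simp
      qed
      ultimately show ?case unfolding sum_divide_distrib using that by linarith
    qed
    then show ?thesis by (simp add: eventually_sequentially)
  qed
  then show ?thesis unfolding int LIMSEQ_def dist_real_def by blast
qed

text \<open>The mean value theorem is applied to
  \<open>g s = f (t + s) + f (t - s) - c * s^2\<close> and then to \<open>f'\<close>. The free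
  \<open>c\<close> serves two purposes: c = 0 gives the sign of the second difference, and
  \<open>c = f'' t\<close> its error. The intermediate \<open>s\<close> is harmless since it lies
  between 0 and \<open>h\<close>.\<close>

lemma second_difference:
  fixes f f' f'' :: "real \<Rightarrow> real"
  assumes f: "\<And>t. t \<in> {0..1} \<Longrightarrow> (f has_real_derivative f' t) (at t within {0..1})"
    and f': "\<And>t. t \<in> {0..1} \<Longrightarrow> (f' has_real_derivative f'' t) (at t within {0..1})"
    and h: "h > 0" "0 \<le> t - h" "t + h \<le> 1"
  obtains s x where "0 < s" "s < h" "\<bar>x - t\<bar> < h"
    "f (t + h) - 2 * f t + f (t - h) - c * h^2 = 2 * s * h * (f'' x - c)"
proof -
  define g where "g s = f (t + s) + f (t - s) - c * s^2" for s
  have "\<exists>s\<in>{0<..<h}. g h - g 0 = (f' (t + s) - f' (t - s) - 2 * c * s) * (h - 0)"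
  proof (rule mvt_simple[OF h(1)])
    fix s assume s: "0 \<le> s" "s \<le> h"
    have "((\<lambda>s. f (t + s)) has_real_derivative f' (t + s) * 1) (at s within {0..h})"
      by (rule DERIV_image_chain[where g="\<lambda>s. t + s", OF DERIV_subset[OF f], unfolded o_def])
        (use s h in \<open>auto intro!: derivative_eq_intros\<close>)
    moreover have "((\<lambda>s. f (t - s)) has_real_derivative f' (t - s) * (-1)) (at s within {0..h})"
      by (rule DERIV_image_chain[where g="\<lambda>s. t - s", OF DERIV_subset[OF f], unfolded o_def])
        (use s h in \<open>auto intro!: derivative_eq_intros\<close>)
    ultimately have "(g has_real_derivative (f' (t + s) - f' (t - s) - 2 * c * s)) (at s within {0..h})"
      unfolding g_def by (auto intro!: derivative_eq_intros)
    then show "(g has_derivative (*) (f' (t + s) - f' (t - s) - 2 * c * s)) (at s within {0..h})"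
      by (simp add: has_field_derivative_def)
  qed
  then obtain s where s: "0 < s" "s < h" "g h - g 0 = (f' (t + s) - f' (t - s) - 2 * c * s) * h"
    by auto
  obtain x where x: "t - s < x" "x < t + s" "f' (t + s) - f' (t - s) = ((t + s) - (t - s)) * f'' x"
    by (rule mvt_within_unit[OF f', of "t - s" "t + s"]) (use s h in auto)
  have "g h - g 0 = 2 * s * h * (f'' x - c)"
    unfolding s(3) x(3) by (simp add: algebra_simps)
  then have "f (t + h) - 2 * f t + f (t - h) - c * h^2 = 2 * s * h * (f'' x - c)"
    by (simp add: g_def)
  moreover have "\<bar>x - t\<bar> < h" using s x by linarith
  ultimately show ?thesis using that[of s x] s by blast
qed

text \<open>Completing the square: with D = 1 - c \<sigma>^2 the integrand is a constant times the
  normal density of mean c \<sigma>^2 x / D and variance \<sigma>^2 / D. Positivity of D is exactly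
  what makes it integrable.\<close>

lemma nn_integral_normal_exp_quadratic:
  fixes c \<sigma> x :: real
  assumes "\<sigma> > 0" "c * \<sigma>\<^sup>2 < 1"
  shows "(\<integral>\<^sup>+y. ennreal (exp (c / 2 * (x + y)\<^sup>2)) \<partial>density lborel (\<lambda>y. ennreal (normal_density 0 \<sigma> y)))
    = ennreal (1 / sqrt (1 - c * \<sigma>\<^sup>2) * exp (c / (1 - c * \<sigma>\<^sup>2) / 2 * x\<^sup>2))"
proof -
  define D where "D = 1 - c * \<sigma>\<^sup>2"
  define K where "K = 1 / sqrt D * exp (c / D / 2 * x\<^sup>2)"
  have D: "D > 0" using assms by (simp add: D_def)
  have K: "K \<ge> 0" using D by (simp add: K_def)
  have eq: "normal_density 0 \<sigma> y * exp (c / 2 * (x + y)\<^sup>2)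
      = K * normal_density (c * \<sigma>\<^sup>2 * x / D) (\<sigma> / sqrt D) y" for y
  proof -
    have "- (y\<^sup>2) / (2 * \<sigma>\<^sup>2) + c / 2 * (x + y)\<^sup>2
        = c / D / 2 * x\<^sup>2 + - ((y - c * \<sigma>\<^sup>2 * x / D)\<^sup>2 / (2 * (\<sigma>\<^sup>2 / D)))"
      (is "?l = ?r")
    proof -
      have "c * \<sigma>\<^sup>2 = 1 - D" by (simp add: D_def)
      then have "2 * \<sigma>\<^sup>2 * D * ?l = 2 * \<sigma>\<^sup>2 * D * ?r"
        using D assms by (simp add: field_simps) algebra
      then show ?thesis using D assms by simp
    qed
    moreover have "sqrt (2 * pi * \<sigma>\<^sup>2) = sqrt D * sqrt (2 * pi * (\<sigma>\<^sup>2 / D))"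
      using D by (simp flip: real_sqrt_mult)
    ultimately show ?thesis
      using D unfolding normal_density_def K_def
      by (simp add: power_divide flip: exp_add)
  qed
  have "(\<integral>\<^sup>+y. ennreal (exp (c / 2 * (x + y)\<^sup>2)) \<partial>density lborel (\<lambda>y. ennreal (normal_density 0 \<sigma> y)))
    = (\<integral>\<^sup>+y. ennreal K * ennreal (normal_density (c * \<sigma>\<^sup>2 * x / D) (\<sigma> / sqrt D) y) \<partial>lborel)"
    using K by (subst nn_integral_density)
      (simp_all only: eq ennreal_mult'[symmetric] normal_density_nonneg, simp_all)
  also have "\<dots> = ennreal K * 1"
    using D assms by (subst nn_integral_cmult) (auto simp: nn_integral_eq_integral)
  finally show ?thesis by (simp add: K_def D_def)
qed

text \<open>
  The coefficients \<open>c\<close> and \<open>q\<close> are read off from \<open>f\<close>, so that integrating out the last Gaussian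
  increment reproduces the same expression with one step less. At the index 0 the truncated
  subtraction \<open>0 - 1 = 0\<close> gives \<open>c 0 = 0\<close>; the value \<open>q 0\<close> is multiplied by an empty sum.
\<close>

lemma nn_integral_gaussian_walk:
  fixes f :: "nat \<Rightarrow> real" and d :: real
  defines "c \<equiv> \<lambda>i. (f i - f (i - 1)) / (d * f i)"
  defines "q \<equiv> \<lambda>i. (f (Suc i) - 2 * f i + f (i - 1)) / (d\<^sup>2 * f i)"
  assumes f: "\<And>i. f i > 0" and d: "d > 0"
  shows "(\<integral>\<^sup>+x. ennreal (exp (c n / 2 * (\<Sum>j<n. x j)\<^sup>2 - d / 2 * (\<Sum>i<n. q i * (\<Sum>j<i. x j)\<^sup>2)))
      \<partial>(\<Pi>\<^sub>M i\<in>{..<n}. density lborel (\<lambda>y. ennreal (normal_density 0 (sqrt d) y))))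
    = ennreal (sqrt (f n / f 0))"
proof (induction n)
  case 0
  show ?case using f[of 0] by (simp add: PiM_empty nn_integral_count_space_finite)
next
  case (Suc n)
  let ?N = "density lborel (\<lambda>y. ennreal (normal_density 0 (sqrt d) y))"
  let ?r = "\<lambda>n (x::nat\<Rightarrow>real). exp (c n / 2 * (\<Sum>j<n. x j)\<^sup>2 - d / 2 * (\<Sum>i<n. q i * (\<Sum>j<i. x j)\<^sup>2))"
  interpret N: prob_space ?N using d by (intro prob_space_normal_density) auto
  interpret product_sigma_finite "\<lambda>_::nat. ?N" by standard
  \<comment> \<open>Each integration contributes the factor
    \<open>1 / sqrt (f n / f (Suc n))\<close>, so the normalising constants telescope.\<close>
  have D: "1 - c (Suc n) * d = f n / f (Suc n)"
    using f[of "Suc n"] d by (simp add: c_def field_simps)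
  have D_pos: "f n / f (Suc n) > 0" using f by simp
  have lt: "c (Suc n) * d < 1" using D D_pos by linarith
  \<comment> \<open>A discrete Riccati equation for the logarithmic derivative \<open>c\<close> of
    \<open>f\<close>: dividing by \<open>1 - c (Suc n) * d\<close> turns the backward difference
    quotient at \<open>Suc n\<close> into the forward one at \<open>n\<close>, and
    \<open>d * q n\<close> is its distance from the backward one.\<close>
  have step: "c (Suc n) / (1 - c (Suc n) * d) - d * q n = c n"
    unfolding D using f[of n] f[of "Suc n"] d
    by (simp add: c_def q_def field_simps power2_eq_square)
  have meas [measurable]: "(\<lambda>x. ?r m x) \<in> borel_measurable (PiM {..<m} (\<lambda>_. ?N))" for m
  proof -
    have "(\<lambda>x. x j) \<in> measurable (PiM {..<m} (\<lambda>_. ?N)) ?N" if "j < m" for j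
      using that by (intro measurable_component_singleton) auto
    moreover have "measurable (PiM {..<m} (\<lambda>_. ?N)) ?N = borel_measurable (PiM {..<m} (\<lambda>_. ?N))"
      by (intro measurable_cong_sets) auto
    ultimately have "(\<lambda>x. \<Sum>j<i. x j) \<in> borel_measurable (PiM {..<m} (\<lambda>_. ?N))" if "i \<le> m" for i
      using that by (intro borel_measurable_sum) auto
    then show ?thesis by measurable
  qed
  have "(\<integral>\<^sup>+x. ennreal (?r (Suc n) x) \<partial>PiM {..<Suc n} (\<lambda>_. ?N))
    = (\<integral>\<^sup>+x. \<integral>\<^sup>+y. ennreal (?r (Suc n) (x(n := y))) \<partial>?N \<partial>PiM {..<n} (\<lambda>_. ?N))"
    unfolding lessThan_Suc by (subst product_nn_integral_insert) (auto simp flip: lessThan_Suc)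
  also have "\<dots> = (\<integral>\<^sup>+x. ennreal (1 / sqrt (f n / f (Suc n))) * ennreal (?r n x) \<partial>PiM {..<n} (\<lambda>_. ?N))"
  proof (rule nn_integral_cong)
    fix x :: "nat \<Rightarrow> real"
    define X where "X = (\<Sum>j<n. x j)"
    define Q where "Q = d / 2 * (\<Sum>i<n. q i * (\<Sum>j<i. x j)\<^sup>2)"
    have *: "(\<Sum>j<i. (x(n := y)) j) = (\<Sum>j<i. x j)" if "i \<le> n" for i y
      using that by (intro sum.cong) auto
    have "?r (Suc n) (x(n := y)) = exp (- Q - d / 2 * q n * X\<^sup>2) * exp (c (Suc n) / 2 * (X + y)\<^sup>2)" for y
      by (simp add: * X_def Q_def algebra_simps flip: exp_add)
    then have "(\<integral>\<^sup>+y. ennreal (?r (Suc n) (x(n := y))) \<partial>?N)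
      = ennreal (exp (- Q - d / 2 * q n * X\<^sup>2)) * (\<integral>\<^sup>+y. ennreal (exp (c (Suc n) / 2 * (X + y)\<^sup>2)) \<partial>?N)"
      by (subst nn_integral_cmult[symmetric]) (auto simp: ennreal_mult')
    also have "\<dots> = ennreal (exp (- Q - d / 2 * q n * X\<^sup>2)) *
        ennreal (1 / sqrt (1 - c (Suc n) * d) * exp (c (Suc n) / (1 - c (Suc n) * d) / 2 * X\<^sup>2))"
      using nn_integral_normal_exp_quadratic[of "sqrt d" "c (Suc n)" X] d lt by simp
    also have "c (Suc n) / (1 - c (Suc n) * d) = c n + d * q n" using step by simp
    also have "ennreal (exp (- Q - d / 2 * q n * X\<^sup>2)) *
        ennreal (1 / sqrt (1 - c (Suc n) * d) * exp ((c n + d * q n) / 2 * X\<^sup>2))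
       = ennreal (1 / sqrt (1 - c (Suc n) * d)) * ennreal (exp (c n / 2 * X\<^sup>2 - Q))"
    proof -
      have "exp (- Q - d / 2 * q n * X\<^sup>2) * exp ((c n + d * q n) / 2 * X\<^sup>2) = exp (c n / 2 * X\<^sup>2 - Q)"
        by (simp add: algebra_simps flip: exp_add)
      then show ?thesis using D_pos D
        by (simp add: ac_simps flip: ennreal_mult')
    qed
    finally show "(\<integral>\<^sup>+y. ennreal (?r (Suc n) (x(n := y))) \<partial>?N)
      = ennreal (1 / sqrt (f n / f (Suc n))) * ennreal (?r n x)"
      by (simp add: D X_def Q_def)
  qed
  also have "\<dots> = ennreal (1 / sqrt (f n / f (Suc n))) * ennreal (sqrt (f n / f 0))"
    unfolding Suc.IH[symmetric] by (rule nn_integral_cmult) measurable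
  also have "\<dots> = ennreal (sqrt (f (Suc n) / f 0))"
  proof -
    have "1 / sqrt (f n / f (Suc n)) * sqrt (f n / f 0) = sqrt (f (Suc n) / f 0)"
      using f[of n] f[of "Suc n"] f[of 0] by (simp add: real_sqrt_divide)
    moreover have "0 \<le> f n / f (Suc n)" "0 \<le> f n / f 0"
      using f by (simp_all add: less_imp_le)
    ultimately show ?thesis by (metis ennreal_mult divide_nonneg_nonneg real_sqrt_ge_zero zero_le_one)
  qed
  finally show ?case .
qed

lemma (in std_brownian_motion) expectation_exp_grid:
  fixes f :: "nat \<Rightarrow> real" and n :: nat
  defines "c \<equiv> (f n - f (n - 1)) * real n / f n"
  defines "q \<equiv> \<lambda>i. (f (Suc i) - 2 * f i + f (i - 1)) * (real n)\<^sup>2 / f i"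
  assumes f: "\<And>i. f i > 0" and n: "n > 0"
  shows "expectation (\<lambda>\<omega>. exp (c / 2 * (W 1 \<omega>)\<^sup>2
           - 1 / 2 * ((\<Sum>i=1..<n. q i * (W (real i / real n) \<omega>)\<^sup>2) / real n))) = sqrt (f n / f 0)"
proof -
  define X where "X i \<omega> = W (real (Suc i) / real n) \<omega> - W (real i / real n) \<omega>" for i \<omega>
  define r where "r x = exp ((f n - f (n - 1)) / ((1 / real n) * f n) / 2 * (\<Sum>j<n. x j)\<^sup>2
    - (1 / real n) / 2 * (\<Sum>i<n. (f (Suc i) - 2 * f i + f (i - 1)) / ((1 / real n)\<^sup>2 * f i)
        * (\<Sum>j<i. x j)\<^sup>2))" for x :: "nat \<Rightarrow> real"
  let ?N = "density lborel (\<lambda>y. ennreal (normal_density 0 (sqrt (1 / real n)) y))"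
  have Wm [measurable]: "W (real i / real n) \<in> borel_measurable M" if "i \<le> n" for i
    using that n by (intro rv) (auto simp: divide_simps)
  have Xm [measurable]: "X i \<in> borel_measurable M" if "i < n" for i
    unfolding X_def using that by (intro borel_measurable_diff Wm) auto
  have ind: "indep_vars (\<lambda>_. borel) X {..<n}"
    unfolding X_def by (rule indep_increments)
      (use n in \<open>auto simp: strict_mono_on_def divide_simps\<close>)
  have dX: "distr M borel (X i) = ?N" if "i < n" for i
  proof -
    have "distributed M lborel (X i)
        (normal_density 0 (sqrt (real (Suc i) / real n - real i / real n)))"
      unfolding X_def using that n by (intro normal_increments) (auto simp: divide_simps)
    moreover have "real (Suc i) / real n - real i / real n = 1 / real n"
      by (simp add: diff_divide_distrib[symmetric])
    moreover have "distr M borel (X i) = distr M lborel (X i)"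
      by (intro distr_cong) auto
    ultimately show ?thesis using distributed_distr_eq_density by metis
  qed
  have PiM: "distr M (\<Pi>\<^sub>M i\<in>{..<n}. borel) (\<lambda>\<omega>. \<lambda>i\<in>{..<n}. X i \<omega>) = (\<Pi>\<^sub>M i\<in>{..<n}. ?N)"
  proof -
    have "distr M (\<Pi>\<^sub>M i\<in>{..<n}. borel) (\<lambda>\<omega>. \<lambda>i\<in>{..<n}. X i \<omega>)
        = (\<Pi>\<^sub>M i\<in>{..<n}. distr M borel (X i))"
      using ind n by (subst indep_vars_iff_distr_eq_PiM'[symmetric]) auto
    also have "\<dots> = (\<Pi>\<^sub>M i\<in>{..<n}. ?N)" by (intro PiM_cong) (auto simp: dX)
    finally show ?thesis .
  qed
  have sum_m: "(\<lambda>x. \<Sum>j<i. x j) \<in> borel_measurable (\<Pi>\<^sub>M i\<in>{..<n}. borel :: real measure)"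
    if "i \<le> n" for i
    using that by (intro borel_measurable_sum measurable_component_singleton) auto
  have rm [measurable]: "r \<in> borel_measurable (\<Pi>\<^sub>M i\<in>{..<n}. borel)"
    unfolding r_def[abs_def]
    by (intro borel_measurable_exp[THEN measurable_compose_rev] borel_measurable_diff
        borel_measurable_times borel_measurable_sum borel_measurable_power borel_measurable_const sum_m) auto
  have "(\<integral>\<^sup>+\<omega>. ennreal (exp (c / 2 * (W 1 \<omega>)\<^sup>2
           - 1 / 2 * ((\<Sum>i=1..<n. q i * (W (real i / real n) \<omega>)\<^sup>2) / real n))) \<partial>M)
      = (\<integral>\<^sup>+\<omega>. ennreal (r (\<lambda>i\<in>{..<n}. X i \<omega>)) \<partial>M)"
  \<comment> \<open>Partial sums of increments recover \<open>W\<close> only where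
    \<open>W 0\<close> vanishes, which is an almost sure property.\<close>
  proof (rule nn_integral_cong_AE)
    show "AE \<omega> in M. ennreal (exp (c / 2 * (W 1 \<omega>)\<^sup>2
           - 1 / 2 * ((\<Sum>i=1..<n. q i * (W (real i / real n) \<omega>)\<^sup>2) / real n)))
        = ennreal (r (\<lambda>i\<in>{..<n}. X i \<omega>))"
      using start
    proof eventually_elim
      case (elim \<omega>)
      have X: "(\<Sum>j<i. (\<lambda>i\<in>{..<n}. X i \<omega>) j) = W (real i / real n) \<omega>" if "i \<le> n" for i
      proof -
        have "(\<Sum>j<i. (\<lambda>i\<in>{..<n}. X i \<omega>) j) = (\<Sum>j<i. X j \<omega>)"
          using that by (intro sum.cong) auto
        then show ?thesis
          using sum_lessThan_telescope[of "\<lambda>i. W (real i / real n) \<omega>" i] elim by (simp add: X_def)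
      qed
      let ?s = "\<lambda>i. (f (Suc i) - 2 * f i + f (i - 1)) / ((1 / real n)\<^sup>2 * f i)
        * (\<Sum>j<i. (\<lambda>i\<in>{..<n}. X i \<omega>) j)\<^sup>2"
      \<comment> \<open>The summand at index 0 carries the square of an empty sum; this removes the
        truncated coefficient there.\<close>
      have "(\<Sum>i<n. ?s i) = (\<Sum>i=1..<n. ?s i)"
        using n by (simp add: lessThan_atLeast0 sum.atLeast_Suc_lessThan)
      also have "\<dots> = (\<Sum>i=1..<n. q i * (W (real i / real n) \<omega>)\<^sup>2)"
        by (intro sum.cong refl, subst X) (auto simp: q_def power_divide)
      finally show ?case
        unfolding r_def using X[of n] n by (simp add: c_def)
    qed
  qed
  also have "\<dots> = (\<integral>\<^sup>+x. ennreal (r x) \<partial>distr M (\<Pi>\<^sub>M i\<in>{..<n}. borel) (\<lambda>\<omega>. \<lambda>i\<in>{..<n}. X i \<omega>))"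
    by (subst nn_integral_distr) (auto intro!: measurable_restrict)
  also have "\<dots> = ennreal (sqrt (f n / f 0))"
    unfolding PiM r_def using f n by (intro nn_integral_gaussian_walk) auto
  \<comment> \<open>For a nonnegative measurable function the Bochner integral is
    \<open>enn2real\<close> of the nonnegative one, so no separate integrability proof is
    needed.\<close>
  finally have "enn2real (\<integral>\<^sup>+\<omega>. ennreal (exp (c / 2 * (W 1 \<omega>)\<^sup>2
           - 1 / 2 * ((\<Sum>i=1..<n. q i * (W (real i / real n) \<omega>)\<^sup>2) / real n))) \<partial>M)
     = enn2real (ennreal (sqrt (f n / f 0)))" by simp
  moreover have "W 1 \<in> borel_measurable M" by (intro rv) auto
  ultimately show ?thesis
    using f[of n] f[of 0] by (subst integral_eq_nn_integral) auto
qed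

section \<open>Exponential functionals of the radial part\<close>

context multidim_brownian_motion
begin

lemma radial_part_squared: "(radial_part k W t \<omega>)\<^sup>2 = (\<Sum>i=1..k. (W i t \<omega>)\<^sup>2)"
  unfolding radial_part_def by (simp add: sum_nonneg)

lemma random_variable_radial_part:
  assumes "t \<in> {0..1}"
  shows "radial_part k W t \<in> borel_measurable M"
  unfolding radial_part_def[abs_def]
  using std_brownian_motion.rv[OF components] assms by measurable

lemma continuous_on_radial_part:
  assumes "\<omega> \<in> space M"
  shows "continuous_on {0..1} (\<lambda>t. radial_part k W t \<omega>)"
  unfolding radial_part_def
  by (intro continuous_intros std_brownian_motion.continuous_paths[OF components] assms) auto

lemma expectation_exp_grid:
  fixes f :: "nat \<Rightarrow> real" and n :: nat
  defines "c \<equiv> (f n - f (n - 1)) * real n / f n"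
  defines "q \<equiv> \<lambda>i. (f (Suc i) - 2 * f i + f (i - 1)) * (real n)\<^sup>2 / f i"
  assumes f: "\<And>i. f i > 0" and n: "n > 0"
  shows "expectation (\<lambda>\<omega>. exp (c / 2 * (radial_part k W 1 \<omega>)\<^sup>2
           - 1 / 2 * ((\<Sum>i=1..<n. q i * (radial_part k W (real i / real n) \<omega>)\<^sup>2) / real n)))
         = (f n / f 0) powr (real k / 2)"
proof -
  define Y where "Y x = exp (c / 2 * (x 1)\<^sup>2
    - 1 / 2 * ((\<Sum>i=1..<n. q i * (x (real i / real n))\<^sup>2) / real n))" for x :: "real \<Rightarrow> real"
  have grid: "real i / real n \<in> {0..1}" if "i \<in> {1..<n}" for i
    using that by (auto simp: divide_simps)
  have Ym: "Y \<in> borel_measurable (\<Pi>\<^sub>M t\<in>{0..1}. borel)"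
    unfolding Y_def[abs_def]
    by (intro borel_measurable_exp[THEN measurable_compose_rev] borel_measurable_diff
        borel_measurable_times borel_measurable_sum borel_measurable_power borel_measurable_const
        borel_measurable_divide measurable_component_singleton grid) auto
  \<comment> \<open>Independence is given for paths restricted to the unit interval;
    \<open>Y\<close> reads a path only at grid points, so it does not see the restriction.\<close>
  have Y_restrict: "Y (\<lambda>t\<in>{0..1}. W i t \<omega>) = Y (\<lambda>t. W i t \<omega>)" for i \<omega>
    unfolding Y_def using grid by (auto intro!: sum.cong)
  have "indep_vars (\<lambda>_. borel) (\<lambda>i \<omega>. Y (\<lambda>t\<in>{0..1}. W i t \<omega>)) {1..k}"
    by (rule indep_vars_compose2[OF indep_components]) (rule Ym)
  then have ind: "indep_vars (\<lambda>_. borel) (\<lambda>i \<omega>. Y (\<lambda>t. W i t \<omega>)) {1..k}"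
    by (simp add: Y_restrict)
  have E: "expectation (\<lambda>\<omega>. Y (\<lambda>t. W i t \<omega>)) = sqrt (f n / f 0)" if "i \<in> {1..k}" for i
    unfolding Y_def c_def q_def
    by (rule std_brownian_motion.expectation_exp_grid[OF components[OF that] f n])
  have pos: "f n / f 0 > 0" using f by simp
  \<comment> \<open>A non-integrable function has Bochner integral 0 by convention, whereas this
    expectation is positive.\<close>
  have int: "integrable M (\<lambda>\<omega>. Y (\<lambda>t. W i t \<omega>))" if "i \<in> {1..k}" for i
    using E[OF that] pos not_integrable_integral_eq by fastforce
  have "exp (c / 2 * (radial_part k W 1 \<omega>)\<^sup>2
           - 1 / 2 * ((\<Sum>i=1..<n. q i * (radial_part k W (real i / real n) \<omega>)\<^sup>2) / real n))
     = (\<Prod>i=1..k. Y (\<lambda>t. W i t \<omega>))" for \<omega>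
  proof -
    have "(\<Sum>i=1..<n. q i * (radial_part k W (real i / real n) \<omega>)\<^sup>2)
      = (\<Sum>i=1..k. \<Sum>j=1..<n. q j * (W i (real j / real n) \<omega>)\<^sup>2)"
      unfolding radial_part_squared sum_distrib_left by (rule sum.swap)
    then show ?thesis
      unfolding Y_def radial_part_squared exp_sum[symmetric, OF finite_atLeastAtMost]
      by (simp add: sum_subtractf sum_distrib_left sum_divide_distrib)
  qed
  then have "expectation (\<lambda>\<omega>. exp (c / 2 * (radial_part k W 1 \<omega>)\<^sup>2
           - 1 / 2 * ((\<Sum>i=1..<n. q i * (radial_part k W (real i / real n) \<omega>)\<^sup>2) / real n)))
     = (\<Prod>i=1..k. expectation (\<lambda>\<omega>. Y (\<lambda>t. W i t \<omega>)))"
    using indep_vars_lebesgue_integral[OF _ ind int] by simp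
  also have "\<dots> = sqrt (f n / f 0) ^ k" using E by simp
  also have "\<dots> = (f n / f 0) powr (real k / 2)"
    using pos f[of n] f[of 0] by (subst powr_realpow[symmetric]) (auto simp: powr_half_sqrt[symmetric] powr_powr)
  finally show ?thesis .
qed

text \<open>The grid formula is applied to samples of \<phi>, whose second difference quotients
  divided by \<phi> converge to \<open>q\<close>. The sign hypotheses serve dominated convergence:
  \<phi> is convex and nonincreasing, so the discrete coefficients have the right signs and all
  exponentials are at most 1.\<close>

lemma expectation_exp_quadratic:
  fixes \<phi> \<phi>' q :: "real \<Rightarrow> real"
  assumes \<phi>: "\<And>t. t \<in> {0..1} \<Longrightarrow> (\<phi> has_real_derivative \<phi>' t) (at t within {0..1})"
    and \<phi>': "\<And>t. t \<in> {0..1} \<Longrightarrow> (\<phi>' has_real_derivative q t * \<phi> t) (at t within {0..1})"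
    and pos: "\<And>t. t \<in> {0..1} \<Longrightarrow> \<phi> t > 0"
    and q: "continuous_on {0..1} q" "\<And>t. t \<in> {0..1} \<Longrightarrow> q t \<ge> 0"
    and le0: "\<phi>' 1 \<le> 0"
  shows "expectation (\<lambda>\<omega>. exp (\<phi>' 1 / \<phi> 1 / 2 * (radial_part k W 1 \<omega>)\<^sup>2
           - 1 / 2 * (LBINT t:{0..1}. q t * (radial_part k W t \<omega>)\<^sup>2)))
         = (\<phi> 1 / \<phi> 0) powr (real k / 2)" (is "expectation ?Z = _")
proof -
  \<comment> \<open>The grid formula asks for positivity at every index; \<open>min\<close> extends
    \<phi> constantly beyond 1, and only indices up to \<open>n\<close> matter.\<close>
  define f where "f n i = \<phi> (min (real i / real n) 1)" for n i :: nat
  define c where "c n = (f n n - f n (n - 1)) * real n / f n n" for n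
  define Q where "Q n i = (f n (Suc i) - 2 * f n i + f n (i - 1)) * (real n)\<^sup>2 / f n i" for n i
  define Z where "Z n \<omega> = exp (c n / 2 * (radial_part k W 1 \<omega>)\<^sup>2
           - 1 / 2 * ((\<Sum>i=1..<n. Q n i * (radial_part k W (real i / real n) \<omega>)\<^sup>2) / real n))" for n \<omega>
  have fpos: "f n i > 0" for n i
    unfolding f_def by (rule pos) auto
  have EZ: "expectation (Z n) = (f n n / f n 0) powr (real k / 2)" if "n > 0" for n
    unfolding Z_def[abs_def] c_def Q_def using fpos that by (rule expectation_exp_grid)
  have cont_\<phi>: "continuous_on {0..1} \<phi>"
    using \<phi> by (rule DERIV_continuous_on)
  have cont_\<phi>'': "continuous_on {0..1} (\<lambda>t. q t * \<phi> t)"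
    by (intro continuous_intros q cont_\<phi>)
  \<comment> \<open>Since q \<phi> is nonnegative, \<phi>' is nondecreasing, and its value at 1 is
    at most 0.\<close>
  have \<phi>'_le0: "\<phi>' t \<le> 0" if "t \<in> {0..1}" for t
  proof (cases "t = 1")
    case False
    then have t: "0 \<le> t" "t < 1" using that by auto
    obtain x where "t < x" "x < 1" "\<phi>' 1 - \<phi>' t = (1 - t) * (q x * \<phi> x)"
      by (rule mvt_within_unit[OF \<phi>' t]) auto
    moreover from this have "0 \<le> (1 - t) * (q x * \<phi> x)"
      using t by (intro mult_nonneg_nonneg q less_imp_le[OF pos]) auto
    ultimately show ?thesis using le0 by linarith
  qed (use le0 in simp)
  have f_in: "f n i = \<phi> (real i / real n)" if "i \<le> n" for n i
    using that by (auto simp: f_def min_def divide_simps)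
  have c_le0: "c n \<le> 0" for n
  proof (cases "n = 0")
    case False
    then have n: "0 \<le> real (n - 1) / real n" "real (n - 1) / real n < 1" by auto
    obtain x where x: "real (n - 1) / real n < x" "x < 1"
        "\<phi> 1 - \<phi> (real (n - 1) / real n) = (1 - real (n - 1) / real n) * \<phi>' x"
      by (rule mvt_within_unit[OF \<phi> n]) auto
    then have "\<phi> 1 - \<phi> (real (n - 1) / real n) \<le> 0"
      using n order.strict_trans1[OF n(1) x(1)]
      by (auto intro!: mult_nonneg_nonpos \<phi>'_le0)
    then show ?thesis using False fpos[of n n]
      by (simp add: c_def f_in divide_nonpos_pos mult_nonpos_nonneg)
  qed (simp add: c_def)
  have c_lim: "c \<longlonglongrightarrow> \<phi>' 1 / \<phi> 1"
  proof -
    have "((\<lambda>y. (\<phi> y - \<phi> 1) / (y - 1)) \<longlongrightarrow> \<phi>' 1) (at 1 within {0..1})"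
      using \<phi>[of 1] by (simp add: has_field_derivative_iff)
    moreover have "filterlim (\<lambda>n. 1 - 1 / real n) (at 1 within {0..1}) sequentially"
      unfolding filterlim_at
    proof
      show "\<forall>\<^sub>F n in sequentially. 1 - 1 / real n \<in> {0..1} \<and> 1 - 1 / real n \<noteq> 1"
        using eventually_gt_at_top[of 0] by eventually_elim (auto simp: divide_simps)
      show "(\<lambda>n. 1 - 1 / real n) \<longlonglongrightarrow> 1" by real_asymp
    qed
    ultimately have "(\<lambda>n. (\<phi> (1 - 1 / real n) - \<phi> 1) / ((1 - 1 / real n) - 1)) \<longlonglongrightarrow> \<phi>' 1"
      by (rule filterlim_compose)
    then have "(\<lambda>n. (\<phi> (1 - 1 / real n) - \<phi> 1) / ((1 - 1 / real n) - 1) / \<phi> 1) \<longlonglongrightarrow> \<phi>' 1 / \<phi> 1"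
      using pos[of 1] by (intro tendsto_divide tendsto_const) auto
    moreover have "\<forall>\<^sub>F n in sequentially.
        (\<phi> (1 - 1 / real n) - \<phi> 1) / ((1 - 1 / real n) - 1) / \<phi> 1 = c n"
      using eventually_gt_at_top[of 0]
    proof eventually_elim
      case (elim n)
      then have "1 - 1 / real n = real (n - 1) / real n"
        by (simp add: of_nat_diff diff_divide_distrib)
      then have "f n (n - 1) = \<phi> (1 - 1 / real n)" using f_in[of "n - 1" n] by simp
      moreover have "f n n = \<phi> 1" using elim by (simp add: f_in)
      ultimately show ?case using elim by (simp add: c_def divide_simps) (simp add: algebra_simps)
    qed
    ultimately show ?thesis by (rule Lim_transform_eventually)
  qed
  \<comment> \<open>Used with \<open>a = 0\<close> for the sign of \<open>Q n i\<close> and with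
    \<open>a\<close> the value of \<open>q\<close> at the grid point for uniform
    convergence.\<close>
  have Q: "\<exists>s x. 0 < s \<and> s < 1 / real n \<and> x \<in> {0..1} \<and> \<bar>x - real i / real n\<bar> < 1 / real n \<and>
      Q n i - a = 2 * s * real n * (q x * \<phi> x - a * \<phi> (real i / real n)) / \<phi> (real i / real n)"
    if i: "i \<in> {1..<n}" for n i a
  proof -
    define t where "t = real i / real n"
    define h where "h = 1 / real n"
    have n: "n > 0" using i by auto
    have h: "0 < h" "0 \<le> t - h" "t + h \<le> 1"
      using i by (auto simp: t_def h_def divide_simps)
    have f_eq: "f n (Suc i) = \<phi> (t + h)" "f n i = \<phi> t" "f n (i - 1) = \<phi> (t - h)"
      using i by (auto simp: f_in t_def h_def add_divide_distrib diff_divide_distrib of_nat_diff ac_simps)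
    obtain s x where sx: "0 < s" "s < h" "\<bar>x - t\<bar> < h"
      "\<phi> (t + h) - 2 * \<phi> t + \<phi> (t - h) - (a * \<phi> t) * h\<^sup>2 = 2 * s * h * (q x * \<phi> x - a * \<phi> t)"
      by (rule second_difference[OF \<phi> \<phi>' h]) auto
    have x01: "x \<in> {0..1}" using sx(3) h by auto
    have pt: "\<phi> t > 0" using fpos[of n i] f_eq by simp
    have "Q n i - a = (\<phi> (t + h) - 2 * \<phi> t + \<phi> (t - h) - (a * \<phi> t) * h\<^sup>2) / (h\<^sup>2 * \<phi> t)"
      using n pt unfolding Q_def f_eq by (simp add: h_def field_simps)
    also have "\<dots> = 2 * s * real n * (q x * \<phi> x - a * \<phi> t) / \<phi> t"
      unfolding sx(4) using n pt by (simp add: h_def field_simps power2_eq_square)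
    finally show ?thesis using sx x01 unfolding h_def t_def by blast
  qed
  have Q_nonneg: "Q n i \<ge> 0" if i: "i \<in> {1..<n}" for n i
  proof -
    obtain s x where sx: "0 < s" "x \<in> {0..1}"
      "Q n i - 0 = 2 * s * real n * (q x * \<phi> x - 0 * \<phi> (real i / real n)) / \<phi> (real i / real n)"
      using Q[OF i, of 0] by blast
    have "\<phi> (real i / real n) > 0" using fpos[of n i] i by (simp add: f_in)
    then show ?thesis using sx q(2)[of x] pos[of x]
      by (simp add: less_imp_le)
  qed
  obtain m where m: "m > 0" "\<And>t. t \<in> {0..1} \<Longrightarrow> m \<le> \<phi> t"
  proof -
    obtain x where x: "x \<in> {0..1}" "\<And>t. t \<in> {0..1} \<Longrightarrow> \<phi> x \<le> \<phi> t"
      using continuous_attains_inf[of "{0..1::real}" \<phi>] cont_\<phi> by auto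
    then show thesis using that[of "\<phi> x"] pos by auto
  qed
  have Q_lim: "\<forall>\<^sub>F n in sequentially. \<forall>i\<in>{1..<n}. \<bar>Q n i - q (real i / real n)\<bar> \<le> e" if e: "e > 0" for e
  proof -
    have uc: "uniformly_continuous_on {0..1} (\<lambda>t. q t * \<phi> t)"
      by (rule compact_uniformly_continuous) (use cont_\<phi>'' in auto)
    have "e * m / 2 > 0" using e m by simp
    then obtain d where d: "d > 0" "\<And>s t. s \<in> {0..1} \<Longrightarrow> t \<in> {0..1} \<Longrightarrow> dist t s < d \<Longrightarrow>
        dist (q t * \<phi> t) (q s * \<phi> s) < e * m / 2"
      using uc unfolding uniformly_continuous_on_def by metis
    have "\<forall>\<^sub>F n in sequentially. 1 / real n < d" using d(1) by real_asymp
    then show ?thesis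
    proof eventually_elim
      case (elim n)
      show ?case
      proof
        fix i assume i: "i \<in> {1..<n}"
        define t where "t = real i / real n"
        have t: "t \<in> {0..1}" using i by (auto simp: t_def divide_simps)
        obtain s x where sx: "0 < s" "s < 1 / real n" "x \<in> {0..1}" "\<bar>x - t\<bar> < 1 / real n"
          "Q n i - q t = 2 * s * real n * (q x * \<phi> x - q t * \<phi> t) / \<phi> t"
          using Q[OF i, of "q t"] unfolding t_def by blast
        have "\<bar>q x * \<phi> x - q t * \<phi> t\<bar> < e * m / 2"
          using d(2)[OF t sx(3)] sx(4) elim by (simp add: dist_real_def)
        moreover have "s * real n \<le> 1" using sx i by (simp add: field_simps)
        ultimately have "(s * real n) * \<bar>q x * \<phi> x - q t * \<phi> t\<bar> \<le> 1 * (e * m / 2)"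
          by (intro mult_mono) auto
        then have "2 * s * real n * \<bar>q x * \<phi> x - q t * \<phi> t\<bar> \<le> e * m" by (simp add: field_simps)
        also have "\<dots> \<le> e * \<phi> t" using m(2)[OF t] e by simp
        finally have "2 * s * real n * \<bar>q x * \<phi> x - q t * \<phi> t\<bar> / \<phi> t \<le> e"
          using pos[OF t] by (simp add: divide_simps)
        then show "\<bar>Q n i - q (real i / real n)\<bar> \<le> e"
          unfolding t_def[symmetric] sx(5) using sx(1) pos[OF t] by (simp add: abs_mult)
      qed
    qed
  qed
  have Rm: "radial_part k W 1 \<in> borel_measurable M"
    by (rule random_variable_radial_part) auto
  have Zm: "Z n \<in> borel_measurable M" for n
  proof -
    have "(\<lambda>\<omega>. (\<Sum>i=1..<n. Q n i * (radial_part k W (real i / real n) \<omega>)\<^sup>2) / real n) \<in> borel_measurable M"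
      by (intro borel_measurable_divide borel_measurable_sum borel_measurable_times
          borel_measurable_const borel_measurable_power random_variable_radial_part)
        (auto simp: divide_simps)
    then show ?thesis unfolding Z_def[abs_def] using Rm by measurable
  qed
  have Z_lim: "(\<lambda>n. Z n \<omega>) \<longlonglongrightarrow> ?Z \<omega>" if \<omega>: "\<omega> \<in> space M" for \<omega>
  proof -
    let ?R = "\<lambda>t. (radial_part k W t \<omega>)\<^sup>2"
    have R: "continuous_on {0..1} ?R"
      by (intro continuous_intros continuous_on_radial_part \<omega>)
    obtain B where B: "\<And>t. t \<in> {0..1} \<Longrightarrow> ?R t \<le> B" "B > 0"
    proof -
      obtain B where "\<And>t. t \<in> {0..1} \<Longrightarrow> \<bar>?R t\<bar> \<le> B"
        using compact_imp_bounded[OF compact_continuous_image[OF R]] unfolding bounded_iff by force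
      then show thesis using that[of "max B 1"] by fastforce
    qed
    have "(\<lambda>n. (\<Sum>i=1..<n. Q n i * ?R (real i / real n)) / real n)
        \<longlonglongrightarrow> (LBINT t:{0..1}. q t * ?R t)"
    proof (rule riemann_sum_tendsto_perturbed)
      show "continuous_on {0..1} (\<lambda>t. q t * ?R t)" by (intro continuous_intros q R)
      fix e :: real assume e: "e > 0"
      then have "e / B > 0" using B by simp
      from Q_lim[OF this] show "\<forall>\<^sub>F n in sequentially. \<forall>i\<in>{1..<n}.
          \<bar>Q n i * ?R (real i / real n) - q (real i / real n) * ?R (real i / real n)\<bar> \<le> e"
      proof eventually_elim
        case (elim n)
        show ?case
        proof
          fix i assume i: "i \<in> {1..<n}"
          define t where "t = real i / real n"
          have t: "t \<in> {0..1}" using i by (auto simp: t_def divide_simps)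
          have "\<bar>Q n i - q t\<bar> * ?R t \<le> e / B * B"
            using elim i B(1)[OF t] \<open>e / B > 0\<close> unfolding t_def by (intro mult_mono) auto
          then show "\<bar>Q n i * ?R (real i / real n) - q (real i / real n) * ?R (real i / real n)\<bar> \<le> e"
            using B(2) unfolding t_def[symmetric] by (simp add: abs_mult flip: left_diff_distrib)
        qed
      qed
    qed
    then show ?thesis unfolding Z_def by (intro tendsto_intros c_lim) auto
  qed
  have "(\<lambda>n. expectation (Z n)) \<longlonglongrightarrow> expectation ?Z"
  proof (rule integral_dominated_convergence[where w = "\<lambda>_. 1"])
    show "?Z \<in> borel_measurable M"
      by (rule borel_measurable_LIMSEQ_real[OF Z_lim Zm])
    show "AE \<omega> in M. (\<lambda>n. Z n \<omega>) \<longlonglongrightarrow> ?Z \<omega>" using Z_lim by simp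
    show "AE \<omega> in M. norm (Z n \<omega>) \<le> 1" for n
    proof (rule AE_I2)
      fix \<omega>
      have "c n / 2 * (radial_part k W 1 \<omega>)\<^sup>2 \<le> 0"
        using c_le0[of n] by (auto intro: mult_nonpos_nonneg)
      moreover have "0 \<le> (\<Sum>i=1..<n. Q n i * (radial_part k W (real i / real n) \<omega>)\<^sup>2) / real n"
        using Q_nonneg by (intro divide_nonneg_nonneg sum_nonneg mult_nonneg_nonneg) auto
      ultimately show "norm (Z n \<omega>) \<le> 1" unfolding Z_def by simp
    qed
  qed (use Zm in auto)
  moreover have "(\<lambda>n. expectation (Z n)) \<longlonglongrightarrow> (\<phi> 1 / \<phi> 0) powr (real k / 2)"
  proof (rule tendsto_eventually)
    show "\<forall>\<^sub>F n in sequentially. expectation (Z n) = (\<phi> 1 / \<phi> 0) powr (real k / 2)"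
      using eventually_gt_at_top[of 0] by eventually_elim (simp add: EZ f_in)
  qed
  ultimately show ?thesis by (rule LIMSEQ_unique)
qed

end

section \<open>Uniqueness of Laplace transforms\<close>

text \<open>All absolute moments on the unit interval are at most 1, so the exponential series may
  be integrated term by term. Hence moments determine the characteristic function, and with it the
  law.\<close>

lemma char_moment_series:
  assumes "real_distribution N" "AE x in N. 0 \<le> x \<and> x \<le> 1"
  shows "char N t = (\<Sum>n. (\<i> * t) ^ n / fact n * complex_of_real (LINT x|N. x ^ n))"
proof -
  interpret real_distribution N by fact
  have ae: "AE x in N. norm (x ^ n) \<le> 1" for n
    using assms(2) by eventually_elim (auto simp: power_le_one)
  have int: "integrable N (\<lambda>x. x ^ n)" for n
    by (rule integrable_const_bound[OF ae]) auto
  have m_le: "(LINT x|N. \<bar>x\<bar> ^ n) \<le> 1" for n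
  proof -
    have "(LINT x|N. \<bar>x\<bar> ^ n) \<le> (LINT x|N. 1)"
      using integrable_abs[OF int[of n]] ae[of n]
      by (intro integral_mono_AE) (auto simp: power_abs)
    then show ?thesis using prob_space by simp
  qed
  have "char N t = (CLINT x|N. (\<Sum>n. (\<i> * t * x) ^ n / fact n))"
    unfolding char_def by (simp add: exp_def scaleR_conv_of_real divide_inverse mult_ac)
  also have "\<dots> = (\<Sum>n. CLINT x|N. (\<i> * t * x) ^ n / fact n)"
  proof (rule integral_suminf)
    show "integrable N (\<lambda>x. (\<i> * complex_of_real t * complex_of_real x) ^ n / fact n)" for n
    proof -
      have "integrable N (\<lambda>x. (\<i> * complex_of_real t) ^ n / fact n * complex_of_real (x ^ n))"
        by (intro integrable_mult_right integrable_of_real int)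
      then show ?thesis by (simp add: power_mult_distrib mult_ac)
    qed
    have n: "norm ((\<i> * complex_of_real t * complex_of_real x) ^ n / fact n) = \<bar>t\<bar> ^ n / fact n * \<bar>x\<bar> ^ n" for x n
      by (simp add: norm_divide norm_power norm_mult power_mult_distrib)
    show "AE x in N. summable (\<lambda>n. norm ((\<i> * complex_of_real t * complex_of_real x) ^ n / fact n))"
    proof (rule AE_I2)
      fix x
      show "summable (\<lambda>n. norm ((\<i> * complex_of_real t * complex_of_real x) ^ n / fact n))"
        unfolding n using summable_exp[of "\<bar>t * x\<bar>"]
        by (simp add: abs_mult power_mult_distrib divide_inverse mult_ac)
    qed
    show "summable (\<lambda>n. LINT x|N. norm ((\<i> * complex_of_real t * complex_of_real x) ^ n / fact n))"
      unfolding n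
    proof (rule summable_comparison_test')
      show "summable (\<lambda>n. \<bar>t\<bar> ^ n / fact n)"
        using summable_exp[of "\<bar>t\<bar>"] by (simp add: divide_inverse mult_ac)
      fix n :: nat
      have "\<bar>t\<bar> ^ n / fact n * (LINT x|N. \<bar>x\<bar> ^ n) \<le> \<bar>t\<bar> ^ n / fact n * 1"
        by (intro mult_left_mono m_le) auto
      then show "norm (LINT x|N. \<bar>t\<bar> ^ n / fact n * \<bar>x\<bar> ^ n) \<le> \<bar>t\<bar> ^ n / fact n"
        by (simp add: abs_mult Bochner_Integration.integral_nonneg)
    qed
  qed
  also have "\<dots> = (\<Sum>n. (\<i> * t) ^ n / fact n * complex_of_real (LINT x|N. x ^ n))"
  proof (rule arg_cong[where f = suminf], rule ext)
    fix n
    have "(CLINT x|N. (\<i> * t * x) ^ n / fact n) = (CLINT x|N. (\<i> * t) ^ n / fact n * complex_of_real (x ^ n))"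
      by (simp add: power_mult_distrib mult_ac)
    also have "\<dots> = (\<i> * t) ^ n / fact n * (CLINT x|N. complex_of_real (x ^ n))"
      by (rule integral_mult_right_zero)
    also have "(CLINT x|N. complex_of_real (x ^ n)) = complex_of_real (LINT x|N. x ^ n)"
      by (rule integral_of_real) (rule int)
    finally show "(CLINT x|N. (\<i> * t * x) ^ n / fact n) = (\<i> * t) ^ n / fact n * complex_of_real (LINT x|N. x ^ n)" .
  qed
  finally show ?thesis .
qed

lemma real_distribution_unit_moments_unique:
  assumes "real_distribution N1" "AE x in N1. 0 \<le> x \<and> x \<le> 1"
    and "real_distribution N2" "AE x in N2. 0 \<le> x \<and> x \<le> 1"
    and "\<And>n. (LINT x|N1. x ^ n) = (LINT x|N2. x ^ n)"
  shows "N1 = N2"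
  by (rule Levy_uniqueness) (use assms in \<open>auto simp: char_moment_series\<close>)

text \<open>The substitution y = exp (- x) turns these integrals into moments on the unit interval.
  Positive and negative part of \<open>f\<close> have equal mass by the case n = 0; divided by it
  they become probability densities with equal moments, and \<open>- ln\<close> transports the
  equality of laws back. Zero mass is treated separately because it cannot be normalised.\<close>

lemma Lerch_aux:
  fixes f :: "real \<Rightarrow> real"
  assumes f: "integrable lborel f" and f0: "\<And>x. x < 0 \<Longrightarrow> f x = 0"
    and zero: "\<And>n::nat. (LINT x|lborel. exp (- real n * x) * f x) = 0"
  shows "AE x in lborel. f x = 0"
proof -
  define p where "p x = max 0 (f x)" for x
  define m where "m x = max 0 (- f x)" for x
  have fm [measurable]: "f \<in> borel_measurable borel" using f by (auto dest: borel_measurable_integrable)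
  have [measurable]: "p \<in> borel_measurable borel" "m \<in> borel_measurable borel"
    unfolding p_def m_def by measurable
  have pm_int: "integrable lborel p" "integrable lborel m"
    unfolding p_def m_def using f by (auto intro!: Bochner_Integration.integrable_max)
  have pm0: "p x \<ge> 0" "m x \<ge> 0" "x < 0 \<Longrightarrow> p x = 0" "x < 0 \<Longrightarrow> m x = 0" "f x = p x - m x" for x
    by (auto simp: p_def m_def f0)
  have e_int: "integrable lborel (\<lambda>x. exp (- real n * x) * g x)"
    if g: "integrable lborel g" "\<And>x. x < 0 \<Longrightarrow> g x = 0" for g n
  proof (rule Bochner_Integration.integrable_bound[OF g(1)])
    show "(\<lambda>x. exp (- real n * x) * g x) \<in> borel_measurable lborel"
      using borel_measurable_integrable[OF g(1)] by measurable
    show "AE x in lborel. norm (exp (- real n * x) * g x) \<le> norm (g x)"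
    proof (rule AE_I2)
      fix x show "norm (exp (- real n * x) * g x) \<le> norm (g x)"
        using g(2)[of x] by (cases "x < 0") (auto simp: abs_mult mult_left_le_one_le)
    qed
  qed
  have eq: "(LINT x|lborel. exp (- real n * x) * p x) = (LINT x|lborel. exp (- real n * x) * m x)" for n
    using zero[of n] e_int[OF pm_int(1)] e_int[OF pm_int(2)] pm0
    by (simp add: pm0(5) right_diff_distrib Bochner_Integration.integral_diff)
  define C where "C = (LINT x|lborel. p x)"
  have C: "(LINT x|lborel. m x) = C" using eq[of 0] by (simp add: C_def)
  have C0: "C \<ge> 0" unfolding C_def using pm0 by (intro Bochner_Integration.integral_nonneg) auto
  show ?thesis
  proof (cases "C = 0")
    case True
    have "AE x in lborel. p x = 0" "AE x in lborel. m x = 0"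
      using integral_nonneg_eq_0_iff_AE[OF pm_int(1)] integral_nonneg_eq_0_iff_AE[OF pm_int(2)]
        True C C_def pm0 by simp_all
    then show ?thesis by eventually_elim (simp add: pm0(5))
  next
    case False
    then have Cpos: "C > 0" using C0 by simp
    define D where "D g = density lborel (\<lambda>x. ennreal (g x / C))" for g :: "real \<Rightarrow> real"
    define E where "E g = distr (D g) borel (\<lambda>x. exp (- x))" for g :: "real \<Rightarrow> real"
    have D: "prob_space (D g)" "real_distribution (E g)" "AE x in E g. 0 \<le> x \<and> x \<le> 1"
        "(LINT x|E g. x ^ n) = (LINT x|lborel. exp (- real n * x) * g x) / C"
        "distr (E g) borel (\<lambda>x. - ln x) = D g"
      if g: "integrable lborel g" "\<And>x. g x \<ge> 0" "\<And>x. x < 0 \<Longrightarrow> g x = 0" "(LINT x|lborel. g x) = C" for g n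
    proof -
      have gm [measurable]: "g \<in> borel_measurable borel" using g(1) by (auto dest: borel_measurable_integrable)
      show P: "prob_space (D g)"
      proof
        have "emeasure (D g) (space (D g)) = (\<integral>\<^sup>+x. ennreal (g x / C) \<partial>lborel)"
          by (simp add: D_def emeasure_density)
        also have "\<dots> = ennreal (LINT x|lborel. g x / C)"
          using g Cpos by (intro nn_integral_eq_integral) auto
        finally show "emeasure (D g) (space (D g)) = 1" using g Cpos by simp
      qed
      have [simp]: "sets (D g) = sets borel" "space (D g) = UNIV" by (auto simp: D_def)
      have em [measurable]: "(\<lambda>x. exp (- x)) \<in> borel_measurable (D g)"
        unfolding D_def by measurable
      have "prob_space (E g)" unfolding E_def by (intro prob_space.prob_space_distr P em)
      then show "real_distribution (E g)"
        by (simp add: real_distribution_def real_distribution_axioms_def E_def)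
      have "AE x in D g. 0 \<le> x"
        unfolding D_def using g by (subst AE_density) (auto simp: not_less[symmetric])
      then show "AE x in E g. 0 \<le> x \<and> x \<le> 1"
        unfolding E_def by (subst AE_distr_iff) auto
      have "(LINT x|E g. x ^ n) = (LINT x|D g. exp (- x) ^ n)"
        unfolding E_def by (subst integral_distr) auto
      also have "\<dots> = (LINT x|lborel. g x / C * exp (- x) ^ n)"
        unfolding D_def using g Cpos by (subst integral_density) auto
      also have "\<dots> = (LINT x|lborel. exp (- real n * x) * g x / C)"
        by (intro Bochner_Integration.integral_cong) (auto simp: exp_of_nat_mult[symmetric] mult_ac)
      finally show "(LINT x|E g. x ^ n) = (LINT x|lborel. exp (- real n * x) * g x) / C" by simp
      have "distr (E g) borel (\<lambda>x. - ln x) = distr (D g) borel (\<lambda>x. x)"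
        unfolding E_def by (subst distr_distr) (auto simp: o_def)
      also have "\<dots> = D g" by (intro distr_id2) auto
      finally show "distr (E g) borel (\<lambda>x. - ln x) = D g" .
    qed
    have p: "integrable lborel p" "\<And>x. p x \<ge> 0" "\<And>x. x < 0 \<Longrightarrow> p x = 0" "(LINT x|lborel. p x) = C"
      using pm_int pm0 C_def by auto
    have m: "integrable lborel m" "\<And>x. m x \<ge> 0" "\<And>x. x < 0 \<Longrightarrow> m x = 0" "(LINT x|lborel. m x) = C"
      using pm_int pm0 C by auto
    have "E p = E m"
    proof (rule real_distribution_unit_moments_unique)
      fix n
      have "(LINT x|E p. x ^ n) = (LINT x|lborel. exp (- real n * x) * p x) / C"
        by (rule D(4)) (use p in auto)
      also have "\<dots> = (LINT x|lborel. exp (- real n * x) * m x) / C" by (simp only: eq)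
      also have "\<dots> = (LINT x|E m. x ^ n)"
        by (rule D(4)[symmetric]) (use m in auto)
      finally show "(LINT x|E p. x ^ n) = (LINT x|E m. x ^ n)" .
    qed (rule D(2,3); use p m in simp)+
    then have "D p = D m" using D(5)[OF p] D(5)[OF m] by simp
    then have "AE x in lborel. ennreal (p x / C) = ennreal (m x / C)"
      unfolding D_def by (intro sigma_finite_measure.density_unique[OF lborel.sigma_finite_measure_axioms]) auto
    then show ?thesis
      by eventually_elim (use Cpos in \<open>simp add: pm0 divide_nonneg_pos ennreal_inj\<close>)
  qed
qed

text \<open>The factor \<open>exp (- s * x)\<close> is absorbed into the function to make it
  integrable; after that the arguments s, s + 1, s + 2, ... suffice.\<close>

lemma Lerch:
  fixes h :: "real \<Rightarrow> real"
  assumes int: "set_integrable lborel {0..} (\<lambda>x. exp (- s * x) * h x)"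
    and zero: "\<And>n::nat. (LBINT x:{0..}. exp (- (s + real n) * x) * h x) = 0"
  shows "AE x in lborel. x \<ge> 0 \<longrightarrow> h x = 0"
proof -
  define f where "f x = indicator {0..} x * (exp (- s * x) * h x)" for x :: real
  have "AE x in lborel. f x = 0"
  proof (rule Lerch_aux)
    show "integrable lborel f" using int by (simp add: set_integrable_def f_def[abs_def])
    show "f x = 0" if "x < 0" for x using that by (simp add: f_def)
    show "(LINT x|lborel. exp (- real n * x) * f x) = 0" for n
    proof -
      have "(LINT x|lborel. exp (- real n * x) * f x) = (LBINT x:{0..}. exp (- (s + real n) * x) * h x)"
        unfolding set_lebesgue_integral_def f_def
        by (intro Bochner_Integration.integral_cong)
          (auto simp: algebra_simps indicator_def simp flip: exp_add)
      then show ?thesis using zero by simp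
    qed
  qed
  then show ?thesis by eventually_elim (auto simp: f_def)
qed

text \<open>Fubini together with the integral of exp (- s x) over x \<ge> X, which is exp (- s X) /
  s. The weight \<open>Z\<close> is there for tilted measures. Working with nonnegative integrals
  yields integrability and value at once.\<close>

lemma (in prob_space) laplace_distribution_function:
  fixes Z X :: "'a \<Rightarrow> real" and s :: real
  assumes Z: "integrable M Z" "\<And>\<omega>. \<omega> \<in> space M \<Longrightarrow> Z \<omega> \<ge> 0"
    and X: "random_variable borel X" "\<And>\<omega>. \<omega> \<in> space M \<Longrightarrow> X \<omega> \<ge> 0"
    and s: "s > 0"
  defines "H \<equiv> \<lambda>x. expectation (\<lambda>\<omega>. Z \<omega> * indicator {..x} (X \<omega>))"
  shows "mono H"
    and "set_integrable lborel {0..} (\<lambda>x. exp (- s * x) * H x)"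
    and "(LBINT x:{0..}. exp (- s * x) * H x) = expectation (\<lambda>\<omega>. Z \<omega> * exp (- s * X \<omega>)) / s"
proof -
  have [measurable]: "Z \<in> borel_measurable M" "X \<in> borel_measurable M"
    using Z X by auto
  have intZ: "integrable M (\<lambda>\<omega>. Z \<omega> * indicator {..x} (X \<omega>))" for x
    by (rule Bochner_Integration.integrable_bound[OF Z(1)]) (auto simp: indicator_def)
  show "mono H"
    unfolding H_def by (intro monoI integral_mono intZ) (auto simp: indicator_def Z)
  then have Hm [measurable]: "H \<in> borel_measurable borel" by (rule borel_measurable_mono)
  have H0: "H x \<ge> 0" for x unfolding H_def using Z by (intro Bochner_Integration.integral_nonneg) auto
  interpret pair_sigma_finite M lborel by unfold_locales
  have "(\<integral>\<^sup>+x. ennreal (indicator {0..} x * (exp (- s * x) * H x)) \<partial>lborel)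
     = (\<integral>\<^sup>+x. \<integral>\<^sup>+\<omega>. ennreal (Z \<omega>) * (ennreal (exp (- s * x)) * indicator {X \<omega>..} x) \<partial>M \<partial>lborel)"
  proof (rule nn_integral_cong)
    fix x :: real
    have "ennreal (H x) = (\<integral>\<^sup>+\<omega>. ennreal (Z \<omega> * indicator {..x} (X \<omega>)) \<partial>M)"
      unfolding H_def using intZ Z by (subst nn_integral_eq_integral) auto
    then have "ennreal (indicator {0..} x * (exp (- s * x) * H x))
       = (\<integral>\<^sup>+\<omega>. ennreal (indicator {0..} x * exp (- s * x)) * ennreal (Z \<omega> * indicator {..x} (X \<omega>)) \<partial>M)"
      by (subst nn_integral_cmult) (auto simp: ennreal_mult' mult.assoc)
    \<comment> \<open>Because \<open>X\<close> is nonnegative, the condition x \<ge> 0 is implied by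
      x \<ge> X.\<close>
    also have "\<dots> = (\<integral>\<^sup>+\<omega>. ennreal (Z \<omega>) * (ennreal (exp (- s * x)) * indicator {X \<omega>..} x) \<partial>M)"
      using X(2) Z(2) by (intro nn_integral_cong) (auto simp: indicator_def mult_ac dest: order_trans)
    finally show "ennreal (indicator {0..} x * (exp (- s * x) * H x))
       = (\<integral>\<^sup>+\<omega>. ennreal (Z \<omega>) * (ennreal (exp (- s * x)) * indicator {X \<omega>..} x) \<partial>M)" .
  qed
  also have "\<dots> = (\<integral>\<^sup>+\<omega>. \<integral>\<^sup>+x. ennreal (Z \<omega>) * (ennreal (exp (- s * x)) * indicator {X \<omega>..} x) \<partial>lborel \<partial>M)"
  proof (rule Fubini')
    have "(\<lambda>(\<omega>, x). ennreal (Z \<omega>) * (ennreal (exp (- s * x)) * (if X \<omega> \<le> x then 1 else 0)))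
      \<in> borel_measurable (M \<Otimes>\<^sub>M lborel)" by measurable
    then show "(\<lambda>(\<omega>, x). ennreal (Z \<omega>) * (ennreal (exp (- s * x)) * indicator {X \<omega>..} x))
      \<in> borel_measurable (M \<Otimes>\<^sub>M lborel)"
      by (rule measurable_cong[THEN iffD1, rotated]) (auto simp: indicator_def)
  qed
  also have "\<dots> = (\<integral>\<^sup>+\<omega>. ennreal (Z \<omega> * exp (- s * X \<omega>) / s) \<partial>M)"
  proof (rule nn_integral_cong)
    fix \<omega> assume \<omega>: "\<omega> \<in> space M"
    have "(\<integral>\<^sup>+x. ennreal (exp (- s * x)) * indicator {X \<omega>..} x \<partial>lborel)
        = ennreal (0 - (- exp (- s * X \<omega>) / s))"
    proof (rule nn_integral_FTC_atLeast)
      show "((\<lambda>x. - exp (- s * x) / s) has_real_derivative exp (- s * x)) (at x)" for x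
        using s by (auto intro!: derivative_eq_intros)
      show "((\<lambda>x. - exp (- s * x) / s) \<longlongrightarrow> 0) at_top" using s by real_asymp
    qed auto
    then show "(\<integral>\<^sup>+x. ennreal (Z \<omega>) * (ennreal (exp (- s * x)) * indicator {X \<omega>..} x) \<partial>lborel)
       = ennreal (Z \<omega> * exp (- s * X \<omega>) / s)"
      using Z(2)[OF \<omega>] s by (subst nn_integral_cmult) (auto simp flip: ennreal_mult)
  qed
  also have "\<dots> = ennreal (expectation (\<lambda>\<omega>. Z \<omega> * exp (- s * X \<omega>) / s))"
  proof (rule nn_integral_eq_integral)
    have "integrable M (\<lambda>\<omega>. Z \<omega> * exp (- s * X \<omega>))"
      by (rule Bochner_Integration.integrable_bound[OF Z(1)])
        (use X s in \<open>auto simp: abs_mult mult_left_le intro!: AE_I2\<close>)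
    then show "integrable M (\<lambda>\<omega>. Z \<omega> * exp (- s * X \<omega>) / s)" by simp
  qed (use Z s in auto)
  finally have nn: "(\<integral>\<^sup>+x. ennreal (indicator {0..} x * (exp (- s * x) * H x)) \<partial>lborel)
     = ennreal (expectation (\<lambda>\<omega>. Z \<omega> * exp (- s * X \<omega>)) / s)" by simp
  have "has_bochner_integral lborel (\<lambda>x. indicator {0..} x * (exp (- s * x) * H x))
     (expectation (\<lambda>\<omega>. Z \<omega> * exp (- s * X \<omega>)) / s)"
    using nn H0 Z s by (intro has_bochner_integral_nn_integral) (auto intro!: Bochner_Integration.integral_nonneg)
  then show "set_integrable lborel {0..} (\<lambda>x. exp (- s * x) * H x)"
    and "(LBINT x:{0..}. exp (- s * x) * H x) = expectation (\<lambda>\<omega>. Z \<omega> * exp (- s * X \<omega>)) / s"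
    unfolding set_integrable_def set_lebesgue_integral_def has_bochner_integral_iff by auto
qed

section \<open>First passage times of Brownian motion\<close>

definition normal_tail :: "real \<Rightarrow> real" where
  "normal_tail y = 1 - cdf (density lborel (\<lambda>x. ennreal (std_normal_density x))) y"

lemma real_distribution_std_normal: "real_distribution (density lborel (\<lambda>x. ennreal (std_normal_density x)))"
  using prob_space_normal_density[of 1 0]
  by (simp add: real_distribution_def real_distribution_axioms_def)

lemma normal_tail_nonneg: "0 \<le> normal_tail y"
proof -
  interpret real_distribution "density lborel (\<lambda>x. ennreal (std_normal_density x))"
    by (rule real_distribution_std_normal)
  show ?thesis using cdf_bounded_prob[of y] by (simp add: normal_tail_def)
qed

lemma tendsto_normal_tail_at_top: "(normal_tail \<longlongrightarrow> 0) at_top"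
proof -
  interpret real_distribution "density lborel (\<lambda>x. ennreal (std_normal_density x))"
    by (rule real_distribution_std_normal)
  show ?thesis unfolding normal_tail_def[abs_def]
    using tendsto_diff[OF tendsto_const cdf_lim_at_top_prob, of 1] by simp
qed

lemma tendsto_normal_tail_at_bot: "(normal_tail \<longlongrightarrow> 1) at_bot"
proof -
  interpret real_distribution "density lborel (\<lambda>x. ennreal (std_normal_density x))"
    by (rule real_distribution_std_normal)
  show ?thesis unfolding normal_tail_def[abs_def]
    using tendsto_diff[OF tendsto_const cdf_lim_at_bot, of 1] by simp
qed

lemma DERIV_std_normal_density:
  "(std_normal_density has_real_derivative - y * std_normal_density y) (at y)"
proof -
  have "((\<lambda>x. exp (- x\<^sup>2 / 2)) has_real_derivative exp (- y\<^sup>2 / 2) * (- y)) (at y)"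
    by (auto intro!: derivative_eq_intros)
  from DERIV_cmult[OF this, of "1 / sqrt (2 * pi)"] show ?thesis
    unfolding std_normal_density_def[abs_def] by (rule DERIV_cong) simp
qed

lemma DERIV_normal_tail: "(normal_tail has_real_derivative - std_normal_density y) (at y)"
proof -
  let ?N = "density lborel (\<lambda>x. ennreal (std_normal_density x))"
  interpret real_distribution ?N by (rule real_distribution_std_normal)
  have cont: "continuous_on A std_normal_density" for A
    by (rule DERIV_continuous_on[OF has_field_derivative_at_within[OF DERIV_std_normal_density]])
  have "\<exists>G. \<forall>x::real. (-\<infinity>::ereal) < ereal x \<longrightarrow> ereal x < \<infinity> \<longrightarrow>
      (G has_vector_derivative std_normal_density x) (at x)"
    by (rule einterval_antiderivative) (simp_all add: DERIV_isCont[OF DERIV_std_normal_density])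
  then obtain G where G: "\<And>x. (G has_vector_derivative std_normal_density x) (at x)" by auto
  have inc: "cdf ?N b - cdf ?N a = G b - G a" if "a < b" for a b
  proof -
    have "cdf ?N b - cdf ?N a = measure ?N {a<..b}" by (rule cdf_diff_eq[OF that])
    also have "\<dots> = measure ?N {a..b}"
    proof (rule measure_eq_AE)
      have "AE x in ?N. x \<noteq> a"
        using AE_lborel_singleton[of a] by (subst AE_density) (auto elim: eventually_mono)
      then show "AE x in ?N. x \<in> {a<..b} \<longleftrightarrow> x \<in> {a..b}"
        by (rule eventually_mono) auto
    qed auto
    also have "\<dots> = (LINT x|lborel. indicator {a..b} x *\<^sub>R std_normal_density x)"
    proof -
      have "emeasure ?N {a..b} = (\<integral>\<^sup>+x. ennreal (indicator {a..b} x *\<^sub>R std_normal_density x) \<partial>lborel)"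
        by (subst emeasure_density) (auto intro!: nn_integral_cong simp: indicator_def)
      also have "\<dots> = ennreal (LINT x|lborel. indicator {a..b} x *\<^sub>R std_normal_density x)"
        by (intro nn_integral_eq_integral integrable_mult_indicator) auto
      finally show ?thesis by (simp add: measure_def Bochner_Integration.integral_nonneg)
    qed
    also have "\<dots> = G b - G a"
      by (rule integral_FTC_atLeastAtMost)
        (use that in \<open>simp_all add: has_vector_derivative_at_within[OF G] cont\<close>)
    finally show ?thesis .
  qed
  have "cdf ?N x = cdf ?N 0 - G 0 + G x" for x
  proof (cases x "0 :: real" rule: linorder_cases)
    case less
    then show ?thesis using inc[of x 0] by linarith
  next
    case greater
    then show ?thesis using inc[of 0 x] by linarith
  qed simp
  then have "normal_tail = (\<lambda>x. 1 - (cdf ?N 0 - G 0 + G x))"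
    unfolding normal_tail_def by (intro ext) (rule arg_cong)
  moreover have "((\<lambda>x. 1 - (cdf ?N 0 - G 0 + G x)) has_real_derivative - std_normal_density y) (at y)"
    using G[of y, folded has_real_derivative_iff_has_vector_derivative]
    by (auto intro!: derivative_eq_intros)
  ultimately show ?thesis by simp
qed

lemma tendsto_std_normal_density_at_top: "(std_normal_density \<longlongrightarrow> 0) at_top"
  unfolding std_normal_density_def[abs_def] by real_asymp

text \<open>Upper half of the Mills ratio estimate. The difference of the two sides tends to 0 at
  infinity and has derivative minus density over x^2, so it is positive before.\<close>

lemma normal_tail_less:
  assumes "y > 0"
  shows "normal_tail y < std_normal_density y / y"
proof -
  have "0 < std_normal_density y / y - normal_tail y"
  proof (rule DERIV_neg_imp_decreasing_at_top[of y])
    show "\<exists>d. ((\<lambda>y. std_normal_density y / y - normal_tail y) has_real_derivative d) (at x) \<and> d < 0"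
      if "x \<ge> y" for x
    proof -
      have x: "x > 0" using that assms by simp
      have "((\<lambda>y. std_normal_density y / y - normal_tail y) has_real_derivative
          (- x * std_normal_density x * x - std_normal_density x) / (x * x) + std_normal_density x) (at x)"
        by (rule derivative_eq_intros DERIV_std_normal_density DERIV_normal_tail refl | use x in simp)+
      moreover have "(- x * std_normal_density x * x - std_normal_density x) / (x * x) + std_normal_density x
          = - std_normal_density x / x\<^sup>2"
        using x by (simp add: field_simps power2_eq_square)
      ultimately show ?thesis using x normal_density_pos[of 1 0 x] by auto
    qed
    have "((\<lambda>y. std_normal_density y * (1 / y)) \<longlongrightarrow> 0 * 0) at_top"
      by (rule tendsto_mult[OF tendsto_std_normal_density_at_top]) real_asymp
    from tendsto_diff[OF this tendsto_normal_tail_at_top]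
    show "((\<lambda>y. std_normal_density y / y - normal_tail y) \<longlongrightarrow> 0) at_top" by simp
  qed
  then show ?thesis by simp
qed

text \<open>Lower half of the Mills ratio estimate, by the same monotonicity argument; here the
  derivative is minus 3 / x^4 times the density.\<close>

lemma normal_tail_greater:
  assumes "y > 0"
  shows "std_normal_density y * (1 / y - 1 / y ^ 3) < normal_tail y"
proof -
  let ?f = "\<lambda>y. normal_tail y - std_normal_density y * (1 / y - 1 / y ^ 3)"
  have "0 < ?f y"
  proof (rule DERIV_neg_imp_decreasing_at_top[of y])
    show "\<exists>d. (?f has_real_derivative d) (at x) \<and> d < 0" if "x \<ge> y" for x
    proof -
      have x: "x > 0" using that assms by simp
      have r: "((\<lambda>y. 1 / y - 1 / y ^ 3) has_real_derivative - 1 / x ^ 2 + 3 / x ^ 4) (at x)"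
        using x by (auto intro!: derivative_eq_intros simp: field_simps power2_eq_square eval_nat_numeral)
      have "(?f has_real_derivative - std_normal_density x -
          (- x * std_normal_density x * (1 / x - 1 / x ^ 3)
            + (- 1 / x ^ 2 + 3 / x ^ 4) * std_normal_density x)) (at x)"
        by (rule DERIV_diff DERIV_mult DERIV_std_normal_density DERIV_normal_tail r)+
      moreover have "- std_normal_density x -
          (- x * std_normal_density x * (1 / x - 1 / x ^ 3)
            + (- 1 / x ^ 2 + 3 / x ^ 4) * std_normal_density x) = - (3 / x ^ 4 * std_normal_density x)"
        using x by (simp add: field_simps eval_nat_numeral)
      moreover have "3 / x ^ 4 * std_normal_density x > 0" using x normal_density_pos[of 1 0 x] by simp
      ultimately show ?thesis by (metis neg_less_0_iff_less)
    qed
    have "((\<lambda>y. std_normal_density y * (1 / y - 1 / y ^ 3)) \<longlongrightarrow> 0 * 0) at_top"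
      by (rule tendsto_mult[OF tendsto_std_normal_density_at_top]) real_asymp
    from tendsto_diff[OF tendsto_normal_tail_at_top this] show "(?f \<longlongrightarrow> 0) at_top" by simp
  qed
  then show ?thesis by simp
qed

text \<open>The distribution function of the time at which a Brownian motion first reaches \<open>c > 0\<close>.\<close>

definition levy_cdf :: "real \<Rightarrow> real \<Rightarrow> real" where
  "levy_cdf c x = (if x > 0 then 2 * normal_tail (c / sqrt x) else 0)"

lemma levy_cdf_nonneg: "0 \<le> levy_cdf c x"
  by (simp add: levy_cdf_def normal_tail_nonneg)

text \<open>\<open>F\<close> is an explicit antiderivative. Integration by parts leaves the integral
  of exp (- s x) against the passage time density; by the Girsanov change of measure this is exp (-
  c l) times the passage time distribution of a Brownian motion with drift l, which is the sum of
  two Gaussian tails in \<open>F\<close>.\<close>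

lemma laplace_levy_cdf:
  assumes c: "c > 0" and s: "s > 0"
  shows "set_integrable lborel {0..} (\<lambda>x. exp (- s * x) * levy_cdf c x)"
    and "(LBINT x:{0..}. exp (- s * x) * levy_cdf c x) = exp (- c * sqrt (2 * s)) / s"
proof -
  define l where "l = sqrt (2 * s)"
  have l: "l > 0" and l2: "l\<^sup>2 = 2 * s" using s by (auto simp: l_def)
  define F where "F x = (exp (- c * l) * normal_tail (c / sqrt x - l * sqrt x)
    + exp (c * l) * normal_tail (c / sqrt x + l * sqrt x)) / s
    - exp (- s * x) / s * (2 * normal_tail (c / sqrt x))" for x
  have chain: "((\<lambda>x. normal_tail (g x)) has_real_derivative - std_normal_density (g x) * g') (at x)"
    if "(g has_real_derivative g') (at x)" for g g' x
    by (rule DERIV_chain2[OF DERIV_normal_tail that])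
  \<comment> \<open>The cross terms of the two squares cancel the prefactors exp (- c l) and exp (c
    l). Both densities become the same function, so the contributions of the drift to the derivative
    of \<open>F\<close> cancel.\<close>
  have dens: "exp (- c * l) * std_normal_density (c / sqrt x - l * sqrt x) = exp (- s * x) * std_normal_density (c / sqrt x)"
    "exp (c * l) * std_normal_density (c / sqrt x + l * sqrt x) = exp (- s * x) * std_normal_density (c / sqrt x)"
    if x: "x > 0" for x
  proof -
    have "(c / sqrt x - l * sqrt x)\<^sup>2 = (c / sqrt x)\<^sup>2 - 2 * (c * l) + 2 * (s * x)"
      "(c / sqrt x + l * sqrt x)\<^sup>2 = (c / sqrt x)\<^sup>2 + 2 * (c * l) + 2 * (s * x)"
      using x l l2 by (simp_all add: power2_diff power2_sum power_mult_distrib)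
    then show "exp (- c * l) * std_normal_density (c / sqrt x - l * sqrt x) = exp (- s * x) * std_normal_density (c / sqrt x)"
      "exp (c * l) * std_normal_density (c / sqrt x + l * sqrt x) = exp (- s * x) * std_normal_density (c / sqrt x)"
      unfolding std_normal_density_def by (simp_all add: field_simps flip: exp_add)
  qed
  have F: "(F has_real_derivative exp (- s * x) * levy_cdf c x) (at x)" if x: "x > 0" for x
  proof -
    define r where "r = sqrt x"
    have r: "r > 0" "x = r * r" using x by (auto simp: r_def)
    have g1: "((\<lambda>x. c / sqrt x) has_real_derivative - c / (2 * r ^ 3)) (at x)"
      using x by (auto intro!: derivative_eq_intros simp: r_def field_simps eval_nat_numeral)
    have g2: "((\<lambda>x. l * sqrt x) has_real_derivative l / (2 * r)) (at x)"
      using x by (auto intro!: derivative_eq_intros simp: r_def field_simps)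
    have e: "((\<lambda>x. exp (- s * x) / s) has_real_derivative - exp (- s * x)) (at x)"
      using s by (auto intro!: derivative_eq_intros)
    define d where "d = std_normal_density (c / sqrt x)"
    define d1 where "d1 = std_normal_density (c / sqrt x - l * sqrt x)"
    define d2 where "d2 = std_normal_density (c / sqrt x + l * sqrt x)"
    have "(F has_real_derivative
      (exp (- c * l) * (- d1 * (- c / (2 * r ^ 3) - l / (2 * r)))
       + exp (c * l) * (- d2 * (- c / (2 * r ^ 3) + l / (2 * r)))) / s
      - ((- exp (- s * x)) * (2 * normal_tail (c / sqrt x))
         + (2 * (- d * (- c / (2 * r ^ 3)))) * (exp (- s * x) / s))) (at x)"
      unfolding F_def[abs_def] d_def d1_def d2_def
      by (intro DERIV_diff DERIV_cdivide DERIV_add DERIV_cmult DERIV_mult chain g1 g2 e)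
    moreover have "(exp (- c * l) * (- d1 * (- c / (2 * r ^ 3) - l / (2 * r)))
       + exp (c * l) * (- d2 * (- c / (2 * r ^ 3) + l / (2 * r)))) / s
      - ((- exp (- s * x)) * (2 * normal_tail (c / sqrt x))
         + (2 * (- d * (- c / (2 * r ^ 3)))) * (exp (- s * x) / s)) = exp (- s * x) * levy_cdf c x"
    proof -
      have "exp (- c * l) * (- d1 * (- c / (2 * r ^ 3) - l / (2 * r)))
          = (exp (- c * l) * d1) * (c / (2 * r ^ 3) + l / (2 * r))"
        "exp (c * l) * (- d2 * (- c / (2 * r ^ 3) + l / (2 * r)))
          = (exp (c * l) * d2) * (c / (2 * r ^ 3) - l / (2 * r))"
        by (simp_all add: algebra_simps)
      then have "exp (- c * l) * (- d1 * (- c / (2 * r ^ 3) - l / (2 * r)))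
        + exp (c * l) * (- d2 * (- c / (2 * r ^ 3) + l / (2 * r))) = exp (- s * x) * d * (c / r ^ 3)"
        unfolding d1_def d2_def dens[OF x] d_def by (simp add: algebra_simps)
      then show ?thesis using x by (simp add: levy_cdf_def)
    qed
    ultimately show ?thesis by simp
  qed
  have F_lim: "(F \<longlongrightarrow> (exp (- c * l) * p + exp (c * l) * 0) / s - e / s * (2 * u)) net"
    if "((\<lambda>x. normal_tail (c / sqrt x - l * sqrt x)) \<longlongrightarrow> p) net"
      "((\<lambda>x. normal_tail (c / sqrt x + l * sqrt x)) \<longlongrightarrow> 0) net"
      "((\<lambda>x. exp (- s * x)) \<longlongrightarrow> e) net"
      "((\<lambda>x. normal_tail (c / sqrt x)) \<longlongrightarrow> u) net" for p e u net
    unfolding F_def[abs_def]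
    by (intro tendsto_diff tendsto_divide tendsto_add tendsto_mult tendsto_const that) (use s in simp_all)
  have lim0: "(F \<longlongrightarrow> 0) (at_right 0)"
  proof -
    have "(F \<longlongrightarrow> (exp (- c * l) * 0 + exp (c * l) * 0) / s - 1 / s * (2 * 0)) (at_right 0)"
    proof (rule F_lim)
      show "((\<lambda>x. normal_tail (c / sqrt x - l * sqrt x)) \<longlongrightarrow> 0) (at_right 0)"
        by (rule filterlim_compose[OF tendsto_normal_tail_at_top]) (use c in real_asymp)
      show "((\<lambda>x. normal_tail (c / sqrt x + l * sqrt x)) \<longlongrightarrow> 0) (at_right 0)"
        by (rule filterlim_compose[OF tendsto_normal_tail_at_top]) (use c in real_asymp)
      show "((\<lambda>x. normal_tail (c / sqrt x)) \<longlongrightarrow> 0) (at_right 0)"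
        by (rule filterlim_compose[OF tendsto_normal_tail_at_top]) (use c in real_asymp)
      show "((\<lambda>x. exp (- s * x)) \<longlongrightarrow> 1) (at_right 0)" by real_asymp
    qed
    then show ?thesis by simp
  qed
  have lim1: "(F \<longlongrightarrow> exp (- c * l) / s) at_top"
  proof -
    have "(F \<longlongrightarrow> (exp (- c * l) * 1 + exp (c * l) * 0) / s - 0 / s * (2 * normal_tail 0)) at_top"
    proof (rule F_lim)
      show "((\<lambda>x. normal_tail (c / sqrt x - l * sqrt x)) \<longlongrightarrow> 1) at_top"
        by (rule filterlim_compose[OF tendsto_normal_tail_at_bot]) (use l in real_asymp)
      show "((\<lambda>x. normal_tail (c / sqrt x + l * sqrt x)) \<longlongrightarrow> 0) at_top"
        by (rule filterlim_compose[OF tendsto_normal_tail_at_top]) (use l in real_asymp)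
      show "((\<lambda>x. normal_tail (c / sqrt x)) \<longlongrightarrow> normal_tail 0) at_top"
        by (rule isCont_tendsto_compose[OF DERIV_isCont[OF DERIV_normal_tail]]) real_asymp
      show "((\<lambda>x. exp (- s * x)) \<longlongrightarrow> 0) at_top" using s by real_asymp
    qed
    then show ?thesis by simp
  qed
  have cont: "isCont (\<lambda>x. exp (- s * x) * levy_cdf c x) x" if x: "x > 0" for x
  proof -
    have "((\<lambda>x. c / sqrt x) has_real_derivative - c / (2 * sqrt x ^ 3)) (at x)"
      using x by (auto intro!: derivative_eq_intros simp: field_simps eval_nat_numeral)
    note c1 = DERIV_isCont[OF chain[OF this]]
    have c2: "isCont (\<lambda>x. exp (- s * x)) x"
      by (rule DERIV_isCont[of _ "exp (- s * x) * - s"]) (auto intro!: derivative_eq_intros)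
    have "isCont (\<lambda>x. exp (- s * x) * (2 * normal_tail (c / sqrt x))) x"
      by (rule isCont_mult[OF c2 isCont_mult[OF continuous_const c1]])
    moreover have "\<forall>\<^sub>F y in nhds x. exp (- s * y) * levy_cdf c y = exp (- s * y) * (2 * normal_tail (c / sqrt y))"
      using eventually_nhds_in_open[of "{0<..}" x] x by (auto elim!: eventually_mono simp: levy_cdf_def)
    ultimately show ?thesis by (subst isCont_cong)
  qed
  have lim0': "((F \<circ> real_of_ereal) \<longlongrightarrow> 0) (at_right 0)"
    unfolding zero_ereal_def using lim0 by (simp only: ereal_tendsto_simps)
  have lim1': "((F \<circ> real_of_ereal) \<longlongrightarrow> exp (- c * l) / s) (at_left \<infinity>)"
    using lim1 by (simp only: ereal_tendsto_simps)
  have pos: "x > 0" if "0 < ereal x" for x using that by simp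
  have AE: "AE x in lborel. 0 < ereal x \<longrightarrow> ereal x < \<infinity> \<longrightarrow> 0 \<le> exp (- s * x) * levy_cdf c x"
    by (rule AE_I2) (simp add: levy_cdf_nonneg)
  note FTC = interval_integral_FTC_nonneg[of 0 \<infinity>, OF _ F[OF pos] cont[OF pos] AE lim0' lim1']
  have si: "set_integrable lborel {0<..} (\<lambda>x. exp (- s * x) * levy_cdf c x)"
    using FTC(1) by (simp add: zero_ereal_def)
  have "(LBINT x=0..\<infinity>. exp (- s * x) * levy_cdf c x) = exp (- c * l) / s - 0"
    using FTC(2) by simp
  then have i: "(LBINT x:{0<..}. exp (- s * x) * levy_cdf c x) = exp (- c * l) / s"
    by (simp add: interval_lebesgue_integral_def zero_ereal_def)
  have eq: "indicator {0..} x *\<^sub>R (exp (- s * x) * levy_cdf c x)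
      = indicator {0<..} x *\<^sub>R (exp (- s * x) * levy_cdf c x)" for x :: real
    by (auto simp: indicator_def levy_cdf_def)
  show "set_integrable lborel {0..} (\<lambda>x. exp (- s * x) * levy_cdf c x)"
    using si unfolding set_integrable_def eq .
  show "(LBINT x:{0..}. exp (- s * x) * levy_cdf c x) = exp (- c * sqrt (2 * s)) / s"
    using i unfolding set_lebesgue_integral_def eq l_def .
qed

section \<open>Inversion of powers of the hyperbolic cosine\<close>

lemma levy_cdf_le:
  assumes c: "c > 0" and x: "x > 0"
  shows "levy_cdf c x \<le> 2 * sqrt x / (c * sqrt (2 * pi)) * exp (- c\<^sup>2 / (2 * x))"
proof -
  have "normal_tail (c / sqrt x) \<le> std_normal_density (c / sqrt x) / (c / sqrt x)"
    using normal_tail_less[of "c / sqrt x"] assms by simp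
  also have "\<dots> = sqrt x / (c * sqrt (2 * pi)) * exp (- c\<^sup>2 / (2 * x))"
    using assms by (simp add: std_normal_density_def power_divide mult_ac)
  finally show ?thesis using x by (simp add: levy_cdf_def)
qed

text \<open>Convergence of the binomial series at the larger point (1 + z) / 2 gives absolute
  convergence at z.\<close>

lemma summable_abs_gbinomial:
  fixes a z :: real
  assumes "0 \<le> z" "z < 1"
  shows "summable (\<lambda>n. \<bar>a gchoose n\<bar> * z ^ n)"
proof -
  have "summable (\<lambda>n. (a gchoose n) * ((1 + z) / 2) ^ n)"
    by (rule sums_summable[OF gen_binomial_real]) (use assms in auto)
  from powser_insidea[OF this, of z] show ?thesis
    using assms by (simp add: abs_mult power_abs)
qed

text \<open>With z = exp (- 2 l \<theta>) the transform is 2^p exp (- p l \<theta>) (1 + z)^(-p), a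
  series in exp (- l \<theta> (p + 2 j)); divided by s = l^2 / 2 each term is the transform of a
  \<open>levy_cdf\<close>. Uniqueness gives the distribution function as the corresponding series,
  whose terms with j \<ge> 1 are smaller by an exponential in - 1 / x.\<close>

lemma (in prob_space) distribution_of_cosh_transform:
  fixes X :: "'a \<Rightarrow> real" and p \<theta> :: real
  assumes X: "random_variable borel X" "\<And>\<omega>. \<omega> \<in> space M \<Longrightarrow> X \<omega> \<ge> 0"
    and p: "p > 0" and \<theta>: "\<theta> > 0"
    and transform: "\<And>l. l > 0 \<Longrightarrow> expectation (\<lambda>\<omega>. exp (- (l\<^sup>2 / 2) * X \<omega>)) = cosh (l * \<theta>) powr (- p)"
  shows "\<exists>C. AE x in lborel. 0 < x \<and> x \<le> 1 \<longrightarrow>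
    \<bar>expectation (\<lambda>\<omega>. indicator {..x} (X \<omega>)) - 2 powr p * levy_cdf (p * \<theta>) x\<bar>
      \<le> C * x * exp (- (p * \<theta>)\<^sup>2 / (2 * x))"
proof -
  define a where "a = p * \<theta>"
  have a: "a > 0" using p \<theta> by (simp add: a_def)
  define B where "B j = 2 powr p * ((- p) gchoose j)" for j
  define c where "c j = \<theta> * (p + 2 * real j)" for j
  define H where "H x = expectation (\<lambda>\<omega>. 1 * indicator {..x} (X \<omega>) :: real)" for x
  define G where "G x = (\<Sum>j. B j * levy_cdf (c j) x)" for x
  define K where "K = 2 / (a * sqrt (2 * pi))"
  have K: "K > 0" using a by (simp add: K_def)
  \<comment> \<open>Dropping the term quadratic in j from the square of \<open>c j\<close> leaves a
    bound linear in j, so the Gaussian factors are dominated by a geometric sequence with ratio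
    \<open>r x\<close>.\<close>
  have c: "c j > 0" "c j \<ge> a" "(c j)\<^sup>2 \<ge> a\<^sup>2 + 4 * a * \<theta> * real j" for j
    using p \<theta> by (auto simp: c_def a_def algebra_simps power2_eq_square add_pos_nonneg)
  have B_summable: "summable (\<lambda>j. \<bar>B j\<bar> * z ^ j)" if "0 \<le> z" "z < 1" for z
    using summable_mult[OF summable_abs_gbinomial[OF that, of "- p"], of "2 powr p"]
    by (simp add: B_def abs_mult mult_ac)
  define r where "r x = exp (- 2 * a * \<theta> / x)" for x
  have r: "0 \<le> r x" "r x < 1" if "x > 0" for x
    using that a \<theta> by (auto simp: r_def)
  have levy_le: "levy_cdf (c j) x \<le> K * sqrt x * exp (- a\<^sup>2 / (2 * x)) * r x ^ j" if x: "x > 0" for j x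
  proof -
    have "levy_cdf (c j) x \<le> 2 * sqrt x / (c j * sqrt (2 * pi)) * exp (- (c j)\<^sup>2 / (2 * x))"
      by (rule levy_cdf_le[OF c(1) x])
    also have "\<dots> \<le> 2 * sqrt x / (a * sqrt (2 * pi)) * exp (- (a\<^sup>2 + 4 * a * \<theta> * real j) / (2 * x))"
    proof (intro mult_mono)
      show "2 * sqrt x / (c j * sqrt (2 * pi)) \<le> 2 * sqrt x / (a * sqrt (2 * pi))"
        using x a c[of j] by (intro divide_left_mono mult_right_mono) auto
      have "- (c j)\<^sup>2 / (2 * x) \<le> - (a\<^sup>2 + 4 * a * \<theta> * real j) / (2 * x)"
        by (intro divide_right_mono) (use x c(3)[of j] in auto)
      then show "exp (- (c j)\<^sup>2 / (2 * x)) \<le> exp (- (a\<^sup>2 + 4 * a * \<theta> * real j) / (2 * x))" by simp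
    qed (use x a in auto)
    also have "exp (- (a\<^sup>2 + 4 * a * \<theta> * real j) / (2 * x)) = exp (- a\<^sup>2 / (2 * x)) * r x ^ j"
      using x by (simp add: r_def field_simps flip: exp_add exp_of_nat_mult)
    finally show ?thesis by (simp add: K_def mult_ac)
  qed
  have levy_summable: "summable (\<lambda>j. \<bar>B j * levy_cdf (c j) x\<bar>)" for x
  proof (cases "x > 0")
    case True
    show ?thesis
    proof (rule summable_comparison_test')
      show "summable (\<lambda>j. K * sqrt x * exp (- a\<^sup>2 / (2 * x)) * (\<bar>B j\<bar> * r x ^ j))"
        by (intro summable_mult B_summable r True)
      show "norm \<bar>B j * levy_cdf (c j) x\<bar> \<le> K * sqrt x * exp (- a\<^sup>2 / (2 * x)) * (\<bar>B j\<bar> * r x ^ j)" for j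
        using mult_left_mono[OF levy_le[OF True, of j], of "\<bar>B j\<bar>"]
        by (simp add: abs_mult levy_cdf_nonneg mult_ac)
    qed
  qed (simp add: levy_cdf_def)
  have G_laplace: "set_integrable lborel {0..} (\<lambda>x. exp (- s * x) * G x)"
      "(LBINT x:{0..}. exp (- s * x) * G x) = cosh (sqrt (2 * s) * \<theta>) powr (- p) / s" if s: "s > 0" for s
  proof -
    define l where "l = sqrt (2 * s)"
    have l: "l > 0" using s by (simp add: l_def)
    define z where "z = exp (- 2 * l * \<theta>)"
    have z: "0 \<le> z" "z < 1" using l \<theta> by (auto simp: z_def)
    have e_c: "exp (- c j * l) = exp (- p * (l * \<theta>)) * z ^ j" for j
      by (simp add: z_def c_def algebra_simps flip: exp_add exp_of_nat_mult)
    have "(\<lambda>j. (2 powr p * exp (- p * (l * \<theta>)) / s) * (((- p) gchoose j) * z ^ j)) sums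
        ((2 powr p * exp (- p * (l * \<theta>)) / s) * (1 + z) powr (- p))"
      by (intro sums_mult gen_binomial_real) (use z in auto)
    moreover have "2 powr p * exp (- p * (l * \<theta>)) * (1 + z) powr (- p) = cosh (l * \<theta>) powr (- p)"
    proof -
      have cosh: "cosh (l * \<theta>) = exp (l * \<theta>) * (1 + z) / 2"
        by (simp add: cosh_field_def z_def algebra_simps flip: exp_add)
      have "cosh (l * \<theta>) powr (- p) = (exp (l * \<theta>) powr (- p) * (1 + z) powr (- p)) / 2 powr (- p)"
        unfolding cosh using z by (simp add: powr_divide powr_mult)
      also have "exp (l * \<theta>) powr (- p) = exp (- p * (l * \<theta>))" by (simp add: powr_def)
      finally show ?thesis by (simp add: powr_minus field_simps)
    qed
    moreover have "B j * (exp (- c j * l) / s)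
        = (2 powr p * exp (- p * (l * \<theta>)) / s) * (((- p) gchoose j) * z ^ j)" for j
      unfolding B_def e_c by (simp add: mult_ac)
    ultimately have sums: "(\<lambda>j. B j * (exp (- c j * l) / s)) sums (cosh (l * \<theta>) powr (- p) / s)"
      by (simp only: times_divide_eq_left)
    define f where "f j x = indicator {0..} x *\<^sub>R (exp (- s * x) * (B j * levy_cdf (c j) x))" for j and x :: real
    have lev: "integrable lborel (\<lambda>x. indicator {0..} x *\<^sub>R (exp (- s * x) * levy_cdf (c j) x))"
      "(LINT x|lborel. indicator {0..} x *\<^sub>R (exp (- s * x) * levy_cdf (c j) x)) = exp (- c j * l) / s" for j
      using laplace_levy_cdf[OF c(1) s, of j]
      by (simp_all add: set_integrable_def set_lebesgue_integral_def l_def)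
    have f_eq: "f j = (\<lambda>x. B j * (indicator {0..} x *\<^sub>R (exp (- s * x) * levy_cdf (c j) x)))" for j
      by (auto simp: f_def)
    have f_int: "integrable lborel (f j)" for j
      unfolding f_eq by (intro integrable_mult_right lev)
    have f_val: "(LINT x|lborel. f j x) = B j * (exp (- c j * l) / s)" for j
      unfolding f_eq by (simp only: integral_mult_right_zero lev)
    have f_norm: "(LINT x|lborel. norm (f j x)) = \<bar>B j\<bar> * (exp (- c j * l) / s)" for j
    proof -
      have "norm (f j x) = \<bar>B j\<bar> * (indicator {0..} x *\<^sub>R (exp (- s * x) * levy_cdf (c j) x))" for x
        by (auto simp: f_def abs_mult levy_cdf_nonneg indicator_def)
      then show ?thesis by (simp only: integral_mult_right_zero lev)
    qed
    have ae: "AE x in lborel. summable (\<lambda>j. norm (f j x))"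
    proof (rule AE_I2)
      fix x :: real
      show "summable (\<lambda>j. norm (f j x))"
        using summable_mult[OF levy_summable[of x], of "indicator {0..} x * exp (- s * x)"]
        by (simp add: f_def abs_mult mult_ac)
    qed
    have sn: "summable (\<lambda>j. LINT x|lborel. norm (f j x))"
      using summable_mult[OF B_summable[OF z], of "exp (- p * (l * \<theta>)) / s"]
      unfolding f_norm e_c by (simp add: mult_ac)
    have G_eq: "(\<lambda>x. \<Sum>j. f j x) = (\<lambda>x. indicator {0..} x *\<^sub>R (exp (- s * x) * G x))"
    proof
      fix x :: real
      have "(\<Sum>j. f j x) = (\<Sum>j. (indicator {0..} x * exp (- s * x)) * (B j * levy_cdf (c j) x))"
        by (simp add: f_def mult_ac)
      also have "\<dots> = (indicator {0..} x * exp (- s * x)) * G x"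
        unfolding G_def by (rule suminf_mult[OF summable_rabs_cancel[OF levy_summable]])
      finally show "(\<Sum>j. f j x) = indicator {0..} x *\<^sub>R (exp (- s * x) * G x)" by simp
    qed
    show "set_integrable lborel {0..} (\<lambda>x. exp (- s * x) * G x)"
      using integrable_suminf[OF f_int ae sn] unfolding G_eq set_integrable_def .
    have "(LBINT x:{0..}. exp (- s * x) * G x) = (\<Sum>j. B j * (exp (- c j * l) / s))"
      using integral_suminf[OF f_int ae sn] unfolding G_eq set_lebesgue_integral_def f_val .
    also have "\<dots> = cosh (l * \<theta>) powr (- p) / s" using sums by (rule sums_unique[symmetric])
    finally show "(LBINT x:{0..}. exp (- s * x) * G x) = cosh (sqrt (2 * s) * \<theta>) powr (- p) / s"
      by (simp add: l_def)
  qed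
  have H_laplace: "set_integrable lborel {0..} (\<lambda>x. exp (- s * x) * H x)"
      "(LBINT x:{0..}. exp (- s * x) * H x) = cosh (sqrt (2 * s) * \<theta>) powr (- p) / s" if s: "s > 0" for s
    using laplace_distribution_function(2,3)[of "\<lambda>_. 1", OF _ _ X s] transform[of "sqrt (2 * s)"] s
    by (simp_all add: H_def)
  have "AE x in lborel. x \<ge> 0 \<longrightarrow> H x - G x = 0"
  proof (rule Lerch[of 1])
    show "set_integrable lborel {0..} (\<lambda>x. exp (- 1 * x) * (H x - G x))"
      using set_integral_diff(1)[OF H_laplace(1) G_laplace(1), of 1 1] by (simp add: right_diff_distrib)
    show "(LBINT x:{0..}. exp (- (1 + real n) * x) * (H x - G x)) = 0" for n
    proof -
      have pos: "1 + real n > 0" by simp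
      show ?thesis
        by (simp only: right_diff_distrib set_integral_diff(2)[OF H_laplace(1)[OF pos] G_laplace(1)[OF pos]]
            H_laplace(2)[OF pos] G_laplace(2)[OF pos] diff_self)
    qed
  qed
  then have HG: "AE x in lborel. x \<ge> 0 \<longrightarrow> H x = G x" by simp
  \<comment> \<open>For x \<le> 1 the ratio \<open>r x\<close> is at most \<open>r 1\<close>, so one
    series controls the tail for all these x; the power of \<open>r x\<close> split off beforehand
    supplies the small factor.\<close>
  define S where "S = (\<Sum>j. \<bar>B (Suc j)\<bar> * r 1 ^ j)"
  have S_summable: "summable (\<lambda>j. \<bar>B (Suc j)\<bar> * r 1 ^ j)"
  proof -
    have "summable (\<lambda>j. inverse (r 1) * (\<bar>B (Suc j)\<bar> * r 1 ^ Suc j))"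
      using B_summable[OF r, of 1]
      by (intro summable_mult) (simp only: summable_Suc_iff[of "\<lambda>j. \<bar>B j\<bar> * r 1 ^ j"] zero_less_one)
    moreover have "inverse (r 1) * (\<bar>B (Suc j)\<bar> * r 1 ^ Suc j) = \<bar>B (Suc j)\<bar> * r 1 ^ j" for j
      by (simp add: r_def)
    ultimately show ?thesis by (simp only:)
  qed
  have S0: "S \<ge> 0" unfolding S_def using r(1)[of 1] by (intro suminf_nonneg S_summable) auto
  have tail: "\<bar>G x - 2 powr p * levy_cdf (p * \<theta>) x\<bar> \<le> (K * S / (2 * a * \<theta>)) * x * exp (- (p * \<theta>)\<^sup>2 / (2 * x))"
    if x: "0 < x" "x \<le> 1" for x
  proof -
    define E where "E = exp (- a\<^sup>2 / (2 * x))"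
    have r_le: "r x \<le> r 1" "r x \<le> x / (2 * a * \<theta>)"
    proof -
      have "2 * a * \<theta> \<le> 2 * a * \<theta> / x" using x a \<theta> by (simp add: pos_le_divide_eq mult_left_le)
      then show "r x \<le> r 1" by (simp add: r_def)
      \<comment> \<open>The crude bound u \<le> exp u suffices: only one factor x is wanted from the
        exponentially small ratio.\<close>
      have "2 * a * \<theta> / x \<le> exp (2 * a * \<theta> / x)" using exp_ge_add_one_self[of "2 * a * \<theta> / x"] by linarith
      then have "inverse (exp (2 * a * \<theta> / x)) \<le> inverse (2 * a * \<theta> / x)"
        using x a \<theta> by (intro le_imp_inverse_le) auto
      then show "r x \<le> x / (2 * a * \<theta>)" by (simp add: r_def exp_minus)
    qed
    have "G x = B 0 * levy_cdf (c 0) x + (\<Sum>j. B (Suc j) * levy_cdf (c (Suc j)) x)"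
      unfolding G_def using suminf_split_head[OF summable_rabs_cancel[OF levy_summable[of x]]] by simp
    moreover have "B 0 * levy_cdf (c 0) x = 2 powr p * levy_cdf (p * \<theta>) x"
      by (simp add: B_def c_def mult_ac)
    moreover have "\<bar>\<Sum>j. B (Suc j) * levy_cdf (c (Suc j)) x\<bar> \<le> (\<Sum>j. K * sqrt x * E * r x * (\<bar>B (Suc j)\<bar> * r 1 ^ j))"
    proof (rule order_trans[OF summable_rabs])
      show sm: "summable (\<lambda>j. \<bar>B (Suc j) * levy_cdf (c (Suc j)) x\<bar>)"
        using levy_summable[of x] by (subst (asm) summable_Suc_iff[symmetric])
      show "(\<Sum>j. \<bar>B (Suc j) * levy_cdf (c (Suc j)) x\<bar>) \<le> (\<Sum>j. K * sqrt x * E * r x * (\<bar>B (Suc j)\<bar> * r 1 ^ j))"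
      proof (rule suminf_le[OF _ sm summable_mult[OF S_summable]])
        fix j
        have "levy_cdf (c (Suc j)) x \<le> K * sqrt x * E * r x ^ Suc j"
          using levy_le[OF x(1), of "Suc j"] by (simp add: E_def)
        also have "\<dots> \<le> K * sqrt x * E * (r x * r 1 ^ j)"
          using r_le(1) r(1)[OF x(1)] K x by (intro mult_left_mono) (auto simp: E_def power_mono mult_left_mono)
        finally have "\<bar>B (Suc j)\<bar> * levy_cdf (c (Suc j)) x \<le> \<bar>B (Suc j)\<bar> * (K * sqrt x * E * (r x * r 1 ^ j))"
          by (intro mult_left_mono) auto
        then show "\<bar>B (Suc j) * levy_cdf (c (Suc j)) x\<bar> \<le> K * sqrt x * E * r x * (\<bar>B (Suc j)\<bar> * r 1 ^ j)"
          by (simp add: abs_mult levy_cdf_nonneg mult_ac)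
      qed
    qed
    moreover have "(\<Sum>j. K * sqrt x * E * r x * (\<bar>B (Suc j)\<bar> * r 1 ^ j)) = K * sqrt x * E * r x * S"
      unfolding S_def by (rule suminf_mult[OF S_summable])
    moreover have "K * sqrt x * E * r x * S \<le> K * 1 * E * (x / (2 * a * \<theta>)) * S"
      using K S0 r_le(2) r(1)[OF x(1)] x a \<theta>
      by (intro mult_right_mono mult_mono mult_left_mono) (auto simp: E_def)
    ultimately show ?thesis by (simp add: E_def a_def mult_ac)
  qed
  from HG have "AE x in lborel. 0 < x \<and> x \<le> 1 \<longrightarrow>
    \<bar>H x - 2 powr p * levy_cdf (p * \<theta>) x\<bar> \<le> (K * S / (2 * a * \<theta>)) * x * exp (- (p * \<theta>)\<^sup>2 / (2 * x))"
    by (rule eventually_mono) (use tail in auto)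
  then show ?thesis unfolding H_def mult_1 by (intro exI[of _ "K * S / (2 * a * \<theta>)"])
qed

section \<open>Liouville transformation\<close>

context multidim_brownian_motion
begin

definition quad :: "(real \<Rightarrow> real) \<Rightarrow> 'a \<Rightarrow> real" where
  "quad w \<omega> = (LBINT t:{0..1}. w t * (radial_part k W t \<omega>)\<^sup>2)"

lemma set_integrable_quad:
  assumes "continuous_on {0..1} w" "\<omega> \<in> space M"
  shows "set_integrable lborel {0..1} (\<lambda>t. w t * (radial_part k W t \<omega>)\<^sup>2)"
  by (intro borel_integrable_atLeastAtMost' continuous_intros assms continuous_on_radial_part)

lemma quad_add:
  assumes "continuous_on {0..1} v" "continuous_on {0..1} w" "\<omega> \<in> space M"
  shows "quad (\<lambda>t. v t + c * w t) \<omega> = quad v \<omega> + c * quad w \<omega>"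
proof -
  have "quad (\<lambda>t. v t + c * w t) \<omega> = (LBINT t:{0..1}. v t * (radial_part k W t \<omega>)\<^sup>2
      + c * (w t * (radial_part k W t \<omega>)\<^sup>2))"
    unfolding quad_def by (simp add: algebra_simps)
  also have "\<dots> = quad v \<omega> + c * quad w \<omega>"
    unfolding quad_def
    by (subst set_integral_add(2)) (simp_all add: set_integrable_quad assms)
  finally show ?thesis .
qed

lemma quad_mono:
  assumes "continuous_on {0..1} v" "continuous_on {0..1} w" "\<omega> \<in> space M"
    and "\<And>t. t \<in> {0..1} \<Longrightarrow> v t \<le> w t"
  shows "quad v \<omega> \<le> quad w \<omega>"
  unfolding quad_def
  by (rule set_integral_mono[OF set_integrable_quad set_integrable_quad])
    (auto intro!: mult_right_mono assms)

lemma borel_measurable_quad [measurable]: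
  assumes "continuous_on {0..1} w"
  shows "quad w \<in> borel_measurable M"
proof (rule borel_measurable_LIMSEQ_real)
  let ?f = "\<lambda>n \<omega>. (\<Sum>i=1..<n. w (real i / real n) * (radial_part k W (real i / real n) \<omega>)\<^sup>2) / real n"
  show "(\<lambda>n. ?f n \<omega>) \<longlonglongrightarrow> quad w \<omega>" if "\<omega> \<in> space M" for \<omega>
    unfolding quad_def
    by (rule riemann_sum_tendsto_perturbed)
      (auto intro!: continuous_intros assms continuous_on_radial_part that)
  show "?f n \<in> borel_measurable M" for n
    by (intro borel_measurable_divide borel_measurable_sum borel_measurable_times
        borel_measurable_const borel_measurable_power random_variable_radial_part)
      (auto simp: divide_simps)
qed

end

text \<open>
  The weight is \<open>1 / A\<^sup>4\<close>. The functions \<open>A C\<close>, where \<open>C\<close> is a hyperbolic function of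
  \<open>l \<integral> 1 / A\<^sup>2\<close>, solve \<open>\<phi>'' = (A'' / A + l\<^sup>2 / A\<^sup>4) \<phi>\<close> exactly.
\<close>

locale liouville_weight = multidim_brownian_motion M k W
  for M :: "'a measure" and k :: nat and W :: "nat \<Rightarrow> real \<Rightarrow> 'a \<Rightarrow> real" +
  fixes A A' A'' :: "real \<Rightarrow> real"
  assumes k_pos: "k \<ge> 1"
    and A_pos: "\<And>t. t \<in> {0..1} \<Longrightarrow> A t > 0"
    and A_deriv: "\<And>t. t \<in> {0..1} \<Longrightarrow> (A has_real_derivative A' t) (at t within {0..1})"
    and A'_deriv: "\<And>t. t \<in> {0..1} \<Longrightarrow> (A' has_real_derivative A'' t) (at t within {0..1})"
    and A''_cont: "continuous_on {0..1} A''"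
begin

definition "\<theta> = (LBINT t:{0..1}. 1 / (A t)\<^sup>2)"

definition "S = quad (\<lambda>t. 1 / A t ^ 4)"

definition "V = quad (\<lambda>t. A'' t / A t)"

text \<open>The logarithmic derivative at 1 of the Liouville solution with parameter \<kappa>. It
  does not depend on l, which is why the coefficient of sinh is \<kappa> / l; it vanishes for
  \<kappa> = - A'(1) A(1).\<close>

definition "slope \<kappa> = (A' 1 + \<kappa> / A 1) / A 1"

lemma A_cont: "continuous_on {0..1} A"
  using A_deriv by (rule DERIV_continuous_on)

lemma A_nz: "t \<in> {0..1} \<Longrightarrow> A t \<noteq> 0"
  using A_pos[of t] by simp

lemma weight_cont: "continuous_on {0..1} (\<lambda>t. 1 / A t ^ 4)"
  by (intro continuous_intros A_cont) (use A_nz in auto)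

lemma ratio_cont: "continuous_on {0..1} (\<lambda>t. A'' t / A t)"
  by (intro continuous_intros A_cont A''_cont) (use A_nz in auto)

lemma S_measurable [measurable]: "S \<in> borel_measurable M"
  unfolding S_def by (intro borel_measurable_quad weight_cont)

lemma V_measurable [measurable]: "V \<in> borel_measurable M"
  unfolding V_def by (intro borel_measurable_quad ratio_cont)

lemma R1_measurable [measurable]: "radial_part k W 1 \<in> borel_measurable M"
  by (rule random_variable_radial_part) auto

lemma S_nonneg: "\<omega> \<in> space M \<Longrightarrow> S \<omega> \<ge> 0"
  using quad_mono[of "\<lambda>_. 0" "\<lambda>t. 1 / A t ^ 4" \<omega>] weight_cont
  by (auto simp: S_def quad_def)

text \<open>The Liouville time is counted backwards from 1, so that the hyperbolic functions take
  trivial values at the end point, where the boundary condition is imposed.\<close>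

lemma primitive:
  "\<exists>r. (\<forall>t\<in>{0..1}. (r has_real_derivative - (1 / (A t)\<^sup>2)) (at t within {0..1}) \<and> r t \<ge> 0)
     \<and> r 1 = 0 \<and> r 0 = \<theta>"
proof -
  have cont: "continuous_on {0..1} (\<lambda>t. 1 / (A t)\<^sup>2)"
    by (intro continuous_intros A_cont) (use A_nz in auto)
  obtain F where F: "\<And>t. t \<in> {0..1} \<Longrightarrow> (F has_vector_derivative 1 / (A t)\<^sup>2) (at t within {0..1})"
    using antiderivative_continuous[OF cont] by metis
  have F': "\<And>t. t \<in> {0..1} \<Longrightarrow> (F has_real_derivative 1 / (A t)\<^sup>2) (at t within {0..1})"
    using F by (simp add: has_real_derivative_iff_has_vector_derivative)
  have int: "\<theta> = F 1 - F 0"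
    unfolding set_lebesgue_integral_def \<theta>_def
    by (rule integral_FTC_atLeastAtMost) (use F cont in auto)
  show ?thesis
  proof (intro exI[of _ "\<lambda>t. F 1 - F t"] conjI ballI)
    fix t :: real assume t: "t \<in> {0..1}"
    show "((\<lambda>t. F 1 - F t) has_real_derivative - (1 / (A t)\<^sup>2)) (at t within {0..1})"
      using F'[OF t] by (auto intro!: derivative_eq_intros)
    show "F 1 - F t \<ge> 0"
    proof (cases "t = 1")
      case False
      then have t': "0 \<le> t" "t < 1" using t by auto
      obtain x where "F 1 - F t = (1 - t) * (1 / (A x)\<^sup>2)"
        by (rule mvt_within_unit[OF F' t']) auto
      then show ?thesis using t' by simp
    qed simp
  qed (use int in auto)
qed

lemma \<theta>_pos: "\<theta> > 0"
proof -
  obtain r where *: "\<forall>t\<in>{0..1}. (r has_real_derivative - (1 / (A t)\<^sup>2)) (at t within {0..1}) \<and> r t \<ge> 0"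
    and r01: "r 1 = 0" "r 0 = \<theta>" using primitive by auto
  then have r: "\<And>t. t \<in> {0..1} \<Longrightarrow> (r has_real_derivative - (1 / (A t)\<^sup>2)) (at t within {0..1})" by simp
  obtain x where x: "0 < x" "x < 1" "r 1 - r 0 = (1 - 0) * - (1 / (A x)\<^sup>2)"
    by (rule mvt_within_unit[OF r, of 0 1]) auto
  then show ?thesis using r01 A_pos[of x] by simp
qed

text \<open>With \<phi> = A C and C' = - D / A^2, the terms A' D / A^2 cancel in \<phi>'', leaving
  A'' C + l^2 C / A^3, a multiple of \<phi>. As C equals 1 at time 1, the ratio of the boundary
  values of \<phi> separates into a factor from \<open>A\<close> and one depending on \<theta>
  alone.\<close>

lemma expectation_exp_liouville:
  assumes l: "l > \<bar>\<kappa>\<bar>" and slope: "slope \<kappa> \<le> 0"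
    and q: "\<And>t. t \<in> {0..1} \<Longrightarrow> A'' t / A t + l\<^sup>2 * (1 / A t ^ 4) \<ge> 0"
  shows "expectation (\<lambda>\<omega>. exp (slope \<kappa> / 2 * (radial_part k W 1 \<omega>)\<^sup>2 - (V \<omega> + l\<^sup>2 * S \<omega>) / 2))
    = (A 1 / A 0) powr (real k / 2) * (cosh (l * \<theta>) - \<kappa> / l * sinh (l * \<theta>)) powr (- (real k / 2))"
proof -
  obtain r where *: "\<forall>t\<in>{0..1}. (r has_real_derivative - (1 / (A t)\<^sup>2)) (at t within {0..1}) \<and> r t \<ge> 0"
    and r01: "r 1 = 0" "r 0 = \<theta>" using primitive by auto
  then have r: "\<And>t. t \<in> {0..1} \<Longrightarrow> (r has_real_derivative - (1 / (A t)\<^sup>2)) (at t within {0..1})"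
    and r_nonneg: "\<And>t. t \<in> {0..1} \<Longrightarrow> r t \<ge> 0" by simp_all
  define C where "C t = cosh (l * r t) - \<kappa> / l * sinh (l * r t)" for t
  \<comment> \<open>Minus the derivative of \<open>C\<close> with respect to Liouville time;
    \<open>C\<close> and \<open>D\<close> form a linear first-order system.\<close>
  define D where "D t = l * sinh (l * r t) - \<kappa> * cosh (l * r t)" for t
  have l0: "l > 0" using l by linarith
  have C_deriv: "(C has_real_derivative - (D t / (A t)\<^sup>2)) (at t within {0..1})" if "t \<in> {0..1}" for t
  proof -
    have "(C has_real_derivative sinh (l * r t) * (l * - (1 / (A t)\<^sup>2))
        - \<kappa> / l * (cosh (l * r t) * (l * - (1 / (A t)\<^sup>2)))) (at t within {0..1})"
      unfolding C_def[abs_def]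
      by (rule DERIV_diff[OF has_field_derivative_cosh[OF DERIV_cmult[OF r[OF that]]]
            DERIV_cmult[OF has_field_derivative_sinh[OF DERIV_cmult[OF r[OF that]]]]])
    then show ?thesis
      by (rule DERIV_cong) (use l0 A_nz[OF that] in \<open>simp add: D_def field_simps\<close>)
  qed
  have D_deriv: "(D has_real_derivative - (l\<^sup>2 * C t / (A t)\<^sup>2)) (at t within {0..1})" if "t \<in> {0..1}" for t
  proof -
    have "(D has_real_derivative l * (cosh (l * r t) * (l * - (1 / (A t)\<^sup>2)))
        - \<kappa> * (sinh (l * r t) * (l * - (1 / (A t)\<^sup>2)))) (at t within {0..1})"
      unfolding D_def[abs_def]
      by (rule DERIV_diff[OF DERIV_cmult[OF has_field_derivative_sinh[OF DERIV_cmult[OF r[OF that]]]]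
            DERIV_cmult[OF has_field_derivative_cosh[OF DERIV_cmult[OF r[OF that]]]]])
    then show ?thesis
      by (rule DERIV_cong) (use l0 A_nz[OF that] in \<open>simp add: C_def field_simps power2_eq_square\<close>)
  qed
  \<comment> \<open>This is where l > |\<kappa>| enters: the sinh coefficient is at most 1, and sinh
    < cosh.\<close>
  have C_pos: "C t > 0" if "t \<in> {0..1}" for t
  proof -
    have s: "0 \<le> sinh (l * r t)" using r_nonneg[OF that] l0 by simp
    have "\<kappa> / l * sinh (l * r t) \<le> 1 * sinh (l * r t)"
      using l l0 s by (intro mult_right_mono) (auto simp: divide_simps)
    also have "\<dots> < cosh (l * r t)" using sinh_less_cosh_real by simp
    finally show ?thesis by (simp add: C_def)
  qed
  define \<phi> where "\<phi> t = A t * C t" for t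
  define \<phi>' where "\<phi>' t = A' t * C t - D t / A t" for t
  define q where "q t = A'' t / A t + l\<^sup>2 * (1 / A t ^ 4)" for t
  have "expectation (\<lambda>\<omega>. exp (\<phi>' 1 / \<phi> 1 / 2 * (radial_part k W 1 \<omega>)\<^sup>2
           - 1 / 2 * (LBINT t:{0..1}. q t * (radial_part k W t \<omega>)\<^sup>2)))
         = (\<phi> 1 / \<phi> 0) powr (real k / 2)"
  proof (rule expectation_exp_quadratic[of \<phi> \<phi>' q])
    fix t :: real assume t: "t \<in> {0..1}"
    show "(\<phi> has_real_derivative \<phi>' t) (at t within {0..1})"
      unfolding \<phi>_def[abs_def]
      by (rule DERIV_cong[OF DERIV_mult[OF A_deriv[OF t] C_deriv[OF t]]])
        (use A_nz[OF t] in \<open>simp add: \<phi>'_def power2_eq_square\<close>)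
    have "((\<lambda>t. A' t * C t - D t / A t) has_real_derivative
        (A'' t * C t + - (D t / (A t)\<^sup>2) * A' t)
        - (- (l\<^sup>2 * C t / (A t)\<^sup>2) * A t - D t * A' t) / (A t * A t)) (at t within {0..1})"
      by (rule DERIV_diff[OF DERIV_mult[OF A'_deriv[OF t] C_deriv[OF t]]
            DERIV_divide[OF D_deriv[OF t] A_deriv[OF t] A_nz[OF t]]])
    moreover have "(A'' t * C t + - (D t / (A t)\<^sup>2) * A' t)
        - (- (l\<^sup>2 * C t / (A t)\<^sup>2) * A t - D t * A' t) / (A t * A t) = q t * \<phi> t"
      using A_nz[OF t] by (simp add: q_def \<phi>_def field_simps power2_eq_square eval_nat_numeral)
    ultimately show "(\<phi>' has_real_derivative q t * \<phi> t) (at t within {0..1})"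
      unfolding \<phi>'_def[abs_def] by simp
    show "\<phi> t > 0" using A_pos[OF t] C_pos[OF t] by (simp add: \<phi>_def)
    show "q t \<ge> 0" using q[OF t] by (simp add: q_def)
  next
    show "continuous_on {0..1} q"
      unfolding q_def by (intro continuous_on_add continuous_on_mult continuous_on_const weight_cont ratio_cont)
    show "\<phi>' 1 \<le> 0"
      using slope A_pos[of 1] by (simp add: \<phi>'_def slope_def C_def D_def r01 divide_le_0_iff)
  qed
  moreover have "\<phi>' 1 / \<phi> 1 = slope \<kappa>"
    by (simp add: \<phi>'_def \<phi>_def slope_def C_def D_def r01)
  moreover have "(\<phi> 1 / \<phi> 0) powr (real k / 2)
    = (A 1 / A 0) powr (real k / 2) * (cosh (l * \<theta>) - \<kappa> / l * sinh (l * \<theta>)) powr (- (real k / 2))"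
  proof -
    have C0: "C 0 = cosh (l * \<theta>) - \<kappa> / l * sinh (l * \<theta>)" by (simp add: C_def r01)
    have eq: "\<phi> 1 / \<phi> 0 = (A 1 / A 0) / C 0" by (simp add: \<phi>_def C_def r01)
    show ?thesis
      unfolding eq C0[symmetric] powr_divide[of "A 1 / A 0"] powr_minus by (rule divide_inverse)
  qed
  moreover have "expectation (\<lambda>\<omega>. exp (slope \<kappa> / 2 * (radial_part k W 1 \<omega>)\<^sup>2
           - 1 / 2 * (LBINT t:{0..1}. q t * (radial_part k W t \<omega>)\<^sup>2)))
    = expectation (\<lambda>\<omega>. exp (slope \<kappa> / 2 * (radial_part k W 1 \<omega>)\<^sup>2 - (V \<omega> + l\<^sup>2 * S \<omega>) / 2))"
  proof (rule Bochner_Integration.integral_cong[OF refl])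
    fix \<omega> assume \<omega>: "\<omega> \<in> space M"
    have "(LBINT t:{0..1}. q t * (radial_part k W t \<omega>)\<^sup>2) = V \<omega> + l\<^sup>2 * S \<omega>"
      unfolding V_def S_def quad_add[OF ratio_cont weight_cont \<omega>, symmetric] by (simp add: quad_def q_def)
    then show "exp (slope \<kappa> / 2 * (radial_part k W 1 \<omega>)\<^sup>2
           - 1 / 2 * (LBINT t:{0..1}. q t * (radial_part k W t \<omega>)\<^sup>2))
      = exp (slope \<kappa> / 2 * (radial_part k W 1 \<omega>)\<^sup>2 - (V \<omega> + l\<^sup>2 * S \<omega>) / 2)" by simp
  qed
  ultimately show ?thesis by simp
qed

end

section \<open>Comparison with a constant weight\<close>

context liouville_weight
begin

text \<open>The bound on \<open>K\<close> makes the slope at \<open>- K\<close> nonpositive and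
  covers the parameter with slope zero; L > K keeps the Liouville solutions positive for every l
  \<ge> L; the last condition makes the potential nonnegative for these l and bounds |V| by
  \<open>L\<^sup>2 * S\<close>.\<close>

definition "admissible L K \<longleftrightarrow> K \<ge> \<bar>A' 1 * A 1\<bar> \<and> L > K \<and>
  (\<forall>t\<in>{0..1}. \<bar>A'' t / A t\<bar> \<le> L\<^sup>2 * (1 / A t ^ 4))"

lemma admissible_exists:
  assumes "K \<ge> \<bar>A' 1 * A 1\<bar>"
  shows "\<exists>L0. \<forall>L\<ge>L0. admissible L K"
proof -
  have cont: "continuous_on {0..1} (\<lambda>t. A'' t * A t ^ 3)"
    by (intro continuous_intros A''_cont A_cont)
  obtain Q where Q: "\<And>t. t \<in> {0..1} \<Longrightarrow> \<bar>A'' t * A t ^ 3\<bar> \<le> Q"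
    using compact_imp_bounded[OF compact_continuous_image[OF cont]] unfolding bounded_iff by force
  have "admissible L K" if L: "L \<ge> max (K + 1) (max 1 Q)" for L
    unfolding admissible_def
  proof (intro conjI ballI)
    fix t :: real assume t: "t \<in> {0..1}"
    have "\<bar>A'' t * A t ^ 3\<bar> \<le> Q" by (rule Q[OF t])
    also have "Q \<le> 1 * L" using L by simp
    also have "\<dots> \<le> L\<^sup>2" using L unfolding power2_eq_square by (intro mult_right_mono) auto
    finally have "\<bar>A'' t * A t ^ 3\<bar> / A t ^ 4 \<le> L\<^sup>2 / A t ^ 4" by (intro divide_right_mono) auto
    moreover have "\<bar>A'' t * A t ^ 3\<bar> / A t ^ 4 = \<bar>A'' t / A t\<bar>"
      using A_pos[OF t] by (simp add: abs_mult field_simps eval_nat_numeral)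
    ultimately show "\<bar>A'' t / A t\<bar> \<le> L\<^sup>2 * (1 / A t ^ 4)" by simp
  qed (use L assms in auto)
  then show ?thesis by blast
qed

text \<open>Distribution function of \<open>S\<close> under the tilted, unnormalised measure. The
  extra factor exp (- L^2 S / 2) compensates a negative \<open>V\<close> and keeps the density at
  most 1.\<close>

definition "H L K x = expectation (\<lambda>\<omega>. exp (slope (- K) / 2 * (radial_part k W 1 \<omega>)\<^sup>2
  - (V \<omega> + L\<^sup>2 * S \<omega>) / 2) * indicator {..x} (S \<omega>))"

definition "F x = expectation (\<lambda>\<omega>. indicator {..x} (S \<omega>) :: real)"

lemma slope_nonpos:
  assumes "admissible L K"
  shows "slope (- K) \<le> 0"
proof -
  have "A' 1 * A 1 - K \<le> 0" using assms unfolding admissible_def by linarith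
  moreover have "slope (- K) = (A' 1 * A 1 - K) / (A 1)\<^sup>2"
    using A_pos[of 1] by (simp add: slope_def field_simps power2_eq_square)
  ultimately show ?thesis by (simp add: divide_nonpos_nonneg)
qed

lemma abs_V_le:
  assumes "admissible L K" "\<omega> \<in> space M"
  shows "\<bar>V \<omega>\<bar> \<le> L\<^sup>2 * S \<omega>"
proof -
  have 0: "quad (\<lambda>_. 0) \<omega> = 0" by (simp add: quad_def)
  \<comment> \<open>The leading 0 brings the integrand into the shape of \<open>quad_add\<close>,
    which then acts as a scaling rule.\<close>
  have LS: "quad (\<lambda>t. 0 + L\<^sup>2 * (1 / A t ^ 4)) \<omega> = L\<^sup>2 * S \<omega>"
    by (subst quad_add[OF continuous_on_const weight_cont assms(2)]) (simp add: 0 S_def)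
  have nV: "quad (\<lambda>t. 0 + (- 1) * (A'' t / A t)) \<omega> = - V \<omega>"
    by (subst quad_add[OF continuous_on_const ratio_cont assms(2)]) (simp add: 0 V_def)
  have c: "continuous_on {0..1} (\<lambda>t. 0 + L\<^sup>2 * (1 / A t ^ 4))"
    "continuous_on {0..1} (\<lambda>t. 0 + (- 1) * (A'' t / A t))"
    by (intro continuous_on_add continuous_on_mult continuous_on_const weight_cont ratio_cont)+
  have b: "\<bar>A'' t / A t\<bar> \<le> L\<^sup>2 * (1 / A t ^ 4)" if "t \<in> {0..1}" for t
    using assms(1) that by (auto simp: admissible_def)
  have "V \<omega> \<le> L\<^sup>2 * S \<omega>"
    unfolding LS[symmetric] unfolding V_def
  proof (rule quad_mono[OF ratio_cont c(1) assms(2)])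
    show "A'' t / A t \<le> 0 + L\<^sup>2 * (1 / A t ^ 4)" if "t \<in> {0..1}" for t
      using b[OF that] by (simp only: add_0_left abs_le_iff)
  qed
  moreover have "- V \<omega> \<le> L\<^sup>2 * S \<omega>"
    unfolding LS[symmetric] nV[symmetric]
  proof (rule quad_mono[OF c(2) c(1) assms(2)])
    show "0 + (- 1) * (A'' t / A t) \<le> 0 + L\<^sup>2 * (1 / A t ^ 4)" if "t \<in> {0..1}" for t
      using b[OF that] by (simp only: add_0_left mult_minus1 abs_le_iff)
  qed
  ultimately show ?thesis by (simp add: abs_le_iff)
qed

lemma exponent_nonpos:
  assumes "admissible L K" "\<omega> \<in> space M" "c \<le> 0" "L \<le> l"
  shows "c / 2 * (radial_part k W 1 \<omega>)\<^sup>2 - (V \<omega> + l\<^sup>2 * S \<omega>) / 2 \<le> 0"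
proof -
  have L: "L > 0" using assms(1) by (auto simp: admissible_def)
  have "L\<^sup>2 * S \<omega> \<le> l\<^sup>2 * S \<omega>"
    using assms L S_nonneg by (intro mult_right_mono power_mono) auto
  then have "0 \<le> V \<omega> + l\<^sup>2 * S \<omega>" using abs_V_le[OF assms(1,2)] by linarith
  then have "0 \<le> (V \<omega> + l\<^sup>2 * S \<omega>) / 2" by simp
  moreover have "c / 2 * (radial_part k W 1 \<omega>)\<^sup>2 \<le> 0"
    using assms(3) by (auto intro: mult_nonpos_nonneg)
  ultimately show ?thesis by (metis diff_le_0_iff_le order_trans)
qed

lemma integrable_exponential:
  assumes "admissible L K" "c \<le> 0" "L \<le> l"
  shows "integrable M (\<lambda>\<omega>. exp (c / 2 * (radial_part k W 1 \<omega>)\<^sup>2 - (V \<omega> + l\<^sup>2 * S \<omega>) / 2))"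
  by (rule integrable_const_bound[of _ 1]) (use exponent_nonpos[OF assms(1) _ assms(2,3)] in auto)

lemma ratio_bound:
  assumes "admissible L K" "L \<le> l" "t \<in> {0..1}"
  shows "A'' t / A t + l\<^sup>2 * (1 / A t ^ 4) \<ge> 0"
proof -
  have L: "L > 0" using assms(1) by (auto simp: admissible_def)
  have "L\<^sup>2 * (1 / A t ^ 4) \<le> l\<^sup>2 * (1 / A t ^ 4)"
    using assms L A_pos by (intro mult_right_mono power_mono) auto
  moreover have "\<bar>A'' t / A t\<bar> \<le> L\<^sup>2 * (1 / A t ^ 4)"
    using assms by (auto simp: admissible_def)
  ultimately show ?thesis by linarith
qed

text \<open>The factor exp (- s S) merely replaces L^2 by L^2 + 2 s. For fixed \<open>L\<close> and
  \<open>K\<close> the transform depends on the weight only through \<theta> and the constant factor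
  (A(1) / A(0))^(k/2), the fact on which the comparison of weights rests.\<close>

lemma H_laplace:
  assumes adm: "admissible L K" and s: "s > 0"
  defines "l \<equiv> sqrt (L\<^sup>2 + 2 * s)"
  shows "mono (H L K)" "set_integrable lborel {0..} (\<lambda>x. exp (- s * x) * H L K x)"
    and "(LBINT x:{0..}. exp (- s * x) * H L K x)
      = (A 1 / A 0) powr (real k / 2) * ((cosh (l * \<theta>) + K / l * sinh (l * \<theta>)) powr (- (real k / 2)) / s)"
proof -
  have L: "L > 0" "L > K" "K \<ge> 0" using adm by (auto simp: admissible_def)
  have l: "l \<ge> L" "l\<^sup>2 = L\<^sup>2 + 2 * s"
    using s L by (auto simp: l_def intro: real_le_rsqrt)
  note lap = laplace_distribution_function[OF integrable_exponential[OF adm slope_nonpos[OF adm] order_refl]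
      _ S_measurable S_nonneg s, folded H_def]
  show "mono (H L K)" "set_integrable lborel {0..} (\<lambda>x. exp (- s * x) * H L K x)"
    using lap(1,2) by auto
  have "expectation (\<lambda>\<omega>. exp (slope (- K) / 2 * (radial_part k W 1 \<omega>)\<^sup>2
      - (V \<omega> + L\<^sup>2 * S \<omega>) / 2) * exp (- s * S \<omega>))
    = expectation (\<lambda>\<omega>. exp (slope (- K) / 2 * (radial_part k W 1 \<omega>)\<^sup>2 - (V \<omega> + l\<^sup>2 * S \<omega>) / 2))"
    unfolding l(2) mult_exp_exp
    by (intro Bochner_Integration.integral_cong refl arg_cong[where f = exp]) (simp add: field_simps)
  also have "\<dots> = (A 1 / A 0) powr (real k / 2)
      * (cosh (l * \<theta>) - (- K) / l * sinh (l * \<theta>)) powr (- (real k / 2))"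
    by (rule expectation_exp_liouville)
      (use L l slope_nonpos[OF adm] ratio_bound[OF adm l(1)] in auto)
  finally show "(LBINT x:{0..}. exp (- s * x) * H L K x)
      = (A 1 / A 0) powr (real k / 2) * ((cosh (l * \<theta>) + K / l * sinh (l * \<theta>)) powr (- (real k / 2)) / s)"
    using lap(3) by simp
qed

lemma H_le_F:
  assumes adm: "admissible L K"
  shows "H L K x \<le> F x"
proof -
  note e = exponent_nonpos[OF adm _ slope_nonpos[OF adm] order_refl]
  have i: "integrable M (\<lambda>\<omega>. indicator {..x} (S \<omega>) :: real)"
    by (rule integrable_const_bound[of _ 1]) (auto simp: indicator_def)
  show ?thesis unfolding H_def F_def
  proof (rule integral_mono[OF _ i])
    show "integrable M (\<lambda>\<omega>. exp (slope (- K) / 2 * (radial_part k W 1 \<omega>)\<^sup>2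
       - (V \<omega> + L\<^sup>2 * S \<omega>) / 2) * indicator {..x} (S \<omega>))"
      by (rule integrable_const_bound[of _ 1]) (use e in \<open>auto simp: indicator_def\<close>)
  qed (use e in \<open>auto simp: indicator_def\<close>)
qed

text \<open>
  Exponential Chebyshev inequality at \<open>l = a / x\<close>, the minimiser of \<open>l\<^sup>2 x / 2 - a l\<close>. The two
  transforms being compared differ by a factor \<open>1 + O(1 / l)\<close>.
\<close>

lemma F_le_H:
  assumes adm: "admissible L K"
  defines "a \<equiv> real k / 2 * \<theta>"
  shows "\<exists>C x0. x0 > 0 \<and> (\<forall>x. 0 < x \<and> x \<le> x0 \<longrightarrow>
    F x \<le> exp (L\<^sup>2 * x) * (H L K x + C * x * exp (- a\<^sup>2 / (2 * x))))"
proof -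
  define p where "p = real k / 2"
  define m where "m = (A 1 / A 0) powr p"
  \<comment> \<open>For this parameter the slope is 0, so the Liouville formula also computes the
    expectation without terminal factor.\<close>
  define \<kappa> where "\<kappa> = - (A' 1 * A 1)"
  have p: "p > 0" using k_pos by (simp add: p_def)
  have a: "a > 0" using p \<theta>_pos by (simp add: a_def p_def)
  have m0: "m \<ge> 0" by (simp add: m_def)
  have L: "L > 0" "L > K" "K \<ge> 0" "\<bar>\<kappa>\<bar> \<le> K" using adm by (auto simp: admissible_def \<kappa>_def)
  have slope0: "slope \<kappa> = 0" using A_pos[of 1] by (simp add: slope_def \<kappa>_def)
  \<comment> \<open>At \<tau> = tanh (l \<theta>) / l this is the difference of the transforms
    without and with terminal factor, divided by m cosh (l \<theta>)^(-p). It vanishes at 0 and is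
    differentiable there, hence O(\<tau>) = O(1 / l).\<close>
  define g where "g \<tau> = (1 - \<kappa> * \<tau>) powr (- p) - (1 + K * \<tau>) powr (- p)" for \<tau>
  obtain D where D: "(g has_real_derivative D) (at 0)"
  proof
    show "(g has_real_derivative p * \<kappa> + p * K) (at 0)"
      unfolding g_def[abs_def] by (auto intro!: derivative_eq_intros)
  qed
  have "((\<lambda>\<tau>. (g \<tau> - g 0) / (\<tau> - 0)) \<longlongrightarrow> D) (at 0)"
    using D by (simp add: has_field_derivative_iff)
  then have "\<forall>\<^sub>F \<tau> in at 0. \<bar>(g \<tau> - g 0) / (\<tau> - 0) - D\<bar> < 1"
    using tendstoD[of _ D "at 0" 1] by (simp add: dist_real_def)
  then obtain \<tau>0 where \<tau>0: "\<tau>0 > 0" "\<And>\<tau>. \<tau> \<noteq> 0 \<Longrightarrow> \<bar>\<tau>\<bar> < \<tau>0 \<Longrightarrow> \<bar>g \<tau> / \<tau> - D\<bar> < 1"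
    unfolding eventually_at by (auto simp: g_def dist_real_def)
  define G where "G = \<bar>D\<bar> + 1"
  have g_le: "g \<tau> \<le> G * \<tau>" if "0 \<le> \<tau>" "\<tau> < \<tau>0" for \<tau>
  proof (cases "\<tau> = 0")
    case False
    then have "g \<tau> / \<tau> \<le> G" using \<tau>0(2)[of \<tau>] that by (auto simp: G_def)
    then show ?thesis using False that by (simp add: divide_le_eq)
  qed (simp add: g_def)
  \<comment> \<open>The two entries guarantee l \<ge> L and 1 / l < \<tau>0 for l = a / x.\<close>
  define x0 where "x0 = min (a / L) (a * \<tau>0 / 2)"
  have x0: "x0 > 0" using a L \<tau>0(1) by (simp add: x0_def)
  define C where "C = m * 2 powr p * G / a"
  have main: "F x \<le> exp (L\<^sup>2 * x) * (H L K x + C * x * exp (- a\<^sup>2 / (2 * x)))"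
    if x: "0 < x" "x \<le> x0" for x
  proof -
    define l where "l = a / x"
    have l: "l \<ge> L" "1 / l < \<tau>0" "l > 0"
    proof -
      show "l \<ge> L" using x L by (simp add: l_def x0_def field_simps)
      have "x \<le> a * \<tau>0 / 2" using x by (simp add: x0_def)
      then show "1 / l < \<tau>0" using a \<tau>0(1) x by (simp add: l_def field_simps)
      show "l > 0" using a x by (simp add: l_def)
    qed
    let ?T = "\<lambda>\<omega>. exp (slope (- K) / 2 * (radial_part k W 1 \<omega>)\<^sup>2)"
    let ?U = "\<lambda>l \<omega>. exp (- (V \<omega> + l\<^sup>2 * S \<omega>) / 2)"
    let ?I = "\<lambda>\<omega>. indicator {..x} (S \<omega>) :: real"
    have UT: "?U l \<omega> * ?T \<omega> = exp (slope (- K) / 2 * (radial_part k W 1 \<omega>)\<^sup>2 - (V \<omega> + l\<^sup>2 * S \<omega>) / 2)" for l \<omega>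
    proof -
      have "- v / 2 + u = u - v / 2" for u v :: real by simp
      then show ?thesis unfolding mult_exp_exp by (rule arg_cong)
    qed
    have U0: "?U l \<omega> = exp (0 / 2 * (radial_part k W 1 \<omega>)\<^sup>2 - (V \<omega> + l\<^sup>2 * S \<omega>) / 2)" for l \<omega>
      by (simp only: div_0 mult_zero_left diff_0 minus_divide_left)
    have int: "integrable M (?U l)" "integrable M (\<lambda>\<omega>. ?U l \<omega> * ?T \<omega>)" if "L \<le> l" for l
    proof -
      show "integrable M (?U l)" unfolding U0
        by (rule integrable_exponential[OF adm _ that]) simp
      show "integrable M (\<lambda>\<omega>. ?U l \<omega> * ?T \<omega>)" unfolding UT
        by (rule integrable_exponential[OF adm slope_nonpos[OF adm] that])
    qed
    have intI: "integrable M (\<lambda>\<omega>. ?U L \<omega> * ?I \<omega>)" "integrable M (\<lambda>\<omega>. ?U L \<omega> * ?T \<omega> * ?I \<omega>)"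
    proof -
      show "integrable M (\<lambda>\<omega>. ?U L \<omega> * ?I \<omega>)"
        by (rule Bochner_Integration.integrable_bound[OF int(1)[OF order_refl]]) (auto simp: indicator_def)
      show "integrable M (\<lambda>\<omega>. ?U L \<omega> * ?T \<omega> * ?I \<omega>)"
        by (rule Bochner_Integration.integrable_bound[OF int(2)[OF order_refl]]) (auto simp: indicator_def)
    qed
    have T_le: "?T \<omega> \<le> 1" for \<omega>
      using slope_nonpos[OF adm] by (auto intro: mult_nonpos_nonneg)
    \<comment> \<open>On S \<le> x the exponent (V + L^2 S) / 2 is at most L^2 x, so undoing the
      tilt costs the factor exp (L^2 x).\<close>
    have "F x \<le> expectation (\<lambda>\<omega>. exp (L\<^sup>2 * x) * (?U L \<omega> * ?I \<omega>))"
      unfolding F_def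
    proof (rule integral_mono)
      show "integrable M ?I"
        by (rule integrable_const_bound[of _ 1]) (auto simp: indicator_def)
      show "integrable M (\<lambda>\<omega>. exp (L\<^sup>2 * x) * (?U L \<omega> * ?I \<omega>))"
        by (intro integrable_mult_right intI)
      fix \<omega> assume \<omega>: "\<omega> \<in> space M"
      show "?I \<omega> \<le> exp (L\<^sup>2 * x) * (?U L \<omega> * ?I \<omega>)"
      proof (cases "S \<omega> \<le> x")
        case True
        have "(v + u) / 2 \<le> u" if "\<bar>v\<bar> \<le> u" for v u :: real
          using abs_le_D1[OF that] by (simp add: field_simps)
        from this[OF abs_V_le[OF adm \<omega>]]
        have "(V \<omega> + L\<^sup>2 * S \<omega>) / 2 \<le> L\<^sup>2 * S \<omega>" .
        also have "\<dots> \<le> L\<^sup>2 * x" using True by (intro mult_left_mono) auto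
        finally have "(V \<omega> + L\<^sup>2 * S \<omega>) / 2 \<le> L\<^sup>2 * x" .
        moreover have "0 \<le> w + - v / 2" if "v / 2 \<le> w" for v w :: real
          using that by (simp add: field_simps)
        ultimately have "1 \<le> exp (L\<^sup>2 * x) * ?U L \<omega>"
          by (simp only: exp_add[symmetric] one_le_exp_iff)
        then show ?thesis using True by simp
      qed simp
    qed
    then have F_le: "F x \<le> exp (L\<^sup>2 * x) * expectation (\<lambda>\<omega>. ?U L \<omega> * ?I \<omega>)" by simp
    have "expectation (\<lambda>\<omega>. ?U L \<omega> * ?I \<omega>) - H L K x
        = expectation (\<lambda>\<omega>. ?U L \<omega> * ?I \<omega> - ?U L \<omega> * ?T \<omega> * ?I \<omega>)"
      unfolding H_def UT[symmetric] using intI by (simp add: Bochner_Integration.integral_diff)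
    \<comment> \<open>Chebyshev step: raising L to l costs at most exp (l^2 x / 2) on S \<le> x. The
      indicator can then be dropped because the terminal factor is at most 1, so the difference is
      nonnegative.\<close>
    also have "\<dots> \<le> expectation (\<lambda>\<omega>. exp (l\<^sup>2 * x / 2) * (?U l \<omega> - ?U l \<omega> * ?T \<omega>))"
    proof (rule integral_mono)
      show "integrable M (\<lambda>\<omega>. ?U L \<omega> * ?I \<omega> - ?U L \<omega> * ?T \<omega> * ?I \<omega>)"
        by (intro Bochner_Integration.integrable_diff intI)
      show "integrable M (\<lambda>\<omega>. exp (l\<^sup>2 * x / 2) * (?U l \<omega> - ?U l \<omega> * ?T \<omega>))"
        by (intro integrable_mult_right Bochner_Integration.integrable_diff int l)
      fix \<omega> assume \<omega>: "\<omega> \<in> space M"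
      show "?U L \<omega> * ?I \<omega> - ?U L \<omega> * ?T \<omega> * ?I \<omega> \<le> exp (l\<^sup>2 * x / 2) * (?U l \<omega> - ?U l \<omega> * ?T \<omega>)"
      proof (cases "S \<omega> \<le> x")
        case True
        have "(l\<^sup>2 - L\<^sup>2) * S \<omega> \<le> (l\<^sup>2 - L\<^sup>2) * x"
          using True l L by (intro mult_left_mono) (auto simp: power_mono)
        also have "\<dots> \<le> l\<^sup>2 * x" using x by (intro mult_right_mono) auto
        finally have "l\<^sup>2 * S \<omega> - L\<^sup>2 * S \<omega> \<le> l\<^sup>2 * x" by (simp only: left_diff_distrib)
        moreover have "- (v + b) / 2 \<le> y / 2 + - (v + c) / 2" if "c - b \<le> y" for v b c y :: real
          using that by (simp add: field_simps)
        ultimately have "- (V \<omega> + L\<^sup>2 * S \<omega>) / 2 \<le> l\<^sup>2 * x / 2 + - (V \<omega> + l\<^sup>2 * S \<omega>) / 2"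
          by blast
        then have "?U L \<omega> \<le> exp (l\<^sup>2 * x / 2) * ?U l \<omega>" by (simp only: exp_le_cancel_iff flip: exp_add)
        then have "?U L \<omega> * (1 - ?T \<omega>) \<le> (exp (l\<^sup>2 * x / 2) * ?U l \<omega>) * (1 - ?T \<omega>)"
          using T_le[of \<omega>] by (intro mult_right_mono) auto
        then show ?thesis using True by (simp add: algebra_simps)
      next
        case False
        have "0 \<le> exp (l\<^sup>2 * x / 2) * (?U l \<omega> * (1 - ?T \<omega>))"
          using T_le[of \<omega>] by (intro mult_nonneg_nonneg) auto
        then show ?thesis using False by (simp add: algebra_simps)
      qed
    qed
    also have "\<dots> = exp (l\<^sup>2 * x / 2) * (expectation (?U l) - expectation (\<lambda>\<omega>. ?U l \<omega> * ?T \<omega>))"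
      using int[OF l(1)] by (simp add: Bochner_Integration.integral_diff)
    also have "expectation (?U l) = m * (cosh (l * \<theta>) - \<kappa> / l * sinh (l * \<theta>)) powr (- p)"
      using expectation_exp_liouville[of \<kappa> l] L l ratio_bound[OF adm l(1)]
      unfolding slope0 U0 m_def p_def by auto
    also have "expectation (\<lambda>\<omega>. ?U l \<omega> * ?T \<omega>) = m * (cosh (l * \<theta>) - (- K) / l * sinh (l * \<theta>)) powr (- p)"
      using expectation_exp_liouville[of "- K" l] L l ratio_bound[OF adm l(1)] slope_nonpos[OF adm]
      unfolding UT m_def p_def by auto
    also have "m * (cosh (l * \<theta>) - \<kappa> / l * sinh (l * \<theta>)) powr (- p)
        - m * (cosh (l * \<theta>) - (- K) / l * sinh (l * \<theta>)) powr (- p)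
        = m * (cosh (l * \<theta>) powr (- p) * g (tanh (l * \<theta>) / l))"
    proof -
      define \<tau> where "\<tau> = tanh (l * \<theta>) / l"
      have cosh: "cosh (l * \<theta>) > 0" by simp
      have e: "cosh (l * \<theta>) - \<kappa> / l * sinh (l * \<theta>) = cosh (l * \<theta>) * (1 - \<kappa> * \<tau>)"
        "cosh (l * \<theta>) - (- K) / l * sinh (l * \<theta>) = cosh (l * \<theta>) * (1 + K * \<tau>)"
        using cosh by (auto simp: \<tau>_def tanh_def field_simps)
      show ?thesis
        unfolding e powr_mult g_def \<tau>_def[symmetric] by (simp only: right_diff_distrib)
    qed
    also have "exp (l\<^sup>2 * x / 2) * (m * (cosh (l * \<theta>) powr (- p) * g (tanh (l * \<theta>) / l)))
        \<le> exp (l\<^sup>2 * x / 2) * (m * (2 powr p * exp (- a * l) * (G * (1 / l))))"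
    proof (intro mult_left_mono m0 mult_mono)
      have "exp (l * \<theta>) / 2 \<le> cosh (l * \<theta>)" by (simp add: cosh_field_def)
      then have "cosh (l * \<theta>) powr (- p) \<le> (exp (l * \<theta>) / 2) powr (- p)"
        using p by (intro powr_mono2') auto
      also have "\<dots> = 2 powr p * exp (- a * l)"
        by (simp add: powr_divide powr_minus) (simp add: powr_def exp_minus a_def p_def field_simps)
      finally show "cosh (l * \<theta>) powr (- p) \<le> 2 powr p * exp (- a * l)" .
      have \<tau>: "0 \<le> tanh (l * \<theta>) / l" "tanh (l * \<theta>) / l \<le> 1 / l"
        using l \<theta>_pos tanh_real_lt_1[of "l * \<theta>"] by (auto simp: divide_right_mono)
      have "g (tanh (l * \<theta>) / l) \<le> G * (tanh (l * \<theta>) / l)"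
        using \<tau> l by (intro g_le) auto
      also have "\<dots> \<le> G * (1 / l)" using \<tau> by (intro mult_left_mono) (auto simp: G_def)
      finally show "g (tanh (l * \<theta>) / l) \<le> G * (1 / l)" .
      show "0 \<le> g (tanh (l * \<theta>) / l)"
      proof -
        have "\<kappa> * (tanh (l * \<theta>) / l) < 1"
        proof -
          have "\<kappa> * (tanh (l * \<theta>) / l) \<le> K * (1 / l)" using L \<tau> by (intro mult_mono) auto
          also have "\<dots> < 1" using L l by (simp add: field_simps)
          finally show ?thesis .
        qed
        moreover have "- \<kappa> * (tanh (l * \<theta>) / l) \<le> K * (tanh (l * \<theta>) / l)"
          using L \<tau> by (intro mult_right_mono) auto
        ultimately have "(1 + K * (tanh (l * \<theta>) / l)) powr (- p) \<le> (1 - \<kappa> * (tanh (l * \<theta>) / l)) powr (- p)"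
          using p by (intro powr_mono2') auto
        then show ?thesis by (simp add: g_def)
      qed
    qed auto
    also have "\<dots> = C * x * exp (- a\<^sup>2 / (2 * x))"
    proof -
      have "exp (l\<^sup>2 * x / 2) * exp (- a * l) = exp (- a\<^sup>2 / (2 * x))"
      proof -
        have "l\<^sup>2 * x / 2 + - a * l = - a\<^sup>2 / (2 * x)"
          using x by (simp add: l_def field_simps power2_eq_square)
        then show ?thesis by (simp only: flip: exp_add)
      qed
      moreover have "1 / l = x / a" by (simp add: l_def)
      ultimately show ?thesis by (simp add: C_def mult_ac)
    qed
    finally have "expectation (\<lambda>\<omega>. ?U L \<omega> * ?I \<omega>) \<le> H L K x + C * x * exp (- a\<^sup>2 / (2 * x))" by simp
    then have "exp (L\<^sup>2 * x) * expectation (\<lambda>\<omega>. ?U L \<omega> * ?I \<omega>)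
        \<le> exp (L\<^sup>2 * x) * (H L K x + C * x * exp (- a\<^sup>2 / (2 * x)))"
      by (intro mult_left_mono) auto
    with F_le show ?thesis by linarith
  qed
  show ?thesis by (intro exI[of _ C] exI[of _ x0] conjI allI impI x0 main) auto
qed

end

section \<open>Asymptotics of the distribution function\<close>

lemma levy_cdf_ge:
  assumes c: "c > 0" and x: "x > 0"
  shows "2 * sqrt x / (c * sqrt (2 * pi)) * exp (- c\<^sup>2 / (2 * x)) * (1 - x / c\<^sup>2) \<le> levy_cdf c x"
proof -
  define r where "r = sqrt x"
  have r: "r > 0" "r\<^sup>2 = x" using x by (auto simp: r_def)
  define y where "y = 1 - x / c\<^sup>2"
  have lower: "std_normal_density (c / r) * (1 / (c / r) - 1 / (c / r) ^ 3) \<le> normal_tail (c / r)"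
    using normal_tail_greater[of "c / r"] c r by simp
  have "1 / (c / r) - 1 / (c / r) ^ 3 = r / c * (1 - r\<^sup>2 / c\<^sup>2)"
    using c r(1) by (simp add: field_simps eval_nat_numeral)
  then have poly: "1 / (c / r) - 1 / (c / r) ^ 3 = r / c * y" by (simp only: r(2) y_def)
  have "std_normal_density (c / r) = exp (- c\<^sup>2 / (2 * x)) / sqrt (2 * pi)"
    using r by (simp add: std_normal_density_def power_divide)
  with lower have "exp (- c\<^sup>2 / (2 * x)) / sqrt (2 * pi) * (r / c * y) \<le> normal_tail (c / r)"
    by (simp only: poly)
  moreover have "2 * r / (c * sqrt (2 * pi)) * exp (- c\<^sup>2 / (2 * x)) * y
      = 2 * (exp (- c\<^sup>2 / (2 * x)) / sqrt (2 * pi) * (r / c * y))"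
    by (simp add: mult_ac)
  ultimately show ?thesis using x unfolding levy_cdf_def r_def y_def by simp
qed

section \<open>From almost everywhere bounds to pointwise bounds\<close>

lemma AE_lborel_interval_ex:
  fixes a b :: real
  assumes "AE y in lborel. P y" "a < b"
  shows "\<exists>y. a < y \<and> y < b \<and> P y"
proof (rule ccontr)
  assume "\<not> ?thesis"
  then have "AE y in lborel. y \<notin> {a<..<b}"
    using assms(1) by (auto elim!: eventually_mono)
  then have "emeasure lborel {a<..<b} = 0"
    by (subst (asm) AE_iff_measurable[of "{a<..<b}"]) auto
  then show False using assms(2) by simp
qed

text \<open>If the bound failed at \<open>x\<close>, it would fail on a whole interval to the right
  of \<open>x\<close>, because \<open>f\<close> does not decrease and \<open>u\<close> is
  continuous; such an interval is not a null set.\<close>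

lemma mono_le_if_AE_le:
  fixes f u :: "real \<Rightarrow> real"
  assumes "mono f" "AE y in lborel. a < y \<and> y < b \<longrightarrow> f y \<le> u y"
    and "isCont u x" "a < x" "x < b"
  shows "f x \<le> u x"
proof (rule ccontr)
  assume "\<not> f x \<le> u x"
  then have "\<forall>\<^sub>F y in at x. u y < f x"
    using assms(3) by (intro order_tendstoD(2)[of u "u x"]) (auto simp: isCont_def)
  then obtain d where d: "d > 0" "\<And>y. y \<noteq> x \<Longrightarrow> dist y x < d \<Longrightarrow> u y < f x"
    unfolding eventually_at by auto
  have "x < min b (x + d)" using assms(5) d(1) by simp
  from AE_lborel_interval_ex[OF assms(2) this]
  obtain y where y: "x < y" "y < b" "y < x + d" "f y \<le> u y" using assms(4) by auto
  then have "u y < f x" by (intro d(2)) (auto simp: dist_real_def)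
  also have "f x \<le> f y" using y(1) by (intro monoD[OF assms(1)]) simp
  finally show False using y(4) by simp
qed

text \<open>Mirror image: a failure at \<open>x\<close> would persist on an interval to the
  left.\<close>

lemma mono_ge_if_AE_ge:
  fixes f l :: "real \<Rightarrow> real"
  assumes "mono f" "AE y in lborel. a < y \<and> y < b \<longrightarrow> l y \<le> f y"
    and "isCont l x" "a < x" "x < b"
  shows "l x \<le> f x"
proof (rule ccontr)
  assume "\<not> l x \<le> f x"
  then have "\<forall>\<^sub>F y in at x. f x < l y"
    using assms(3) by (intro order_tendstoD(1)[of l "l x"]) (auto simp: isCont_def)
  then obtain d where d: "d > 0" "\<And>y. y \<noteq> x \<Longrightarrow> dist y x < d \<Longrightarrow> f x < l y"
    unfolding eventually_at by auto
  have "max a (x - d) < x" using assms(4) d(1) by simp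
  from AE_lborel_interval_ex[OF assms(2) this]
  obtain y where y: "a < y" "x - d < y" "y < x" "l y \<le> f y" using assms(5) by auto
  have "f y \<le> f x" using y(3) by (intro monoD[OF assms(1)]) simp
  also have "f x < l y" using y by (intro d(2)) (auto simp: dist_real_def)
  finally show False using y(4) by simp
qed

context liouville_weight
begin

lemma F_eq_prob: "F x = prob {\<omega> \<in> space M. S \<omega> \<le> x}"
proof -
  have "F x = expectation (indicator {\<omega> \<in> space M. S \<omega> \<le> x})"
    unfolding F_def by (intro Bochner_Integration.integral_cong) (auto simp: indicator_def)
  then show ?thesis by (simp add: Int_absorb1)
qed

lemma F_mono: "mono F"
  unfolding F_eq_prob[abs_def] by (intro monoI finite_measure_mono) auto

text \<open>For A = \<theta>^(-1/2) the weight 1 / A^4 is \<theta>^2 and 1 / A^2 is \<theta>, so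
  this constant weight has the same value of \<theta>.\<close>

lemma constant_weight: "liouville_weight M k W (\<lambda>_. 1 / sqrt \<theta>) (\<lambda>_. 0) (\<lambda>_. 0)"
  by (intro liouville_weight.intro multidim_brownian_motion_axioms liouville_weight_axioms.intro)
    (use k_pos \<theta>_pos in simp_all)

text \<open>The chain is H \<le> F \<le> exp (L^2 x) (H + O(x E)) for both weights, linked by H = m
  \<open>c.H\<close> almost everywhere. Relative to the main term sqrt x E every error is O(sqrt x)
  or a factor tending to 1.\<close>

lemma F_asymptotics:
  defines "a \<equiv> real k / 2 * \<theta>"
  shows "((\<lambda>x. F x / (sqrt x * exp (- a\<^sup>2 / (2 * x)))) \<longlongrightarrow>
    (A 1 / A 0) powr (real k / 2) * (2 powr (real k / 2) * 2 / (a * sqrt (2 * pi)))) (at_right 0)"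
proof -
  interpret c: liouville_weight M k W "\<lambda>_. 1 / sqrt \<theta>" "\<lambda>_. 0" "\<lambda>_. 0"
    by (rule constant_weight)
  define p where "p = real k / 2"
  define m where "m = (A 1 / A 0) powr p"
  define \<gamma> where "\<gamma> = 2 powr p * 2 / (a * sqrt (2 * pi))"
  define E where "E x = exp (- a\<^sup>2 / (2 * x))" for x
  have p: "p > 0" using k_pos by (simp add: p_def)
  have a: "a > 0" "a = p * \<theta>" using p \<theta>_pos by (simp_all add: a_def p_def)
  have m: "m \<ge> 0" by (simp add: m_def)
  have c\<theta>: "c.\<theta> = \<theta>"
  proof -
    have "(1 / (1 / sqrt \<theta>)\<^sup>2) = \<theta>" using \<theta>_pos by (simp add: power_divide)
    then show ?thesis unfolding c.\<theta>_def by (simp add: set_lebesgue_integral_def)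
  qed
  \<comment> \<open>For the constant weight the derivative of \<open>A\<close> is 0, so any
    nonnegative \<open>K\<close> is allowed there. Sharing \<open>K\<close> and \<open>L\<close>
    makes the two transforms differ by the factor \<open>m\<close> alone.\<close>
  define K where "K = \<bar>A' 1 * A 1\<bar>"
  obtain L1 where L1: "\<And>L. L \<ge> L1 \<Longrightarrow> admissible L K"
    using admissible_exists[of K] by (auto simp: K_def)
  obtain L2 where L2: "\<And>L. L \<ge> L2 \<Longrightarrow> c.admissible L K"
    using c.admissible_exists[of K] by (auto simp: K_def)
  define L where "L = max L1 L2"
  have adm: "admissible L K" and cadm: "c.admissible L K"
    using L1[of L] L2[of L] by (auto simp: L_def)
  have HH: "AE x in lborel. x \<ge> 0 \<longrightarrow> H L K x - m * c.H L K x = 0"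
  proof (rule Lerch[of 1])
    have i: "set_integrable lborel {0..} (\<lambda>x. exp (- s * x) * (m * c.H L K x))" if "s > 0" for s
      using set_integrable_mult_right[OF c.H_laplace(2)[OF cadm that], of m] by (simp add: mult_ac)
    have pos: "1 + real n > 0" for n by simp
    show "set_integrable lborel {0..} (\<lambda>x. exp (- 1 * x) * (H L K x - m * c.H L K x))"
      unfolding right_diff_distrib
      by (rule set_integral_diff(1)[OF H_laplace(2)[OF adm] i]) auto
    show "(LBINT x:{0..}. exp (- (1 + real n) * x) * (H L K x - m * c.H L K x)) = 0" for n
    proof -
      have "(LBINT x:{0..}. exp (- (1 + real n) * x) * (m * c.H L K x))
          = m * (LBINT x:{0..}. exp (- (1 + real n) * x) * c.H L K x)"
        by (subst set_integral_mult_right[symmetric]) (simp add: mult_ac)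
      then show ?thesis
        unfolding right_diff_distrib set_integral_diff(2)[OF H_laplace(2)[OF adm pos] i[OF pos]]
          H_laplace(3)[OF adm pos] c.H_laplace(3)[OF cadm pos] c\<theta>
        using \<theta>_pos by (simp add: m_def p_def)
    qed
  qed
  obtain C1 x1 where C1: "x1 > 0" "\<And>x. 0 < x \<Longrightarrow> x \<le> x1 \<Longrightarrow>
      c.F x \<le> exp (L\<^sup>2 * x) * (c.H L K x + C1 * x * E x)"
    using c.F_le_H[OF cadm] unfolding c\<theta> E_def a_def by blast
  obtain C2 x2 where C2: "x2 > 0" "\<And>x. 0 < x \<Longrightarrow> x \<le> x2 \<Longrightarrow>
      F x \<le> exp (L\<^sup>2 * x) * (H L K x + C2 * x * E x)"
    using F_le_H[OF adm] unfolding E_def a_def by blast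
  have "\<exists>C. AE x in lborel. 0 < x \<and> x \<le> 1 \<longrightarrow>
    \<bar>expectation (\<lambda>\<omega>. indicator {..x} (c.S \<omega>)) - 2 powr p * levy_cdf (p * \<theta>) x\<bar>
      \<le> C * x * exp (- (p * \<theta>)\<^sup>2 / (2 * x))"
  proof (rule distribution_of_cosh_transform[OF c.S_measurable c.S_nonneg p \<theta>_pos])
    fix l :: real assume l: "l > 0"
    \<comment> \<open>With \<kappa> = 0 and vanishing \<open>V\<close> the Liouville formula is the
      untilted Laplace transform, valid for every l > 0.\<close>
    have slope: "c.slope 0 = 0" by (simp add: c.slope_def)
    have V: "c.V \<omega> = 0" for \<omega> by (simp add: c.V_def quad_def)
    have "expectation (\<lambda>\<omega>. exp (c.slope 0 / 2 * (radial_part k W 1 \<omega>)\<^sup>2 - (c.V \<omega> + l\<^sup>2 * c.S \<omega>) / 2))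
      = (1 / sqrt \<theta> / (1 / sqrt \<theta>)) powr (real k / 2)
        * (cosh (l * c.\<theta>) - 0 / l * sinh (l * c.\<theta>)) powr (- (real k / 2))"
      by (rule c.expectation_exp_liouville) (use l slope in auto)
    then show "expectation (\<lambda>\<omega>. exp (- (l\<^sup>2 / 2) * c.S \<omega>)) = cosh (l * \<theta>) powr - p"
      using \<theta>_pos by (simp add: slope V c\<theta> p_def)
  qed
  then obtain C3 where C3: "AE x in lborel. 0 < x \<and> x \<le> 1 \<longrightarrow>
      \<bar>c.F x - 2 powr p * levy_cdf a x\<bar> \<le> C3 * x * E x"
    unfolding c.F_def a(2)[symmetric] E_def by blast
  define d where "d = min 1 (min x1 x2)"
  have d: "d > 0" "d \<le> 1" "d \<le> x1" "d \<le> x2" using C1(1) C2(1) by (auto simp: d_def)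
  \<comment> \<open>\<open>lo\<close> and \<open>up\<close> are the two bounds for \<open>F\<close>
    divided by sqrt x E. The lower one uses \<open>F_le_H\<close> for the constant weight and
    \<open>H_le_F\<close> for the given one; the upper one exchanges these roles.\<close>
  define lo where "lo x = m * (exp (- (L\<^sup>2 * x)) * (\<gamma> * (1 - x / a\<^sup>2) - C3 * sqrt x) - C1 * sqrt x)" for x
  define up where "up x = exp (L\<^sup>2 * x) * (m * (\<gamma> + C3 * sqrt x) + C2 * sqrt x)" for x
  have levy: "\<gamma> * sqrt x * E x * (1 - x / a\<^sup>2) \<le> 2 powr p * levy_cdf a x"
      "2 powr p * levy_cdf a x \<le> \<gamma> * sqrt x * E x" if "x > 0" for x
    using mult_left_mono[OF levy_cdf_ge[OF a(1) that], of "2 powr p"]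
      mult_left_mono[OF levy_cdf_le[OF a(1) that], of "2 powr p"]
    by (simp_all add: \<gamma>_def E_def mult_ac)
  have "AE x in lborel. 0 < x \<and> x < d \<longrightarrow>
      sqrt x * E x * lo x \<le> F x \<and> F x \<le> sqrt x * E x * up x"
    using HH C3
  proof eventually_elim
    case (elim x)
    show ?case
    proof
      assume x: "0 < x \<and> x < d"
      define g where "g = 2 powr p * levy_cdf a x"
      have H: "H L K x = m * c.H L K x" and G: "\<bar>c.F x - g\<bar> \<le> C3 * x * E x"
        using elim x d by (auto simp: g_def)
      have g: "\<gamma> * sqrt x * E x * (1 - x / a\<^sup>2) \<le> g" "g \<le> \<gamma> * sqrt x * E x"
        using levy x by (auto simp: g_def)
      have "F x \<le> exp (L\<^sup>2 * x) * (m * c.H L K x + C2 * x * E x)"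
        using C2(2)[of x] x d by (simp add: H)
      also have "\<dots> \<le> exp (L\<^sup>2 * x) * (m * (\<gamma> * sqrt x * E x + C3 * x * E x) + C2 * x * E x)"
      proof -
        have "c.H L K x \<le> \<gamma> * sqrt x * E x + C3 * x * E x"
          using c.H_le_F[OF cadm, of x] G g(2) by linarith
        then show ?thesis using m by (intro mult_left_mono add_right_mono) auto
      qed
      also have "\<dots> = sqrt x * E x * up x"
      proof -
        have "C3 * x * E x = C3 * (sqrt x * sqrt x) * E x" "C2 * x * E x = C2 * (sqrt x * sqrt x) * E x"
          using x by simp_all
        moreover have "e * (m * (g * r * z + c * (r * r) * z) + b * (r * r) * z)
            = r * z * (e * (m * (g + c * r) + b * r))" for e m g r z c b :: real
          by (simp add: algebra_simps)
        ultimately show ?thesis unfolding up_def by (simp only:)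
      qed
      finally have U: "F x \<le> sqrt x * E x * up x" .
      have "exp (- (L\<^sup>2 * x)) * c.F x \<le> exp (- (L\<^sup>2 * x)) * (exp (L\<^sup>2 * x) * (c.H L K x + C1 * x * E x))"
        using C1(2)[of x] x d by (intro mult_left_mono) auto
      also have "\<dots> = c.H L K x + C1 * x * E x" by (simp add: exp_minus)
      finally have h: "exp (- (L\<^sup>2 * x)) * c.F x - C1 * x * E x \<le> c.H L K x" by simp
      have "\<gamma> * sqrt x * E x * (1 - x / a\<^sup>2) - C3 * x * E x \<le> c.F x"
        using G g(1) by linarith
      then have "exp (- (L\<^sup>2 * x)) * (\<gamma> * sqrt x * E x * (1 - x / a\<^sup>2) - C3 * x * E x)
          \<le> exp (- (L\<^sup>2 * x)) * c.F x"
        by (intro mult_left_mono) auto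
      with h have "exp (- (L\<^sup>2 * x)) * (\<gamma> * sqrt x * E x * (1 - x / a\<^sup>2) - C3 * x * E x) - C1 * x * E x
          \<le> c.H L K x" by linarith
      then have "m * (exp (- (L\<^sup>2 * x)) * (\<gamma> * sqrt x * E x * (1 - x / a\<^sup>2) - C3 * x * E x) - C1 * x * E x)
          \<le> H L K x" unfolding H by (intro mult_left_mono m)
      also have "H L K x \<le> F x" by (rule H_le_F[OF adm])
      also have "m * (exp (- (L\<^sup>2 * x)) * (\<gamma> * sqrt x * E x * (1 - x / a\<^sup>2) - C3 * x * E x) - C1 * x * E x)
          = sqrt x * E x * lo x"
      proof -
        define y where "y = 1 - x / a\<^sup>2"
        have "C3 * x * E x = C3 * (sqrt x * sqrt x) * E x" "C1 * x * E x = C1 * (sqrt x * sqrt x) * E x"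
          using x by simp_all
        moreover have "m * (e * (g * r * z * y - c * (r * r) * z) - b * (r * r) * z)
            = r * z * (m * (e * (g * y - c * r) - b * r))" for e m g r z c b :: real
          by (simp add: algebra_simps)
        ultimately show ?thesis unfolding lo_def y_def[symmetric] by (simp only:)
      qed
      finally show "sqrt x * E x * lo x \<le> F x \<and> F x \<le> sqrt x * E x * up x" using U by blast
    qed
  qed
  then have ae: "AE x in lborel. 0 < x \<and> x < d \<longrightarrow> sqrt x * E x * lo x \<le> F x"
      "AE x in lborel. 0 < x \<and> x < d \<longrightarrow> F x \<le> sqrt x * E x * up x"
    by (auto elim: eventually_mono)
  have cont: "isCont (\<lambda>x. sqrt x * E x * lo x) x" "isCont (\<lambda>x. sqrt x * E x * up x) x" if "x > 0" for x
  proof -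
    have c: "isCont (\<lambda>x. sqrt x) x" "isCont (\<lambda>x. x) x" "isCont (\<lambda>x. w) x" for w
      by (simp_all add: isCont_real_sqrt)
    have 1: "isCont (\<lambda>x. - a\<^sup>2 / (2 * x)) x"
      using that by (intro isCont_divide isCont_mult c) simp
    have 2: "isCont (\<lambda>x. L\<^sup>2 * x) x" "isCont (\<lambda>x. - (L\<^sup>2 * x)) x"
      by (intro continuous_minus isCont_mult c)+
    have 3: "isCont (\<lambda>x. x / a\<^sup>2) x"
      using a(1) by (intro isCont_divide c) simp
    note exps = isCont_exp'[OF 1] isCont_exp'[OF 2(1)] isCont_exp'[OF 2(2)]
    show "isCont (\<lambda>x. sqrt x * E x * lo x) x" unfolding E_def lo_def
      by (intro isCont_mult isCont_diff c 3 exps)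
    show "isCont (\<lambda>x. sqrt x * E x * up x) x" unfolding E_def up_def
      by (intro isCont_mult isCont_add c exps)
  qed
  \<comment> \<open>Both bounds are continuous and \<open>F\<close> is monotone, so the exceptional
    null set disappears.\<close>
  have bounds: "\<forall>\<^sub>F x in at_right 0. lo x \<le> F x / (sqrt x * E x) \<and> F x / (sqrt x * E x) \<le> up x"
    using eventually_at_right_real[OF d(1)]
  proof eventually_elim
    case (elim x)
    then have x: "0 < x" "x < d" by auto
    have pos: "sqrt x * E x > 0" using x by (simp add: E_def)
    have "sqrt x * E x * lo x \<le> F x"
      by (rule mono_ge_if_AE_ge[OF F_mono ae(1) cont(1)[OF x(1)] x])
    moreover have "F x \<le> sqrt x * E x * up x"
      by (rule mono_le_if_AE_le[OF F_mono ae(2) cont(2)[OF x(1)] x])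
    ultimately show ?case using pos by (simp add: pos_le_divide_eq pos_divide_le_eq mult_ac)
  qed
  have sq: "(sqrt \<longlongrightarrow> 0) (at_right 0)" by real_asymp
  have id: "((\<lambda>x. x) \<longlongrightarrow> 0) (at_right (0 :: real))" by real_asymp
  have ex: "((\<lambda>x. exp (L\<^sup>2 * x)) \<longlongrightarrow> 1) (at_right 0)" "((\<lambda>x. exp (- (L\<^sup>2 * x))) \<longlongrightarrow> 1) (at_right 0)"
    by (auto intro!: tendsto_eq_intros)
  have "(lo \<longlongrightarrow> m * (1 * (\<gamma> * (1 - 0 / a\<^sup>2) - C3 * 0) - C1 * 0)) (at_right 0)"
    unfolding lo_def[abs_def]
    by (intro tendsto_mult tendsto_diff tendsto_const tendsto_divide sq id ex) (use a(1) in simp)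
  then have lo_lim: "(lo \<longlongrightarrow> m * \<gamma>) (at_right 0)" by simp
  have "(up \<longlongrightarrow> 1 * (m * (\<gamma> + C3 * 0) + C2 * 0)) (at_right 0)"
    unfolding up_def[abs_def]
    by (intro tendsto_mult tendsto_add tendsto_const sq ex)
  then have up_lim: "(up \<longlongrightarrow> m * \<gamma>) (at_right 0)" by simp
  have "((\<lambda>x. F x / (sqrt x * E x)) \<longlongrightarrow> m * \<gamma>) (at_right 0)"
    by (rule tendsto_sandwich[OF _ _ lo_lim up_lim]) (use bounds in \<open>auto elim: eventually_mono\<close>)
  then show ?thesis by (simp add: E_def m_def \<gamma>_def p_def)
qed

end

section \<open>Small ball probabilities\<close>

lemma C2_powr_unit_interval:
  fixes \<psi> \<psi>' \<psi>'' :: "real \<Rightarrow> real" and c :: real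
  assumes pos: "\<forall>t\<in>{0..1}. \<psi> t > 0"
    and d1: "\<forall>t\<in>{0..1}. (\<psi> has_real_derivative \<psi>' t) (at t within {0..1})"
    and d2: "\<forall>t\<in>{0..1}. (\<psi>' has_real_derivative \<psi>'' t) (at t within {0..1})"
    and cont: "continuous_on {0..1} \<psi>''"
  defines "f' \<equiv> \<lambda>t. c * \<psi> t powr (c - 1) * \<psi>' t"
    and "f'' \<equiv> \<lambda>t. c * ((c - 1) * \<psi> t powr (c - 1 - 1) * \<psi>' t) * \<psi>' t + \<psi>'' t * (c * \<psi> t powr (c - 1))"
  shows "\<And>t. t \<in> {0..1} \<Longrightarrow> ((\<lambda>t. \<psi> t powr c) has_real_derivative f' t) (at t within {0..1})"
    and "\<And>t. t \<in> {0..1} \<Longrightarrow> (f' has_real_derivative f'' t) (at t within {0..1})"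
    and "continuous_on {0..1} f''"
proof -
  have powr: "((\<lambda>t. \<psi> t powr b) has_real_derivative b * \<psi> t powr (b - 1) * \<psi>' t) (at t within {0..1})"
    if "t \<in> {0..1}" for b t
    by (rule DERIV_chain2[OF has_real_derivative_powr[OF bspec[OF pos that]] bspec[OF d1 that]])
  show "((\<lambda>t. \<psi> t powr c) has_real_derivative f' t) (at t within {0..1})" if "t \<in> {0..1}" for t
    unfolding f'_def by (rule powr[OF that])
  show "(f' has_real_derivative f'' t) (at t within {0..1})" if "t \<in> {0..1}" for t
    unfolding f'_def f''_def by (rule DERIV_mult[OF DERIV_cmult[OF powr[OF that]] bspec[OF d2 that]])
  have "continuous_on {0..1} \<psi>" "continuous_on {0..1} \<psi>'"
    by (rule DERIV_continuous_on, erule bspec[OF d1]) (rule DERIV_continuous_on, erule bspec[OF d2])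
  moreover have "continuous_on {0..1} (\<lambda>t. \<psi> t powr b)" for b
    by (rule DERIV_continuous_on, erule powr)
  ultimately show "continuous_on {0..1} f''"
    unfolding f''_def by (intro continuous_on_add continuous_on_mult continuous_on_const cont)
qed

theorem proposition1:
  fixes M :: "'a measure" and k :: nat and W :: "nat \<Rightarrow> real \<Rightarrow> 'a \<Rightarrow> real"
    and \<psi> :: "real \<Rightarrow> real" and \<theta> :: real
  assumes "k \<ge> 1"
    and "multidim_brownian_motion M k W"
    and "\<And>t. t \<in> {0..1} \<Longrightarrow> \<psi> t > 0"
    and "C2_on_unit_interval \<psi>"
    and "\<theta> = (LBINT t:{0..1}. sqrt (\<psi> t))"
  shows "asymp_equiv
           (\<lambda>\<epsilon>. measure M {\<omega> \<in> space M. weighted_L2_norm \<psi> (\<lambda>t. radial_part k W t \<omega>) \<le> \<epsilon>})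
           (at_right 0)
           (\<lambda>\<epsilon>. 2 powr ((real k + 3) / 2) * \<psi> 0 powr (real k / 8)
                  / (sqrt pi * real k * \<theta> * \<psi> 1 powr (real k / 8))
                * \<epsilon> * exp (- ((real k)\<^sup>2 * \<theta>\<^sup>2 / 8) * \<epsilon> powi (-2)))"
proof -
  interpret multidim_brownian_motion M k W by fact
  obtain \<psi>' \<psi>'' where \<psi>': "\<forall>t\<in>{0..1}. (\<psi> has_real_derivative \<psi>' t) (at t within {0..1})"
    "\<forall>t\<in>{0..1}. (\<psi>' has_real_derivative \<psi>'' t) (at t within {0..1})"
    and \<psi>'': "continuous_on {0..1} \<psi>''"
    using assms(4) unfolding C2_on_unit_interval_def by auto
  have \<psi>_pos: "\<forall>t\<in>{0..1}. \<psi> t > 0" using assms(3) by simp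
  define A where "A t = \<psi> t powr (- 1 / 4)" for t
  note A_C2 = C2_powr_unit_interval[OF \<psi>_pos \<psi>' \<psi>'', where c = "- 1 / 4", folded A_def]
  interpret B: liouville_weight M k W A
    "\<lambda>t. - 1 / 4 * \<psi> t powr (- 1 / 4 - 1) * \<psi>' t"
    "\<lambda>t. - 1 / 4 * ((- 1 / 4 - 1) * \<psi> t powr (- 1 / 4 - 1 - 1) * \<psi>' t) * \<psi>' t
       + \<psi>'' t * (- 1 / 4 * \<psi> t powr (- 1 / 4 - 1))"
  proof (intro liouville_weight.intro liouville_weight_axioms.intro)
    show "A t > 0" if "t \<in> {0..1}" for t using assms(3)[OF that] by (simp add: A_def)
  qed (fact assms(1) assms(2) | rule A_C2 | assumption)+
  have A_powers: "1 / A t ^ 4 = \<psi> t" "1 / (A t)\<^sup>2 = sqrt (\<psi> t)" if "t \<in> {0..1}" for t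
  proof -
    have pos: "\<psi> t > 0" using assms(3)[OF that] .
    have "A t ^ 4 = \<psi> t powr (- 1)" "(A t)\<^sup>2 = \<psi> t powr (- (1 / 2))"
      using pos by (simp_all add: A_def powr_power)
    moreover have "\<psi> t powr (- 1) = 1 / \<psi> t" "\<psi> t powr (- (1 / 2)) = 1 / sqrt (\<psi> t)"
      using powr_minus_divide[of "\<psi> t" 1] powr_minus_divide[of "\<psi> t" "1 / 2"] pos
      by (simp_all only: powr_half_sqrt powr_one less_imp_le)
    ultimately show "1 / A t ^ 4 = \<psi> t" "1 / (A t)\<^sup>2 = sqrt (\<psi> t)" by simp_all
  qed
  have \<theta>: "B.\<theta> = \<theta>"
    unfolding B.\<theta>_def assms(5) by (rule set_lebesgue_integral_cong) (use A_powers in auto)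
  have S: "B.S \<omega> = (LBINT t:{0..1}. (radial_part k W t \<omega>)\<^sup>2 * \<psi> t)" for \<omega>
    unfolding B.S_def quad_def by (rule set_lebesgue_integral_cong) (use A_powers in auto)
  have \<theta>_pos: "\<theta> > 0" using B.\<theta>_pos \<theta> by simp
  have pos: "\<psi> 0 > 0" "\<psi> 1 > 0" using assms(3) by auto
  define a where "a = real k / 2 * \<theta>"
  define c where "c = 2 powr ((real k + 3) / 2) * \<psi> 0 powr (real k / 8)
                  / (sqrt pi * real k * \<theta> * \<psi> 1 powr (real k / 8))"
  have c: "c > 0" using pos assms(1) \<theta>_pos by (simp add: c_def)
  \<comment> \<open>The exponent k / 8 is 1/4, from \<open>A\<close>, times k / 2. The power of 2
    arises from 2 / (a sqrt (2 pi)) with a = k \<theta> / 2, which contributes 2 sqrt 2 =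
    2^(3/2).\<close>
  have c_eq: "(A 1 / A 0) powr (real k / 2) * (2 powr (real k / 2) * 2 / (a * sqrt (2 * pi))) = c"
  proof -
    have "(A 1 / A 0) powr (real k / 2) = \<psi> 0 powr (real k / 8) / \<psi> 1 powr (real k / 8)"
    proof -
      have "(- 1 / 4) * (real k / 2) = - (real k / 8)" by simp
      then show ?thesis
        by (simp only: A_def powr_divide powr_powr powr_minus inverse_eq_divide) simp
    qed
    moreover have "2 powr (real k / 2) * 2 / (a * sqrt (2 * pi)) = 2 powr ((real k + 3) / 2) / (sqrt pi * real k * \<theta>)"
    proof -
      define z where "z = (2 :: real) powr (real k / 2)"
      have "(real k + 3) / 2 = real k / 2 + (1 + 1 / 2)" by simp
      then have "(2 :: real) powr ((real k + 3) / 2) = z * (2 * sqrt 2)"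
        by (simp only: powr_add z_def powr_half_sqrt) simp
      moreover have "z * 2 / (a * sqrt (2 * pi)) = z * (2 * sqrt 2) / (sqrt pi * real k * \<theta>)"
        using assms(1) \<theta>_pos by (simp add: a_def real_sqrt_mult divide_simps)
      ultimately show ?thesis by (simp only: z_def)
    qed
    ultimately show ?thesis by (simp add: c_def mult_ac)
  qed
  have "((\<lambda>x. B.F x / (sqrt x * exp (- a\<^sup>2 / (2 * x)))) \<longlongrightarrow> c) (at_right 0)"
    using B.F_asymptotics unfolding \<theta> a_def[symmetric] c_eq .
  \<comment> \<open>Norm at most \<epsilon> means S \<le> \<epsilon>^2, so x = \<epsilon>^2 is
    substituted; sqrt x becomes the linear factor \<epsilon>.\<close>
  moreover have "filterlim (\<lambda>\<epsilon>::real. \<epsilon>\<^sup>2) (at_right 0) (at_right 0)" by real_asymp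
  ultimately have "((\<lambda>\<epsilon>. B.F (\<epsilon>\<^sup>2) / (sqrt (\<epsilon>\<^sup>2) * exp (- a\<^sup>2 / (2 * \<epsilon>\<^sup>2)))) \<longlongrightarrow> c) (at_right 0)"
    by (rule filterlim_compose)
  then have "((\<lambda>\<epsilon>. B.F (\<epsilon>\<^sup>2) / (sqrt (\<epsilon>\<^sup>2) * exp (- a\<^sup>2 / (2 * \<epsilon>\<^sup>2))) / c) \<longlongrightarrow> c / c) (at_right 0)"
    using c by (intro tendsto_divide tendsto_const) auto
  then have lim: "((\<lambda>\<epsilon>. B.F (\<epsilon>\<^sup>2) / (sqrt (\<epsilon>\<^sup>2) * exp (- a\<^sup>2 / (2 * \<epsilon>\<^sup>2))) / c) \<longlongrightarrow> 1) (at_right 0)"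
    using c by simp
  show ?thesis
    unfolding c_def[symmetric]
  proof (rule asymp_equivI', rule Lim_transform_eventually[OF lim])
    show "\<forall>\<^sub>F \<epsilon> in at_right 0. B.F (\<epsilon>\<^sup>2) / (sqrt (\<epsilon>\<^sup>2) * exp (- a\<^sup>2 / (2 * \<epsilon>\<^sup>2))) / c
      = measure M {\<omega> \<in> space M. weighted_L2_norm \<psi> (\<lambda>t. radial_part k W t \<omega>) \<le> \<epsilon>}
        / (c * \<epsilon> * exp (- ((real k)\<^sup>2 * \<theta>\<^sup>2 / 8) * \<epsilon> powi (-2)))"
      using eventually_at_right_less[of 0]
    proof eventually_elim
      case (elim \<epsilon>)
      have norm: "weighted_L2_norm \<psi> (\<lambda>t. radial_part k W t \<omega>) \<le> \<epsilon> \<longleftrightarrow> B.S \<omega> \<le> \<epsilon>\<^sup>2" for \<omega>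
        unfolding weighted_L2_norm_def S[symmetric]
        using elim real_sqrt_le_iff[of "B.S \<omega>" "\<epsilon>\<^sup>2"] by simp
      define b where "b = (real k)\<^sup>2 * \<theta>\<^sup>2"
      have sq: "a\<^sup>2 = b / 4" by (simp add: a_def b_def power_mult_distrib power_divide)
      have inv: "\<epsilon> powi (-2) = inverse (\<epsilon>\<^sup>2)" by (simp add: power_int_minus)
      have "- (b / 4) / (2 * y) = - (b / 8) * inverse y" for y :: real
        by (cases "y = 0") (simp_all add: field_simps)
      then have exponent: "- a\<^sup>2 / (2 * \<epsilon>\<^sup>2) = - (b / 8) * \<epsilon> powi (-2)"
        unfolding sq inv .
      have "sqrt (\<epsilon>\<^sup>2) = \<epsilon>" using elim by simp
      moreover have "p / (\<epsilon> * e) / c = p / (c * \<epsilon> * e)" for p e by (simp add: mult_ac)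
      ultimately show ?case
        unfolding norm B.F_eq_prob exponent b_def[symmetric] by (simp only:)
    qed
  qed
qed

end
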